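(* Let $G$ be a finite simple graph of order $n$. If $\sigma^*(G)\geq n$ (the value $\sigma^*(G)=+\infty$ being allowed), then either $G$ has a 2-proper partition $\mathcal{P}$ with $|\mathcal{P}|\leq \alpha^*(G)$, or $G$ is isomorphic to a graph in $\{K_2, F_5\}\cup\mathcal{F}_{11}\cup\mathcal{F}_{12}\cup\mathcal{H}_n$.
   Context: All graphs are finite and simple. A graph $H$ is 2-connected if $|V(H)|>2$ and $H-S$ is connected for every $S\subseteq V(H)$ with $|S|<2$. A 2-proper partition of $G$ is a partition $\mathcal{P}$ of $V(G)$ such that every $P\in\mathcal{P}$ induces a 2-connected subgraph of $G$. For an independent set $I$ of $G$, let $\delta_G(I)=\min\{d_G(u): u\in I\}$ and $w_G(I)=\sum_{u\in I}d_G(u)$. $I$ is large if $|I|\geq \delta_G(I)+1$, and light if $w_G(I)\leq |V(G)|-1$. $\sigma^*(G)=\min\{w_G(I): I \text{ a large independent set of } G\}$, with $\sigma^*(G)=+\infty$ if $G$ has no large independent set. $\alpha^*(G)=\max\{|I|: I \text{ a light independent set of } G\}$. Exceptional graphs: $F_5$ has vertex set $\{a,b_1,b_2,b_3,b_4\}$ and edge set $\{ab_1,ab_2,ab_3,ab_4,b_1b_2,b_3b_4\}$. $\mathcal{F}_{11}$ is the family of graphs with vertex set $\{a,b_1,b_2,c_1,\dots,c_8\}$ and edge set $\{ac_i: i\in[8]\}\cup\{b_1c_i: i\in[4]\}\cup\{b_2c_i: 5\le i\le 8\}\cup\{c_1c_2,c_3c_4,c_5c_6,c_7c_8\}\cup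 L$ where $L\subseteq\{ab_1,ab_2\}$. $\mathcal{F}_{12}$ is the family of graphs with vertex set $\{a,b_1,b_2,c_1,\dots,c_9\}$ and edge set $\{ac_i: i\in[8]\}\cup\{b_1c_i: i\in[4]\}\cup\{b_2c_i: 5\le i\le 8\}\cup\{c_1c_2,c_3c_4,c_5c_6,c_7c_9,c_8c_9\}\cup L$ where $L\subseteq\{ab_1,ab_2,ac_9,b_2c_9\}$ and $L\cap\{ac_9,b_2c_9\}\neq\emptyset$. For integers $2\le s\le t$, let $S_1,S_2$ be disjoint complete graphs of orders $s-1$ and $t-1$; $H_{s,t}$ is obtained from $S_1\cup S_2$ by adding new vertices $a,b,c_1,c_2$ and the edges $\{ax,bx: x\in V(S_1)\cup V(S_2)\}\cup\{ab,ac_1,ac_2,c_1c_2\}$; $H_{s,t}^-=H_{s,t}-ab$. For $n\ge 6$, $\mathcal{H}_n=\{H_{s,t},H_{s,t}^-: 2\le s\le t,\ s+t+2=n\}$. *)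

theory Defs
  imports Main "HOL-Library.Extended_Nat"
begin

definition graph :: "'a set \<Rightarrow> 'a set set \<Rightarrow> bool" where
  "graph V E \<longleftrightarrow> finite V \<and> (\<forall>e\<in>E. \<exists>u v. u \<in> V \<and> v \<in> V \<and> u \<noteq> v \<and> e = {u, v})"

definition deg :: "'a set set \<Rightarrow> 'a \<Rightarrow> nat" where
  "deg E u = card {v. {u, v} \<in> E}"

definition connected_in :: "'a set set \<Rightarrow> 'a set \<Rightarrow> bool" where
  "connected_in E X \<longleftrightarrow>
     (\<forall>u\<in>X. \<forall>v\<in>X. (\<lambda>x y. x \<in> X \<and> y \<in> X \<and> {x, y} \<in> E)\<^sup>*\<^sup>* u v)"

definition two_connected_in :: "'a set set \<Rightarrow> 'a set \<Rightarrow> bool" where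
  "two_connected_in E X \<longleftrightarrow>
     card X > 2 \<and> (\<forall>S. S \<subseteq> X \<and> card S < 2 \<longrightarrow> connected_in E (X - S))"

definition is_partition :: "'a set \<Rightarrow> 'a set set \<Rightarrow> bool" where
  "is_partition V P \<longleftrightarrow> (\<forall>X\<in>P. X \<noteq> {}) \<and> \<Union>P = V \<and>
     (\<forall>X\<in>P. \<forall>Y\<in>P. X \<noteq> Y \<longrightarrow> X \<inter> Y = {})"

definition two_proper_partition :: "'a set \<Rightarrow> 'a set set \<Rightarrow> 'a set set \<Rightarrow> bool" where
  "two_proper_partition V E P \<longleftrightarrow> is_partition V P \<and> (\<forall>X\<in>P. two_connected_in E X)"

definition indep :: "'a set \<Rightarrow> 'a set set \<Rightarrow> 'a set \<Rightarrow> bool" where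
  "indep V E I \<longleftrightarrow> I \<subseteq> V \<and> (\<forall>u\<in>I. \<forall>v\<in>I. {u, v} \<notin> E)"

text \<open>delta(I) = min degree over I (for I empty it is +infinity, so I is not large).\<close>
definition delta_set :: "'a set set \<Rightarrow> 'a set \<Rightarrow> nat" where
  "delta_set E I = Min (deg E ` I)"

definition weight :: "'a set set \<Rightarrow> 'a set \<Rightarrow> nat" where
  "weight E I = (\<Sum>u\<in>I. deg E u)"

definition large :: "'a set set \<Rightarrow> 'a set \<Rightarrow> bool" where
  "large E I \<longleftrightarrow> I \<noteq> {} \<and> card I \<ge> delta_set E I + 1"

definition light :: "'a set \<Rightarrow> 'a set set \<Rightarrow> 'a set \<Rightarrow> bool" where
  "light V E I \<longleftrightarrow> int (weight E I) \<le> int (card V) - 1"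

text \<open>sigma*(G): infimum over large independent sets; Inf {} = \<infinity>.\<close>
definition sigma_star :: "'a set \<Rightarrow> 'a set set \<Rightarrow> enat" where
  "sigma_star V E = (INF I \<in> {I. indep V E I \<and> large E I}. enat (weight E I))"

definition alpha_star :: "'a set \<Rightarrow> 'a set set \<Rightarrow> nat" where
  "alpha_star V E = Max {card I | I. indep V E I \<and> light V E I}"

definition isomorphic :: "'a set \<Rightarrow> 'a set set \<Rightarrow> 'b set \<Rightarrow> 'b set set \<Rightarrow> bool" where
  "isomorphic V E V' E' \<longleftrightarrow> (\<exists>f. bij_betw f V V' \<and>
     (\<forall>u\<in>V. \<forall>v\<in>V. {u, v} \<in> E \<longleftrightarrow> {f u, f v} \<in> E'))"

definition K2 :: "nat set \<times> nat set set" where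
  "K2 = ({0, 1}, {{0, 1}})"

text \<open>F5: a = 0, b_i = i.\<close>
definition F5 :: "nat set \<times> nat set set" where
  "F5 = ({0..4}, {{0,1},{0,2},{0,3},{0,4},{1,2},{3,4}})"

text \<open>F11 family: a = 0, b1 = 1, b2 = 2, c_i = i + 2 (i = 1..8).\<close>
definition F11_base :: "nat set set" where
  "F11_base = {{0, i + 2} | i. i \<in> {1..8}} \<union> {{1, i + 2} | i. i \<in> {1..4}}
     \<union> {{2, i + 2} | i. i \<in> {5..8}} \<union> {{3,4},{5,6},{7,8},{9,10}}"

definition F11 :: "(nat set \<times> nat set set) set" where
  "F11 = {({0..10}, F11_base \<union> L) | L. L \<subseteq> {{0,1},{0,2}}}"

text \<open>F12 family: a = 0, b1 = 1, b2 = 2, c_i = i + 2 (i = 1..9).\<close>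
definition F12_base :: "nat set set" where
  "F12_base = {{0, i + 2} | i. i \<in> {1..8}} \<union> {{1, i + 2} | i. i \<in> {1..4}}
     \<union> {{2, i + 2} | i. i \<in> {5..8}} \<union> {{3,4},{5,6},{7,8},{9,11},{10,11}}"

definition F12 :: "(nat set \<times> nat set set) set" where
  "F12 = {({0..11}, F12_base \<union> L) | L. L \<subseteq> {{0,1},{0,2},{0,11},{2,11}}
                                         \<and> L \<inter> {{0,11},{2,11}} \<noteq> {}}"

text \<open>H_{s,t} (ab = True) and H^-_{s,t} (ab = False): a = 0, b = 1, c1 = 2, c2 = 3,
  S1 = {4..<s+3} (order s-1), S2 = {s+3..<s+t+2} (order t-1).\<close>
definition H_S1 :: "nat \<Rightarrow> nat set" where "H_S1 s = {4..<s+3}"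
definition H_S2 :: "nat \<Rightarrow> nat \<Rightarrow> nat set" where "H_S2 s t = {s+3..<s+t+2}"

definition H_graph :: "nat \<Rightarrow> nat \<Rightarrow> bool \<Rightarrow> nat set \<times> nat set set" where
  "H_graph s t ab = ({0..<s+t+2},
      {{x, y} | x y. x \<in> H_S1 s \<and> y \<in> H_S1 s \<and> x \<noteq> y}
    \<union> {{x, y} | x y. x \<in> H_S2 s t \<and> y \<in> H_S2 s t \<and> x \<noteq> y}
    \<union> {{0, x} | x. x \<in> H_S1 s \<union> H_S2 s t}
    \<union> {{1, x} | x. x \<in> H_S1 s \<union> H_S2 s t}
    \<union> (if ab then {{0, 1}} else {})
    \<union> {{0, 2}, {0, 3}, {2, 3}})"

definition H_family :: "nat \<Rightarrow> (nat set \<times> nat set set) set" where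
  "H_family n = (if n \<ge> 6 then {H_graph s t ab | s t ab. 2 \<le> s \<and> s \<le> t \<and> s + t + 2 = n} else {})"

definition exceptional :: "nat \<Rightarrow> (nat set \<times> nat set set) set" where
  "exceptional n = {K2, F5} \<union> F11 \<union> F12 \<union> H_family n"

end

theory Submission
  imports Defs
begin

text \<open>The proof is an induction on the order of the graph. An end block \<open>B\<close> with cut vertex \<open>y\<close> is split
  off. If \<open>B - y\<close> is 2-connected, then \<open>B - y\<close> becomes a part, and \<open>y\<close> stays behind as a marked vertex: it
  must not be used in a light independent set any more, and it may later be given back to \<open>B\<close>. If \<open>B - y\<close>
  has a cut vertex \<open>f\<close>, then \<open>B\<close> itself becomes a part, and two vertices \<open>u\<close>, \<open>u'\<close> of \<open>B - y\<close> separated by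
  \<open>f\<close> satisfy \<open>d(u) + d(u') \<le> \<bar>B - y\<bar> + 1\<close>. This slack pays for the edges from \<open>y\<close> to the rest, so that
  the rest satisfies the hypothesis of the theorem on its own. A light independent set with one vertex for
  each part is maintained. The exceptional graphs arise when the end block is a triangle or when the rest
  is itself exceptional; in the latter case the slack is used up almost completely, which determines the
  graph.\<close>

text \<open>That \<open>sigma_star\<close> is at least the order means that no light independent set
  is large: each vertex of a light set has degree at least the size of the set. Subgraphs do not
  inherit this, since with a side of a cut vertex both the order and some degrees go down. What
  makes the induction run is a vertex of the deleted side that extends every light set of the rest
  to a light set of the whole. The extension gains one in size and so one in the degree bound; this
  one is spent either on a new mark or on a lost edge to the cut vertex.

  Exceptional graphs are tight: each contains a light set \<open>I\<close> with a vertex of degree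
  at most \<open>card I\<close>. Therefore a single mark, or a second component, excludes them, and
  an exceptional rest forces its tight vertices to be adjacent to the cut vertex. This explains the
  orders: 11 = 5 + 1 + 5, two copies of F5 and a cut vertex seeing their outer vertices, and 12 = 5
  + 1 + 6, where one copy is replaced by a six-vertex variant. The process stops there: on top of
  F11 or F12 the degrees required in the next end block exceed 3, and then it can always be
  divided.\<close>

locale loopless =
  fixes E :: "'a set set"
  assumes no_loop: "{v} \<notin> E"
begin

section \<open>Degrees, lightness and separations relative to a vertex set\<close>

definition nb :: "'a set \<Rightarrow> 'a \<Rightarrow> 'a set" where
  "nb W v = {u \<in> W. {v, u} \<in> E}"

definition dg :: "'a set \<Rightarrow> 'a \<Rightarrow> nat" where
  "dg W v = card (nb W v)"

definition wt :: "'a set \<Rightarrow> 'a set \<Rightarrow> nat" where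
  "wt W I = (\<Sum>v\<in>I. dg W v)"

definition light_in :: "'a set \<Rightarrow> 'a set \<Rightarrow> bool" where
  "light_in W I \<longleftrightarrow> indep W E I \<and> wt W I < card W"

definition split :: "'a set \<Rightarrow> 'a set \<Rightarrow> 'a set \<Rightarrow> bool" where
  "split U P Q \<longleftrightarrow> U = P \<union> Q \<and> P \<inter> Q = {} \<and> P \<noteq> {} \<and> Q \<noteq> {} \<and> (\<forall>p\<in>P. \<forall>q\<in>Q. {p, q} \<notin> E)"

text \<open>\<open>W\<close> itself may be disconnected, so \<open>y\<close> is a cut vertex in the
  usual sense only if \<open>W\<close> has no \<open>split\<close>.\<close>

definition sep :: "'a set \<Rightarrow> 'a \<Rightarrow> 'a set \<Rightarrow> 'a set \<Rightarrow> bool" where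
  "sep W y P Q \<longleftrightarrow> y \<in> W \<and> split (W - {y}) P Q"

abbreviation "biconn \<equiv> two_connected_in E"

lemma nb_sym: "u \<in> nb W v \<Longrightarrow> v \<in> W' \<Longrightarrow> v \<in> nb W' u"
  by (simp add: nb_def insert_commute)

lemma self_notin_nb [simp]: "v \<notin> nb W v"
  using no_loop by (simp add: nb_def)

lemma nb_subset: "nb W v \<subseteq> W"
  by (auto simp: nb_def)

lemma dg_le: "nb W v \<subseteq> X \<Longrightarrow> finite X \<Longrightarrow> dg W v \<le> card X"
  by (simp add: dg_def card_mono)

lemma dg_less_card: "finite W \<Longrightarrow> v \<in> W \<Longrightarrow> dg W v < card W"
  unfolding dg_def by (rule psubset_card_mono) (use nb_subset[of W v] self_notin_nb[of v W] in \<open>auto simp del: self_notin_nb\<close>)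

lemma split_sym: "split U P Q \<Longrightarrow> split U Q P"
  unfolding split_def by (metis Un_commute inf_commute insert_commute)

lemma sep_sym: "sep W y P Q \<Longrightarrow> sep W y Q P"
  by (auto simp: sep_def split_sym)

text \<open>From here on connectivity is used only through bipartitions without crossing edges. If
  \<open>U\<close> is not connected, the set of vertices reachable from a suitable \<open>u\<close>
  is one side of such a bipartition.\<close>

lemma connected_iff_no_split: "connected_in E U \<longleftrightarrow> (\<nexists>P Q. split U P Q)"
proof
  assume c: "connected_in E U"
  show "\<nexists>P Q. split U P Q"
  proof clarify
    fix P Q assume s: "split U P Q"
    then obtain p q where p: "p \<in> P" and q: "q \<in> Q" by (auto simp: split_def)
    have "(\<lambda>x y. x \<in> U \<and> y \<in> U \<and> {x, y} \<in> E)\<^sup>*\<^sup>* p q"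
      using c p q s by (auto simp: connected_in_def split_def)
    then have "q \<in> P"
      by (induction rule: rtranclp_induct) (use p s in \<open>auto simp: split_def\<close>)
    then show False using q s by (auto simp: split_def)
  qed
next
  assume n: "\<nexists>P Q. split U P Q"
  show "connected_in E U"
    unfolding connected_in_def
  proof (intro ballI)
    fix u v assume u: "u \<in> U" and v: "v \<in> U"
    let ?R = "\<lambda>x y. x \<in> U \<and> y \<in> U \<and> {x, y} \<in> E"
    let ?P = "{x \<in> U. ?R\<^sup>*\<^sup>* u x}"
    have "\<not> split U ?P (U - ?P)" using n by blast
    moreover have "u \<in> ?P" using u by simp
    moreover have "{p, q} \<notin> E" if "p \<in> ?P" "q \<in> U - ?P" for p q
      using that rtranclp.rtrancl_into_rtrancl[of ?R u p q] by auto
    ultimately have "U - ?P = {}" unfolding split_def by blast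
    then show "?R\<^sup>*\<^sup>* u v" using v by blast
  qed
qed

section \<open>2-connected sets\<close>

lemma biconn_iff:
  "biconn X \<longleftrightarrow> card X > 2 \<and> (\<nexists>P Q. split X P Q) \<and> (\<nexists>z P Q. sep X z P Q)"
proof (cases "card X > 2")
  case True
  then have fin: "finite X" using card.infinite by fastforce
  have S: "S = {} \<or> (\<exists>z\<in>X. S = {z})" if "S \<subseteq> X" "card S < 2" for S
  proof -
    have "finite S" using that fin finite_subset by blast
    moreover have "card S = 0 \<or> card S = 1" using that by linarith
    ultimately show ?thesis using that by (auto simp: card_1_singleton_iff)
  qed
  have "(\<forall>S. S \<subseteq> X \<and> card S < 2 \<longrightarrow> connected_in E (X - S)) \<longleftrightarrow>
      connected_in E X \<and> (\<forall>z\<in>X. connected_in E (X - {z}))"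
    (is "?L \<longleftrightarrow> ?R")
  proof -
    have "card {} < 2" "card {z} < 2" for z :: 'a by auto
    then have "?L \<Longrightarrow> ?R" by (metis Diff_empty empty_subsetI insert_subset)
    moreover have "connected_in E (X - S)" if ?R "S \<subseteq> X" "card S < 2" for S
      using S[OF that(2,3)] that(1) by auto
    ultimately show ?thesis by blast
  qed
  then show ?thesis
    using True by (auto simp: two_connected_in_def connected_iff_no_split sep_def)
qed (simp add: two_connected_in_def)

lemma biconn_connected: "biconn X \<Longrightarrow> \<not> split X P Q"
  by (auto simp: biconn_iff)

lemma biconn_finite: "biconn X \<Longrightarrow> finite X"
  unfolding biconn_iff using card.infinite by fastforce

lemma split_subset:
  assumes "split U P Q" "X \<subseteq> U" "\<nexists>P Q. split X P Q"
  shows "X \<subseteq> P \<or> X \<subseteq> Q"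
proof (rule ccontr)
  assume "\<not> ?thesis"
  then have "split X (X \<inter> P) (X \<inter> Q)" using assms by (auto simp: split_def)
  then show False using assms by blast
qed

text \<open>Whichever vertex of \<open>X\<close> is deleted, one of the neighbours \<open>a\<close>,
  \<open>b\<close> survives and ties \<open>v\<close> to the connected remainder.\<close>

lemma biconn_insert:
  assumes X: "biconn X" and v: "v \<notin> X" and ab: "a \<in> X" "b \<in> X" "a \<noteq> b"
    and e: "{v, a} \<in> E" "{v, b} \<in> E"
  shows "biconn (insert v X)"
proof -
  have fin: "finite X" using X biconn_finite by blast
  have no: "\<not> split (insert v X') P Q"
    if X': "\<nexists>P Q. split X' P Q" and w: "w \<in> X'" "{v, w} \<in> E" for P Q X' w
  proof
    assume s: "split (insert v X') P Q"
    have "False" if s: "split (insert v X') P Q" and X'P: "X' \<subseteq> P" for P Q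
    proof -
      obtain z where z: "z \<in> Q" "z \<in> insert v X'" "z \<notin> P" using s by (auto simp: split_def)
      then have "v \<in> Q" using X'P by auto
      moreover have "w \<in> P" using X'P w(1) by (rule subsetD)
      ultimately have "{w, v} \<notin> E" using s by (simp add: split_def)
      then show False using w(2) by (simp add: insert_commute)
    qed
    moreover have "X' \<subseteq> P \<or> X' \<subseteq> Q" using split_subset[OF s _ X'] by blast
    ultimately show False using s split_sym by blast
  qed
  have "\<not> split (insert v X) P Q" for P Q
  proof
    assume "split (insert v X) P Q"
    moreover have "\<nexists>P Q. split X P Q" using X by (simp add: biconn_iff)
    ultimately show False using no[of X a P Q] ab e by blast
  qed
  moreover have "\<not> sep (insert v X) z P Q" for z P Q
  proof
    assume s: "sep (insert v X) z P Q"
    show False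
    proof (cases "z = v")
      case True
      then have "split X P Q" using s v by (simp add: sep_def)
      then show False using X biconn_connected by blast
    next
      case False
      then have zX: "z \<in> X" using s unfolding sep_def by blast
      obtain w where w: "w \<in> X - {z}" "{v, w} \<in> E" using ab e by blast
      have "insert v X - {z} = insert v (X - {z})" using False by blast
      then have s': "split (insert v (X - {z})) P Q" using s by (simp add: sep_def)
      have "\<nexists>P Q. split (X - {z}) P Q" using X zX by (simp add: biconn_iff sep_def)
      from no[OF this w] s' show False by blast
    qed
  qed
  moreover have "card (insert v X) > 2" using X v fin by (simp add: biconn_iff)
  ultimately show ?thesis by (simp add: biconn_iff)
qed

lemma biconn_triangle:
  assumes "a \<noteq> b" "b \<noteq> c" "a \<noteq> c" "{a, b} \<in> E" "{b, c} \<in> E" "{a, c} \<in> E"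
  shows "biconn {a, b, c}"
proof -
  have cl: False if s: "split U P Q" and "U \<subseteq> {a, b, c}" for U P Q
  proof -
    obtain p q where "p \<in> P" "q \<in> Q" "p \<noteq> q" using s unfolding split_def by blast
    moreover have "{p, q} \<notin> E" "p \<in> {a,b,c}" "q \<in> {a,b,c}"
      using that calculation unfolding split_def by blast+
    ultimately show False using assms by (auto simp: insert_commute)
  qed
  show ?thesis using assms cl by (auto simp: biconn_iff sep_def)
qed

lemma biconn_clique:
  assumes "card X > 2" "\<And>u v. u \<in> X \<Longrightarrow> v \<in> X \<Longrightarrow> u \<noteq> v \<Longrightarrow> {u, v} \<in> E"
  shows "biconn X"
proof -
  have cl: False if s: "split U P Q" and "U \<subseteq> X" for U P Q
  proof -
    obtain p q where pq: "p \<in> P" "q \<in> Q" "p \<noteq> q" using s unfolding split_def by blast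
    then have "{p, q} \<notin> E" "p \<in> X" "q \<in> X" using that by (auto simp: split_def)
    then show False using assms pq by blast
  qed
  show ?thesis using assms(1) cl by (auto simp: biconn_iff sep_def)
qed

section \<open>Light independent sets, marked vertices and partitions\<close>

lemma wt_insert: "finite I \<Longrightarrow> v \<notin> I \<Longrightarrow> wt W (insert v I) = dg W v + wt W I"
  by (simp add: wt_def)

lemma indep_mono: "indep W E I \<Longrightarrow> W \<subseteq> W' \<Longrightarrow> indep W' E I"
  by (auto simp: indep_def)

lemma indep_subset: "indep W E I \<Longrightarrow> J \<subseteq> I \<Longrightarrow> indep W E J"
  by (auto simp: indep_def)

lemma indep_insert: "indep W E I \<Longrightarrow> v \<in> W \<Longrightarrow> (\<And>u. u \<in> I \<Longrightarrow> {v, u} \<notin> E) \<Longrightarrow> indep W E (insert v I)"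
  using no_loop by (auto simp: indep_def insert_commute)

text \<open>A set \<open>Y\<close> of marked vertices collects cut vertices at which parts have been split off. Each of them
  can be returned to such a part, so a partition may leave them out, and each stands for at least one vertex
  of a light independent set outside \<open>W\<close>.\<close>

definition degree_cond :: "'a set \<Rightarrow> 'a set \<Rightarrow> bool" where
  "degree_cond W Y \<longleftrightarrow> (\<forall>I. I \<noteq> {} \<and> I \<subseteq> W - Y \<and> light_in W I \<longrightarrow> (\<forall>v\<in>I. card I + card Y \<le> dg W v))"

definition partitionable :: "'a set \<Rightarrow> 'a set \<Rightarrow> bool" where
  "partitionable W Y \<longleftrightarrow> (\<exists>Z P I. Z \<subseteq> Y \<and> two_proper_partition (W - Z) E P \<and> I \<subseteq> W - Y \<and> light_in W I \<and> card P \<le> card I)"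

lemma degree_condD: "degree_cond W Y \<Longrightarrow> I \<subseteq> W - Y \<Longrightarrow> light_in W I \<Longrightarrow> v \<in> I \<Longrightarrow> card I + card Y \<le> dg W v"
  unfolding degree_cond_def by blast

lemma partitionableI:
  "Z \<subseteq> Y \<Longrightarrow> two_proper_partition (W - Z) E P \<Longrightarrow> I \<subseteq> W - Y \<Longrightarrow> light_in W I \<Longrightarrow> card P \<le> card I \<Longrightarrow> partitionable W Y"
  unfolding partitionable_def by blast

lemma two_proper_iff:
  "two_proper_partition U E P \<longleftrightarrow> \<Union>P = U \<and> (\<forall>X\<in>P. biconn X) \<and> pairwise disjnt P"
proof -
  have "\<not> biconn {}" by (simp add: two_connected_in_def)
  then have "X \<noteq> {}" if "biconn X" for X using that by auto
  then show ?thesis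
    unfolding two_proper_partition_def is_partition_def pairwise_def disjnt_def by meson
qed

lemma two_proper_Un:
  assumes "two_proper_partition U E P" "two_proper_partition V E Q" "U \<inter> V = {}"
  shows "two_proper_partition (U \<union> V) E (P \<union> Q)"
proof -
  have P: "\<Union>P = U" "\<forall>X\<in>P. biconn X" "pairwise disjnt P"
    and Q: "\<Union>Q = V" "\<forall>X\<in>Q. biconn X" "pairwise disjnt Q"
    using assms(1,2) by (simp_all add: two_proper_iff)
  have disj: "disjnt X Y" "disjnt Y X" if "X \<in> P" "Y \<in> Q" for X Y
  proof -
    have "X \<subseteq> U" "Y \<subseteq> V" using that P(1) Q(1) by auto
    then have "X \<inter> Y = {}" using assms(3) by auto
    then show "disjnt X Y" "disjnt Y X" by (auto simp: disjnt_def)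
  qed
  have "pairwise disjnt (P \<union> Q)"
  proof (rule pairwiseI)
    fix X Y assume "X \<in> P \<union> Q" "Y \<in> P \<union> Q" "X \<noteq> Y"
    then show "disjnt X Y" using pairwiseD[OF P(3), of X Y] pairwiseD[OF Q(3), of X Y] disj by auto
  qed
  moreover have "\<Union>(P \<union> Q) = U \<union> V" by (simp only: Union_Un_distrib P(1) Q(1))
  ultimately show ?thesis using P(2) Q(2) unfolding two_proper_iff by auto
qed

lemma two_proper_single: "biconn X \<Longrightarrow> two_proper_partition X E {X}"
  by (simp add: two_proper_iff)

lemma two_proper_insert:
  assumes "two_proper_partition U E P" "biconn X" "U \<inter> X = {}"
  shows "two_proper_partition (U \<union> X) E (insert X P)"
  using two_proper_Un[OF assms(1) two_proper_single[OF assms(2)] assms(3)] by simp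

lemma two_proper_empty: "two_proper_partition {} E {}"
  by (simp add: two_proper_iff)

lemma dg_mono: "finite W' \<Longrightarrow> W \<subseteq> W' \<Longrightarrow> dg W v \<le> dg W' v"
  unfolding dg_def by (rule card_mono) (auto simp: nb_def)

lemma wt_mono_set: "finite I \<Longrightarrow> J \<subseteq> I \<Longrightarrow> wt W J \<le> wt W I"
  unfolding wt_def by (rule sum_mono2) auto

lemma wt_Un: "finite I \<Longrightarrow> finite J \<Longrightarrow> I \<inter> J = {} \<Longrightarrow> wt W (I \<union> J) = wt W I + wt W J"
  unfolding wt_def by (rule sum.union_disjoint)

lemma light_in_single: "finite W \<Longrightarrow> v \<in> W \<Longrightarrow> light_in W {v}"
  using dg_less_card no_loop by (auto simp: light_in_def indep_def wt_def)

lemma light_in_empty: "finite W \<Longrightarrow> W \<noteq> {} \<Longrightarrow> light_in W {}"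
  by (auto simp: light_in_def indep_def wt_def card_gt_0_iff)

subsection \<open>Disconnected sets\<close>

lemma split_card: "split W P Q \<Longrightarrow> finite W \<Longrightarrow> card W = card P + card Q"
  by (auto simp: split_def card_Un_disjoint)

lemma split_nb: "split W P Q \<Longrightarrow> v \<in> P \<Longrightarrow> nb W v = nb P v"
  by (auto simp: split_def nb_def)

lemma split_wt: "split W P Q \<Longrightarrow> I \<subseteq> P \<Longrightarrow> wt W I = wt P I"
  unfolding wt_def dg_def by (rule sum.cong) (auto simp: split_nb)

text \<open>A light set of \<open>P\<close> keeps its degrees in \<open>W\<close>, whose order is
  larger, so it is light there too.\<close>

lemma split_degree_cond:
  assumes "split W P Q" "finite W" "Y \<subseteq> W" "degree_cond W Y"
  shows "degree_cond P (Y \<inter> P)"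
  unfolding degree_cond_def
proof (intro allI impI ballI; elim conjE)
  fix I v assume I: "I \<subseteq> P - Y \<inter> P" "light_in P I" "v \<in> I"
  have "light_in W I" using I split_wt[OF assms(1), of I] split_card[OF assms(1,2)] assms(1)
    by (auto simp: light_in_def indep_def split_def)
  then have "card I + card Y \<le> dg W v" using degree_condD[OF assms(4)] I assms(1) by (auto simp: split_def)
  moreover have "card (Y \<inter> P) \<le> card Y" by (rule card_mono) (use assms finite_subset in auto)
  moreover have "dg W v = dg P v" using split_nb[OF assms(1)] I by (auto simp: dg_def)
  ultimately show "card I + card (Y \<inter> P) \<le> dg P v" by simp
qed

lemma split_light_in:
  assumes s: "split W P Q" and fin: "finite W" and I: "light_in P I" "light_in Q J"
  shows "light_in W (I \<union> J)"
proof -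
  have sub: "I \<subseteq> P" "J \<subseteq> Q" using I by (auto simp: light_in_def indep_def)
  moreover have "finite P" "finite Q" "P \<inter> Q = {}" using s fin by (auto simp: split_def)
  ultimately have "finite I" "finite J" "I \<inter> J = {}" using finite_subset by auto
  then have "wt W (I \<union> J) = wt P I + wt Q J"
    using split_wt[OF s sub(1)] split_wt[OF split_sym[OF s] sub(2)] by (simp add: wt_Un)
  moreover have "indep W E (I \<union> J)"
  proof -
    have "{u, v} \<notin> E" "{v, u} \<notin> E" if "u \<in> I" "v \<in> J" for u v
    proof -
      have "u \<in> P" "v \<in> Q" using that sub by auto
      then show "{u, v} \<notin> E" using s by (simp add: split_def)
      then show "{v, u} \<notin> E" by (simp add: insert_commute)
    qed
    then show ?thesis using I s by (auto simp: indep_def light_in_def split_def)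
  qed
  ultimately show ?thesis using I split_card[OF s fin] by (simp add: light_in_def)
qed

lemma split_partitionable:
  assumes s: "split W P Q" and fin: "finite W" and Y: "Y \<subseteq> W"
    and c: "partitionable P (Y \<inter> P)" "partitionable Q (Y \<inter> Q)"
  shows "partitionable W Y"
proof -
  obtain Z1 P1 I1 where 1: "Z1 \<subseteq> Y \<inter> P" "two_proper_partition (P - Z1) E P1" "I1 \<subseteq> P - Y \<inter> P"
    "light_in P I1" "card P1 \<le> card I1" using c(1) by (auto simp: partitionable_def)
  obtain Z2 P2 I2 where 2: "Z2 \<subseteq> Y \<inter> Q" "two_proper_partition (Q - Z2) E P2" "I2 \<subseteq> Q - Y \<inter> Q"
    "light_in Q I2" "card P2 \<le> card I2" using c(2) by (auto simp: partitionable_def)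
  have PQ: "W = P \<union> Q" "P \<inter> Q = {}" using s by (auto simp: split_def)
  have "two_proper_partition ((P - Z1) \<union> (Q - Z2)) E (P1 \<union> P2)"
    by (rule two_proper_Un) (use 1 2 PQ in auto)
  moreover have "(P - Z1) \<union> (Q - Z2) = W - (Z1 \<union> Z2)" using 1 2 PQ by blast
  moreover have "card (P1 \<union> P2) \<le> card (I1 \<union> I2)"
  proof -
    have "I1 \<inter> I2 = {}" "finite I1" "finite I2"
      using 1 2 PQ fin by (auto intro: finite_subset)
    then have "card (I1 \<union> I2) = card I1 + card I2" by (simp add: card_Un_disjoint)
    then show ?thesis using card_Un_le[of P1 P2] 1 2 by linarith
  qed
  ultimately show ?thesis
    using partitionableI[of "Z1 \<union> Z2" Y W "P1 \<union> P2" "I1 \<union> I2"] split_light_in[OF s fin 1(4) 2(4)] 1 2 PQ by auto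
qed

subsection \<open>Cut vertices\<close>

lemma sep_facts:
  assumes "sep W y A B"
  shows "W = insert y (A \<union> B)" "y \<notin> A" "y \<notin> B" "A \<inter> B = {}" "A \<noteq> {}" "B \<noteq> {}"
    "\<And>a b. a \<in> A \<Longrightarrow> b \<in> B \<Longrightarrow> {a, b} \<notin> E" "\<And>a b. a \<in> A \<Longrightarrow> b \<in> B \<Longrightarrow> {b, a} \<notin> E"
proof -
  have 1: "y \<in> W" "W - {y} = A \<union> B" "A \<inter> B = {}" "A \<noteq> {}" "B \<noteq> {}" "\<forall>a\<in>A. \<forall>b\<in>B. {a, b} \<notin> E"
    using assms by (simp_all add: sep_def split_def)
  then show "W = insert y (A \<union> B)" "y \<notin> A" "y \<notin> B" "A \<inter> B = {}" "A \<noteq> {}" "B \<noteq> {}" by auto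
  show "{a, b} \<notin> E" "{b, a} \<notin> E" if "a \<in> A" "b \<in> B" for a b
    using 1 that by (simp_all add: insert_commute)
qed

lemma sep_finite: "sep W y A B \<Longrightarrow> finite W \<Longrightarrow> finite A \<and> finite B"
  using sep_facts(1) by (metis finite_Un finite_insert)

lemma sep_card: "sep W y A B \<Longrightarrow> finite W \<Longrightarrow> card W = card A + card B + 1"
  using sep_facts[of W y A B] sep_finite[of W y A B] by (simp add: card_Un_disjoint)

lemma sep_nb: 
  assumes "sep W y A B" "v \<in> A" shows "nb W v \<subseteq> insert y (nb A v)" "nb A v \<subseteq> nb W v"
  using sep_facts[OF assms(1)] assms(2) by (auto simp: nb_def)

lemma sep_dg:
  assumes s: "sep W y A B" and fin: "finite W" and v: "v \<in> A"
  shows "dg W v \<le> dg A v + 1" "dg A v \<le> dg W v" "dg W v \<le> card A" "dg (insert y A) v = dg W v"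
    "y \<notin> nb W v \<Longrightarrow> dg W v = dg A v"
proof -
  have fA: "finite A" using sep_finite s fin by blast
  then have fn: "finite (nb A v)" using nb_subset finite_subset by blast
  have "dg W v \<le> card (insert y (nb A v))" by (rule dg_le[OF sep_nb(1)[OF s v]]) (use fn in simp)
  also have "\<dots> \<le> dg A v + 1" using fn by (simp add: dg_def card_insert_if)
  finally show a: "dg W v \<le> dg A v + 1" .
  show "dg A v \<le> dg W v" by (rule dg_mono[OF fin]) (use sep_facts[OF s] in auto)
  show "dg W v \<le> card A" using a dg_less_card[OF fA v] by linarith
  show "dg (insert y A) v = dg W v" unfolding dg_def
    by (rule arg_cong[of _ _ card]) (use sep_facts[OF s] v in \<open>auto simp: nb_def\<close>)
  show "y \<notin> nb W v \<Longrightarrow> dg W v = dg A v" using sep_nb[OF s v] unfolding dg_def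
    by (metis subset_antisym subset_insert)
qed

lemma sep_wt:
  assumes s: "sep W y A B" and fin: "finite W" and I: "I \<subseteq> A"
  shows "wt W I \<le> wt A I + card I" "wt (insert y A) I = wt W I"
proof -
  have "wt W I \<le> (\<Sum>v\<in>I. dg A v + 1)"
    unfolding wt_def by (rule sum_mono) (use sep_dg(1)[OF s fin] I in blast)
  then show "wt W I \<le> wt A I + card I" by (simp add: wt_def sum.distrib del: One_nat_def)
  show "wt (insert y A) I = wt W I"
    unfolding wt_def by (rule sum.cong) (use sep_dg(4)[OF s fin] I in auto)
qed

lemma sep_indep:
  assumes s: "sep W y A B" and "indep A E I" "b \<in> B"
  shows "indep W E (insert b I)"
proof (rule indep_insert)
  show "indep W E I" using assms(2) by (rule indep_mono) (use sep_facts(1)[OF s] in auto)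
  show "b \<in> W" using assms(3) sep_facts(1)[OF s] by auto
  show "{b, u} \<notin> E" if "u \<in> I" for u
    by (rule sep_facts(8)[OF s _ assms(3)]) (use that assms(2) in \<open>auto simp: indep_def\<close>)
qed

text \<open>Marked vertices that are cut off by a single vertex are abandoned. The degree of the cut vertex
  drops by at most the number of marked vertices that disappear.\<close>

lemma dissolve_degree_cond:
  assumes s: "sep W y A B" and fin: "finite W" and Y: "Y \<subseteq> W" and B: "B \<subseteq> Y" and h: "degree_cond W Y"
  shows "degree_cond (insert y A) (Y - B)"
    and "\<And>I. I \<subseteq> insert y A - (Y - B) \<Longrightarrow> light_in (insert y A) I \<Longrightarrow> I \<subseteq> W - Y \<and> light_in W I"
proof -
  note F = sep_facts[OF s]
  have fB: "finite B" "finite A" "finite Y" using sep_finite[OF s fin] Y fin finite_subset by auto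
  have cY: "card Y = card (Y - B) + card B"
    using fB B by (metis card_Diff_subset card_mono le_add_diff_inverse2)
  have dy: "dg W y \<le> dg (insert y A) y + card B"
  proof -
    have "nb W y \<subseteq> nb (insert y A) y \<union> B" using F by (auto simp: nb_def)
    then have "card (nb W y) \<le> card (nb (insert y A) y \<union> B)"
      by (rule card_mono[rotated]) (use fB in \<open>auto simp: nb_def\<close>)
    then show ?thesis using card_Un_le[of "nb (insert y A) y" B] by (simp add: dg_def)
  qed
  have key: "I \<subseteq> W - Y \<and> light_in W I"
    if I: "I \<subseteq> insert y A - (Y - B)" "light_in (insert y A) I" for I
  proof -
    have IW: "I \<subseteq> W - Y" using I F B by auto
    have fI: "finite I" using I fB finite_subset by (metis finite_Diff finite_insert)
    \<comment> \<open>Only \<open>y\<close> can have neighbours in \<open>B\<close>, so the weight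
      drops by at most \<open>card B\<close>. The order drops by exactly \<open>card B\<close>,
      which is why lightness can be pulled back to \<open>W\<close>.\<close>
    have "wt W I \<le> wt (insert y A) I + card B"
    proof (cases "y \<in> I")
      case False
      then have "I \<subseteq> A" using I by auto
      then show ?thesis using sep_wt(2)[OF s fin] by simp
    next
      case True
      let ?J = "I - {y}"
      have J: "?J \<subseteq> A" using I by auto
      have "I = insert y ?J" using True by auto
      then have "wt X I = dg X y + wt X ?J" for X
        using wt_insert[of ?J y X] fI by simp
      then show ?thesis using sep_wt(2)[OF s fin J] dy by simp
    qed
    moreover have "card W = card (insert y A) + card B" using sep_card[OF s fin] F fB by simp
    moreover have "indep W E I" using I F by (auto simp: light_in_def indep_def)
    ultimately show ?thesis using I IW by (simp add: light_in_def)
  qed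
  then show "\<And>I. I \<subseteq> insert y A - (Y - B) \<Longrightarrow> light_in (insert y A) I \<Longrightarrow> I \<subseteq> W - Y \<and> light_in W I" .
  show "degree_cond (insert y A) (Y - B)"
    unfolding degree_cond_def
  proof (intro allI impI ballI; elim conjE)
    fix I v assume I: "I \<subseteq> insert y A - (Y - B)" "light_in (insert y A) I" "v \<in> I"
    have "card I + card Y \<le> dg W v" using key[OF I(1,2)] I(3) by (intro degree_condD[OF h]) auto
    moreover have "dg W v \<le> dg (insert y A) v + card B"
    proof (cases "v = y")
      case False
      then have "v \<in> A" using I by auto
      then show ?thesis using sep_dg(4)[OF s fin] by simp
    qed (use dy in simp)
    ultimately show "card I + card (Y - B) \<le> dg (insert y A) v" using cY by simp
  qed
qed

lemma dissolve_partitionable: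
  assumes s: "sep W y A B" and fin: "finite W" and Y: "Y \<subseteq> W" and B: "B \<subseteq> Y" and h: "degree_cond W Y"
    and c: "partitionable (insert y A) (Y - B)"
  shows "partitionable W Y"
proof -
  note F = sep_facts[OF s]
  obtain Z P I where 1: "Z \<subseteq> Y - B" "two_proper_partition (insert y A - Z) E P"
    "I \<subseteq> insert y A - (Y - B)" "light_in (insert y A) I" "card P \<le> card I" using c by (auto simp: partitionable_def)
  have "insert y A - Z = W - (Z \<union> B)" using F by auto
  then show ?thesis
    using partitionableI[of "Z \<union> B" Y W P I] 1 dissolve_degree_cond(2)[OF s fin Y B h 1(3,4)] B by auto
qed

text \<open>Two vertices on different sides of \<open>f\<close> cannot both be adjacent to almost all of \<open>B\<close>; what they
  miss pays for the edges from \<open>y\<close> to \<open>A\<close>.\<close>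

lemma sep_sep_dg:
  assumes s: "sep W y A B" and fin: "finite W" and t: "sep B f F1 F2" and u: "u \<in> F1"
  shows "nb W u \<subseteq> insert y (insert f (F1 - {u}))" "dg W u \<le> card F1 + 1"
proof -
  note F = sep_facts[OF s] and T = sep_facts[OF t]
  have fF: "finite F1" using sep_finite[OF s fin] sep_finite[OF t] by blast
  show *: "nb W u \<subseteq> insert y (insert f (F1 - {u}))" using F T u no_loop by (auto simp: nb_def)
  have "dg W u \<le> card (insert y (insert f (F1 - {u})))" by (rule dg_le[OF *]) (use fF in simp)
  also have "\<dots> \<le> Suc (Suc (card (F1 - {u})))"
    using fF by (simp add: card_insert_if)
  also have "\<dots> = card F1 + 1" using card_Suc_Diff1[OF fF u] by simp
  finally show "dg W u \<le> card F1 + 1" .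
qed

text \<open>By \<open>sep_sep_dg\<close> the degrees of \<open>u1\<close> and \<open>u2\<close> add
  up to at most \<open>card B + 1\<close>. The smaller of the two exceeds \<open>card I\<close> by
  the degree condition, hence both do, and so \<open>card I + dg W u1\<close> is below
  \<open>dg W u1 + dg W u2\<close>, that is, at most \<open>card B\<close>. The summand
  \<open>card I\<close> is the possible cost of the edges from \<open>I\<close> to
  \<open>y\<close>.\<close>

lemma slack:
  assumes s: "sep W y A B" and fin: "finite W" and Y: "Y \<subseteq> W" and h: "degree_cond W Y" and t: "sep B f F1 F2"
    and u: "u1 \<in> F1 - Y" "u2 \<in> F2 - Y" and I: "I \<subseteq> A - Y" "light_in A I"
  shows "light_in W (insert u1 I)" "insert u1 I \<subseteq> W - Y" "u1 \<notin> I" "I \<noteq> {} \<Longrightarrow> card I < dg W u1"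
proof -
  note F = sep_facts[OF s] and T = sep_facts[OF t]
  have fI: "finite I" using I sep_finite[OF s fin] finite_subset by (metis finite_Diff)
  have fB: "finite B" using sep_finite[OF s fin] by simp
  have uB: "u1 \<in> B - Y" "u2 \<in> B - Y" using u T by auto
  have sum: "dg W u1 + dg W u2 \<le> card B + 1"
    using sep_sep_dg(2)[OF s fin t, of u1] sep_sep_dg(2)[OF s fin sep_sym[OF t], of u2] u
      sep_card[OF t fB] by simp
  have cW: "card W = card A + card B + 1" by (rule sep_card[OF s fin])
  have wA: "wt A J < card A" if "J \<subseteq> I" for J
    using wt_mono_set[OF fI that, of A] I by (simp add: light_in_def)
  have wW: "wt W (insert w J) < card A + card J + dg W w" if "J \<subseteq> I" "w \<in> B" for J w
  proof -
    have "w \<notin> J" using that I F by auto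
    then have "wt W (insert w J) = dg W w + wt W J"
      using wt_insert[of J w W] finite_subset[OF that(1) fI] by simp
    moreover have "wt W J \<le> wt A J + card J" by (rule sep_wt(1)[OF s fin]) (use that I in auto)
    ultimately show ?thesis using wA[OF that(1)] by linarith
  qed
  have ind: "indep W E (insert w J)" if "J \<subseteq> I" "w \<in> B" for J w
    using sep_indep[OF s indep_subset[of A I J]] that I by (auto simp: light_in_def)
  \<comment> \<open>Otherwise \<open>I\<close> can be cut down to a set \<open>J\<close> with
    exactly \<open>dg W w\<close> elements. Then \<open>insert w J\<close> has weight below
    \<open>card A + 2 * dg W w\<close> and is light, although it is one larger than the degree of
    its member \<open>w\<close>.\<close>
  have small: "card I < dg W w" if w: "w \<in> B - Y" "2 * dg W w \<le> card B + 1" for w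
  proof (rule ccontr)
    assume "\<not> card I < dg W w"
    then obtain J where J: "J \<subseteq> I" "card J = dg W w"
      by (meson not_less obtain_subset_with_card_n)
    have "wt W (insert w J) < card A + 2 * dg W w" using wW[OF J(1)] w J by fastforce
    then have "light_in W (insert w J)" using ind[OF J(1)] w cW by (auto simp: light_in_def)
    moreover have "insert w J \<subseteq> W - Y" using J I F w by auto
    ultimately have "card (insert w J) + card Y \<le> dg W w" using degree_condD[OF h, of "insert w J" w] by simp
    moreover have "card (insert w J) = Suc (card J)"
      using J I w F finite_subset[OF J(1) fI] by (subst card_insert_disjoint) auto
    ultimately show False using J by simp
  qed
  have both: "card I < dg W u1 \<and> card I < dg W u2"
    using small[OF uB(1)] small[OF uB(2)] sum by (cases "dg W u1 \<le> dg W u2") linarith+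
  then show "card I < dg W u1" by simp
  have "wt W (insert u1 I) < card A + card I + dg W u1" using wW[of I u1] uB by simp
  also have "\<dots> \<le> card A + card B" using both sum by linarith
  finally show "light_in W (insert u1 I)" using ind[of I u1] uB cW by (simp add: light_in_def)
  show "insert u1 I \<subseteq> W - Y" "u1 \<notin> I" using F uB I by auto
qed

text \<open>Adding \<open>u1\<close> to a light set raises the required degree by one, and one is
  all that a vertex of \<open>A\<close> can lose when \<open>y\<close> is removed. The second claim
  keeps the unreduced bound in \<open>W\<close>; it is what makes an exceptional rest rigid.\<close>

lemma slack_degree_cond:
  assumes s: "sep W y A B" and fin: "finite W" and Y: "Y \<subseteq> W" and h: "degree_cond W Y" and t: "sep B f F1 F2"
    and u: "u1 \<in> F1 - Y" "u2 \<in> F2 - Y"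
  shows "degree_cond A (Y \<inter> A)"
    and "\<And>I v. I \<subseteq> A - Y \<Longrightarrow> light_in A I \<Longrightarrow> v \<in> I \<Longrightarrow> card I + 1 + card Y \<le> dg W v"
proof -
  show *: "card I + 1 + card Y \<le> dg W v" if "I \<subseteq> A - Y" "light_in A I" "v \<in> I" for I v
  proof -
    have "finite I" using that(1) sep_finite[OF s fin] finite_subset by (metis finite_Diff)
    then have "card (insert u1 I) = card I + 1" using slack(3)[OF assms that(1,2)] by simp
    then show ?thesis using degree_condD[OF h slack(2,1)[OF assms that(1,2)], of v] that by simp
  qed
  show "degree_cond A (Y \<inter> A)"
    unfolding degree_cond_def
  proof (intro allI impI ballI; elim conjE)
    fix I v assume I: "I \<subseteq> A - Y \<inter> A" "light_in A I" "v \<in> I"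
    then have "card I + 1 + card Y \<le> dg W v" by (intro *) auto
    moreover have "dg W v \<le> dg A v + 1" using sep_dg(1)[OF s fin] I by auto
    moreover have "card (Y \<inter> A) \<le> card Y" by (rule card_mono) (use assms finite_subset in auto)
    ultimately show "card I + card (Y \<inter> A) \<le> dg A v" by linarith
  qed
qed

lemma slack_partitionable:
  assumes s: "sep W y A B" and fin: "finite W" and Y: "Y \<subseteq> W" and h: "degree_cond W Y" and t: "sep B f F1 F2"
    and u: "u1 \<in> F1 - Y" "u2 \<in> F2 - Y" and B: "biconn (insert y B)" and c: "partitionable A (Y \<inter> A)"
  shows "partitionable W Y"
proof -
  note F = sep_facts[OF s]
  obtain Z P I where 1: "Z \<subseteq> Y \<inter> A" "two_proper_partition (A - Z) E P" "I \<subseteq> A - Y \<inter> A"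
    "light_in A I" "card P \<le> card I" using c by (auto simp: partitionable_def)
  have I: "I \<subseteq> A - Y" using 1 by auto
  note S = slack[OF s fin Y h t u I 1(4)]
  have "two_proper_partition (A - Z \<union> insert y B) E (insert (insert y B) P)"
    by (rule two_proper_insert[OF 1(2) B]) (use F in auto)
  moreover have "A - Z \<union> insert y B = W - Z" using F 1 by auto
  moreover have "finite I" using I sep_finite[OF s fin] finite_subset by (metis finite_Diff)
  then have "card (insert u1 I) = card I + 1" using S by simp
  moreover have "card (insert (insert y B) P) \<le> card P + 1"
    by (cases "finite P") (auto simp: card_insert_if)
  ultimately show ?thesis using partitionableI[of Z Y W _ "insert u1 I"] S 1 by auto
qed

subsection \<open>Minimal sides of a cut vertex\<close>

lemma sepI:
  assumes "W = insert y (A \<union> B)" "y \<notin> A" "y \<notin> B" "A \<inter> B = {}" "A \<noteq> {}" "B \<noteq> {}"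
    "\<And>a b. a \<in> A \<Longrightarrow> b \<in> B \<Longrightarrow> {a, b} \<notin> E"
  shows "sep W y A B"
proof -
  have "W - {y} = A \<union> B" using assms by auto
  then show ?thesis using assms by (simp add: sep_def split_def)
qed

lemma splitI:
  assumes "W = A \<union> B" "A \<inter> B = {}" "A \<noteq> {}" "B \<noteq> {}" "\<And>a b. a \<in> A \<Longrightarrow> b \<in> B \<Longrightarrow> {a, b} \<notin> E"
  shows "split W A B"
  using assms by (simp add: split_def)

lemma split_facts:
  assumes "split W A B"
  shows "W = A \<union> B" "A \<inter> B = {}" "A \<noteq> {}" "B \<noteq> {}"
    "\<And>a b. a \<in> A \<Longrightarrow> b \<in> B \<Longrightarrow> {a, b} \<notin> E" "\<And>a b. a \<in> A \<Longrightarrow> b \<in> B \<Longrightarrow> {b, a} \<notin> E"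
  using assms by (simp_all add: split_def insert_commute)

text \<open>The side \<open>Q\<close> touches \<open>insert z P\<close> only at \<open>z\<close>, so
  it can be joined to whatever does not lie in \<open>P2\<close>. Separations inside one side of a
  cut vertex thus become separations of the whole set with the same far side.\<close>

lemma sep_extend:
  assumes s: "sep X z P Q" and t: "sep (insert z P) z' P1 P2" and z: "z \<notin> P2"
  shows "sep X z' (P1 \<union> Q) P2"
proof (rule sepI)
  note S = sep_facts[OF s] and T = sep_facts[OF t]
  show "X = insert z' (P1 \<union> Q \<union> P2)" "z' \<notin> P2" "P1 \<union> Q \<noteq> {}" "P2 \<noteq> {}" using S(1,6) T by auto
  have P2: "P2 \<subseteq> P" using T(1) z by auto
  have "z' \<in> insert z P" using T(1) by auto
  then show "z' \<notin> P1 \<union> Q" using T(2) S(3,4) by auto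
  show "(P1 \<union> Q) \<inter> P2 = {}" using T(4) P2 S(4) by auto
  show "{a, b} \<notin> E" if "a \<in> P1 \<union> Q" "b \<in> P2" for a b
    using that T(7)[of a b] S(8)[of b a] P2 by auto
qed

lemma split_extend:
  assumes s: "sep X z P Q" and t: "split (insert z P) P1 P2" and z: "z \<notin> P2"
  shows "split X (P1 \<union> Q) P2"
proof (rule splitI)
  note S = sep_facts[OF s] and T = split_facts[OF t]
  show "X = P1 \<union> Q \<union> P2" "P1 \<union> Q \<noteq> {}" "P2 \<noteq> {}" using S(1,6) T by auto
  have P2: "P2 \<subseteq> P" using T(1) z by auto
  show "(P1 \<union> Q) \<inter> P2 = {}" using T(2) P2 S(4) by auto
  show "{a, b} \<notin> E" if "a \<in> P1 \<union> Q" "b \<in> P2" for a b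
    using that T(5)[of a b] S(8)[of b a] P2 by auto
qed

lemma no_split_side:
  assumes s: "sep X z P Q" and n: "\<nexists>P Q. split X P Q"
  shows "\<nexists>P1 P2. split (insert z P) P1 P2"
proof clarify
  fix P1 P2 assume t: "split (insert z P) P1 P2"
  have "z \<notin> P1 \<or> z \<notin> P2" using split_facts(2)[OF t] by auto
  then show False using split_extend[OF s t] split_extend[OF s split_sym[OF t]] n by blast
qed

text \<open>Vertices of \<open>F\<close> that no cut vertex separates lie in a common block: at each
  cut vertex the side without vertices of \<open>F\<close> is discarded. The block may have at most
  two vertices, so \<open>biconn\<close> cannot be claimed here.\<close>

lemma core:
  assumes "finite X" "\<nexists>P Q. split X P Q"
    and "\<And>z P Q. sep X z P Q \<Longrightarrow> P \<inter> F = {} \<or> Q \<inter> F = {}"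
  shows "\<exists>C. C \<subseteq> X \<and> X \<inter> F \<subseteq> C \<and> (\<nexists>P Q. split C P Q) \<and> (\<nexists>z P Q. sep C z P Q)"
  using assms
proof (induction "card X" arbitrary: X rule: less_induct)
  case less
  show ?case
  proof (cases "\<exists>z P Q. sep X z P Q")
    case False
    then show ?thesis using less.prems by blast
  next
    case True
    then obtain z P Q where s: "sep X z P Q" and Q: "Q \<inter> F = {}"
      using less.prems(3) sep_sym by meson
    note S = sep_facts[OF s]
    have "finite P \<and> finite Q" by (rule sep_finite[OF s less.prems(1)])
    then have c: "card (insert z P) < card X" "finite (insert z P)"
      using sep_card[OF s less.prems(1)] S(2,6) by (auto simp: card_gt_0_iff)
    have "P1 \<inter> F = {} \<or> P2 \<inter> F = {}" if t: "sep (insert z P) z' P1 P2" for z' P1 P2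
    proof (cases "z \<in> P2")
      case False
      then show ?thesis using less.prems(3)[OF sep_extend[OF s t]] by auto
    next
      case True
      then have "z \<notin> P1" using sep_facts(4)[OF t] by auto
      then show ?thesis using less.prems(3)[OF sep_extend[OF s sep_sym[OF t]]] by auto
    qed
    then obtain C where C: "C \<subseteq> insert z P" "insert z P \<inter> F \<subseteq> C" "\<nexists>P Q. split C P Q" "\<nexists>z P Q. sep C z P Q"
      using less.hyps[OF c(1) c(2) no_split_side[OF s less.prems(2)]] by auto
    have "C \<subseteq> X" "X \<inter> F \<subseteq> C" using C(1,2) S(1) Q by auto
    then show ?thesis using C(3,4) by auto
  qed
qed

lemma biconnI: "card X > 2 \<Longrightarrow> \<nexists>P Q. split X P Q \<Longrightarrow> \<nexists>z P Q. sep X z P Q \<Longrightarrow> biconn X"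
  by (simp add: biconn_iff)

text \<open>By \<open>sep_extend\<close>, a separation of \<open>insert y B\<close>, or a
  disconnection of \<open>B\<close>, would leave a proper subset of \<open>B\<close> as a side of
  some cut vertex of \<open>W\<close>.\<close>

lemma minimal_side:
  assumes fin: "finite W" and n: "\<nexists>P Q. split W P Q" and s: "sep W y A B"
    and min: "\<And>y' A' B'. sep W y' A' B' \<Longrightarrow> card B \<le> card B'"
  shows "\<nexists>P Q. split B P Q" "\<nexists>P Q. split (insert y B) P Q" "\<nexists>z P Q. sep (insert y B) z P Q"
proof -
  note S = sep_facts[OF s]
  have fB: "finite B" using sep_finite[OF s fin] by simp
  have less: False if "sep W z X Q" "Q \<subset> B" for z X Q
    using min[OF that(1)] psubset_card_mono[OF fB that(2)] by simp
  show "\<nexists>P Q. split (insert y B) P Q" by (rule no_split_side[OF sep_sym[OF s] n])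
  show "\<nexists>P Q. split B P Q"
  proof clarify
    fix P Q assume "split B P Q"
    note T = split_facts[OF this]
    have "sep W y (A \<union> P) Q"
    proof (rule sepI)
      show "W = insert y (A \<union> P \<union> Q)" "y \<notin> A \<union> P" "y \<notin> Q" "(A \<union> P) \<inter> Q = {}" "A \<union> P \<noteq> {}" "Q \<noteq> {}"
        using S(1-6) T(1-4) by auto
      show "{a, b} \<notin> E" if "a \<in> A \<union> P" "b \<in> Q" for a b
        using that S(7)[of a b] T(5)[of a b] T(1) by auto
    qed
    moreover have "Q \<subset> B" using T(1-4) by auto
    ultimately show False by (rule less)
  qed
  have *: False if t: "sep (insert y B) z P Q" and y: "y \<notin> Q" for z P Q
  proof -
    note T = sep_facts[OF t]
    have "sep W z (P \<union> A) Q" by (rule sep_extend[OF sep_sym[OF s] t y])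
    moreover have "Q \<subset> B"
    proof -
      have "Q \<subseteq> B" using T(1) y by auto
      moreover obtain p where "p \<in> P" using T(5) by auto
      then have "p \<in> B - Q \<or> z \<in> B - Q" using T(1-4) by (cases "p = y") auto
      ultimately show ?thesis by auto
    qed
    ultimately show False by (rule less)
  qed
  show "\<nexists>z P Q. sep (insert y B) z P Q"
  proof clarify
    fix z P Q assume t: "sep (insert y B) z P Q"
    have "y \<notin> P \<or> y \<notin> Q" using sep_facts(4)[OF t] by auto
    then show False using *[OF t] *[OF sep_sym[OF t]] by blast
  qed
qed

section \<open>Splitting off a side without its cut vertex\<close>

lemma light_in_pair:
  assumes s: "sep W y A B" and fin: "finite W" and "a \<in> A" "b \<in> B"
  shows "light_in W {a, b}"
proof -
  have "a \<noteq> b" using sep_facts(4)[OF s] assms by auto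
  then have "wt W {a, b} = dg W a + dg W b" by (simp add: wt_def)
  also have "\<dots> \<le> card A + card B"
    by (rule add_mono[OF sep_dg(3)[OF s fin assms(3)] sep_dg(3)[OF sep_sym[OF s] fin assms(4)]])
  also have "\<dots> < card W" using sep_card[OF s fin] by simp
  moreover have "indep W E {a, b}"
    using sep_facts(1)[OF s] sep_facts(7,8)[OF s, of a b] assms(3,4) no_loop
    by (auto simp: indep_def)
  ultimately show ?thesis by (simp add: light_in_def)
qed

lemma side_free_dg:
  assumes s: "sep W y A B" and fin: "finite W" and h: "degree_cond W Y" and "a \<in> A - Y" "b \<in> B - Y"
  shows "2 + card Y \<le> dg W b"
proof -
  have "a \<noteq> b" using sep_facts(4)[OF s] assms by auto
  then show ?thesis
    using degree_condD[OF h _ light_in_pair[OF s fin, of a b], of b] assms(4,5) sep_facts(1)[OF s] by auto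
qed

text \<open>A vertex \<open>b\<close> of \<open>B\<close> has degree at most \<open>card B\<close>,
  so it extends every light set of the rest that avoids \<open>y\<close>. It pays twice: in the
  degree condition for the new mark \<open>y\<close>, and in the final count for the new part. The
  mark postpones the decision about \<open>y\<close>: if the partition of the rest leaves
  \<open>y\<close> out, the new part is \<open>insert y B\<close>; otherwise it is \<open>C\<close>,
  and the marked vertices of \<open>B - C\<close> stay uncovered.\<close>

lemma good_side_partitionable:
  assumes s: "sep W y A B" and fin: "finite W" and Y: "Y \<subseteq> W" and h: "degree_cond W Y"
    and C: "C \<subseteq> B" "B - C \<subseteq> Y" "biconn C" and yB: "biconn (insert y B)" and b: "b \<in> B - Y"
    and IH: "degree_cond (insert y A) (insert y (Y - B)) \<Longrightarrow> partitionable (insert y A) (insert y (Y - B))"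
  shows "partitionable W Y"
proof -
  note S = sep_facts[OF s]
  have fY: "finite Y" using Y fin finite_subset by auto
  have ext: "insert b I \<subseteq> W - Y" "light_in W (insert b I)" "card (insert b I) = card I + 1"
    if I: "I \<subseteq> insert y A - insert y (Y - B)" "light_in (insert y A) I" for I
  proof -
    have IA: "I \<subseteq> A - Y" using I(1) S(4) by auto
    have fI: "finite I" using IA sep_finite[OF s fin] finite_subset by (metis finite_Diff)
    have bI: "b \<notin> I" using IA S(4) b by auto
    show "insert b I \<subseteq> W - Y" "card (insert b I) = card I + 1" using IA b S(1) fI bI by auto
    have "wt W (insert b I) = dg W b + wt W I" by (rule wt_insert[OF fI bI])
    also have "\<dots> \<le> card B + wt (insert y A) I"
    proof -
      have "I \<subseteq> A" using IA by blast
      then show ?thesis using sep_dg(3)[OF sep_sym[OF s] fin, of b] sep_wt(2)[OF s fin, of I] b by simp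
    qed
    also have "\<dots> < card W"
      using I(2) sep_card[OF s fin] S(2) sep_finite[OF s fin] by (simp add: light_in_def)
    moreover have "indep W E (insert b I)"
      by (rule sep_indep[OF s]) (use I(2) IA b in \<open>auto simp: light_in_def indep_def\<close>)
    ultimately show "light_in W (insert b I)" by (simp add: light_in_def)
  qed
  have "degree_cond (insert y A) (insert y (Y - B))"
    unfolding degree_cond_def
  proof (intro allI impI ballI; elim conjE)
    fix I v assume I: "I \<subseteq> insert y A - insert y (Y - B)" "light_in (insert y A) I" "v \<in> I"
    have "card (insert b I) + card Y \<le> dg W v" by (rule degree_condD[OF h ext(1,2)[OF I(1,2)]]) (use I in simp)
    moreover have "dg W v = dg (insert y A) v" using sep_dg(4)[OF s fin, of v] I by auto
    moreover have "card (insert y (Y - B)) \<le> card Y + 1"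
      using fY card_mono[OF fY, of "Y - B"] by (auto simp: card_insert_if)
    ultimately show "card I + card (insert y (Y - B)) \<le> dg (insert y A) v"
      using ext(3)[OF I(1,2)] by linarith
  qed
  then obtain Z P I where 1: "Z \<subseteq> insert y (Y - B)" "two_proper_partition (insert y A - Z) E P"
    "I \<subseteq> insert y A - insert y (Y - B)" "light_in (insert y A) I" "card P \<le> card I"
    using IH by (auto simp: partitionable_def)
  define X where "X = (if y \<in> Z then insert y B else C)"
  have X: "biconn X" using yB C(3) by (simp add: X_def)
  have U: "(insert y A - Z) \<union> X = W - (W - ((insert y A - Z) \<union> X))"
    using S(1) C(1) by (auto simp: X_def)
  show ?thesis
  proof (rule partitionableI)
    show "W - ((insert y A - Z) \<union> X) \<subseteq> Y" using S(1) C(2) 1(1) by (auto simp: X_def split: if_splits)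
    have "two_proper_partition ((insert y A - Z) \<union> X) E (insert X P)"
      by (rule two_proper_insert[OF 1(2) X]) (use S(2-4) C(1) in \<open>auto simp: X_def\<close>)
    then show "two_proper_partition (W - (W - ((insert y A - Z) \<union> X))) E (insert X P)"
      using U by (simp only:)
    show "insert b I \<subseteq> W - Y" "light_in W (insert b I)" by (rule ext[OF 1(3,4)])+
    show "card (insert X P) \<le> card (insert b I)"
      using ext(3)[OF 1(3,4)] 1(5) by (cases "finite P") (auto simp: card_insert_if)
  qed
qed

text \<open>By \<open>core\<close> the unmarked vertices of \<open>B\<close> lie in one block
  \<open>C\<close>. Their degrees are at least \<open>2 + card Y\<close> and at most
  \<open>card B\<close>, so \<open>C\<close> has at least two vertices. If it has exactly two,
  everything is tight: \<open>Y = B - C\<close>, and both vertices of \<open>C\<close> are adjacent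
  to all of \<open>insert y B\<close>. Then \<open>B\<close> is 2-connected as soon as it has a
  third vertex; without one, \<open>B\<close> and \<open>y\<close> form a triangle.\<close>

lemma good_side:
  assumes s: "sep W y A B" and fin: "finite W" and Y: "Y \<subseteq> W" and h: "degree_cond W Y"
    and nB: "\<nexists>P Q. split B P Q" and nyB: "\<nexists>P Q. split (insert y B) P Q" "\<nexists>z P Q. sep (insert y B) z P Q"
    and ab: "a \<in> A - Y" "b \<in> B - Y"
    and good: "\<And>z P Q. sep B z P Q \<Longrightarrow> P \<subseteq> Y \<or> Q \<subseteq> Y"
    and IH: "degree_cond (insert y A) (insert y (Y - B)) \<Longrightarrow> partitionable (insert y A) (insert y (Y - B))"
  shows "partitionable W Y \<or> (Y = {} \<and> (\<exists>c d. c \<noteq> d \<and> B = {c, d} \<and> {c, d} \<in> E \<and> {y, c} \<in> E \<and> {y, d} \<in> E))"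
proof -
  note S = sep_facts[OF s]
  have fB: "finite B" "finite Y" using sep_finite[OF s fin] Y fin finite_subset by auto
  have deg: "2 + card Y \<le> dg W u" if "u \<in> B - Y" for u
    using side_free_dg[OF s fin h ab(1) that] .
  have nbB: "nb W u \<subseteq> insert y (B - {u})" "card (insert y (B - {u})) = card B" if "u \<in> B" for u
  proof -
    show "nb W u \<subseteq> insert y (B - {u})"
      using sep_nb(1)[OF sep_sym[OF s] that] nb_subset[of B u] self_notin_nb[of u] by blast
    show "card (insert y (B - {u})) = card B"
      using card_Suc_Diff1[OF fB(1) that] S(3) fB by simp
  qed
  have cB: "2 + card Y \<le> card B"
    using deg[OF ab(2)] sep_dg(3)[OF sep_sym[OF s] fin, of b] ab(2) by simp
  have yB: "biconn (insert y B)"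
    by (rule biconnI) (use cB S(3) fB nyB in auto)
  obtain C where C: "C \<subseteq> B" "B \<inter> - Y \<subseteq> C" "\<nexists>P Q. split C P Q" "\<nexists>z P Q. sep C z P Q"
  proof -
    have "P \<inter> - Y = {} \<or> Q \<inter> - Y = {}" if "sep B z P Q" for z P Q
      using good[OF that] by auto
    then show ?thesis using core[OF fB(1) nB, of "- Y"] that by auto
  qed
  have Z: "B - C \<subseteq> Y" using C(2) by auto
  have "card B = card C + card (B - C)" using C(1) fB by (metis card_Diff_subset card_mono finite_subset le_add_diff_inverse)
  moreover have "card (B - C) \<le> card Y" by (rule card_mono[OF fB(2) Z])
  ultimately consider "card C > 2" | "card C = 2" "card Y = card (B - C)" using cB by linarith
  then show ?thesis
  proof cases
    case 1
    then show ?thesis using good_side_partitionable[OF s fin Y h C(1) Z biconnI[OF 1 C(3,4)] yB ab(2) IH] by blast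
  next
    case 2
    have YZ: "Y = B - C" using card_subset_eq[OF fB(2) Z] 2 by simp
    have full: "nb W u = insert y (B - {u})" if "u \<in> C" for u
    proof (rule card_subset_eq)
      have u: "u \<in> B - Y" using that C(1) YZ by auto
      then show "finite (insert y (B - {u}))" "nb W u \<subseteq> insert y (B - {u})" using fB nbB by auto
      have "card (nb W u) \<le> card B" "card B \<le> card (nb W u)"
        using sep_dg(3)[OF sep_sym[OF s] fin, of u] deg[OF u] u \<open>card B = card C + card (B - C)\<close> 2
        by (auto simp: dg_def)
      then show "card (nb W u) = card (insert y (B - {u}))" using nbB(2) u by simp
    qed
    obtain c d where cd: "C = {c, d}" "c \<noteq> d" using 2(1) by (meson card_2_iff)
    have adj: "{u, v} \<in> E" if "u \<in> C" "v \<in> insert y B" "u \<noteq> v" for u v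
      using full[OF that(1)] that(2,3) by (auto simp: nb_def)
    show ?thesis
    proof (cases "B - C = {}")
      case True
      then have B: "B = {c, d}" using cd C(1) by auto
      have "c \<noteq> y" "d \<noteq> y" using cd C(1) S(3) by auto
      then have "{c, d} \<in> E" "{c, y} \<in> E" "{d, y} \<in> E"
        using adj[of c d] adj[of c y] adj[of d y] cd B by simp_all
      then have "c \<noteq> d \<and> B = {c, d} \<and> {c, d} \<in> E \<and> {y, c} \<in> E \<and> {y, d} \<in> E"
        using cd(2) B by (simp add: insert_commute)
      then show ?thesis using YZ True by blast
    next
      case False
      have "biconn B"
      proof (rule biconnI)
        have "card (B - C) > 0" using False fB by (simp add: card_gt_0_iff)
        then show "card B > 2" using \<open>card B = card C + card (B - C)\<close> 2 by simp
        show "\<nexists>P Q. split B P Q" by fact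
        have no: False if t: "sep B z P Q" and u: "u \<in> C" "u \<in> P" for z P Q u
        proof -
          obtain q where "q \<in> Q" using sep_facts(6)[OF t] by auto
          then show False
            using sep_facts(7)[OF t u(2), of q] adj[OF u(1), of q] sep_facts(1,4)[OF t] u by auto
        qed
        show "\<nexists>z P Q. sep B z P Q"
        proof clarify
          fix z P Q assume t: "sep B z P Q"
          obtain u where u: "u \<in> C" "u \<noteq> z" using cd by auto
          then have "u \<in> P \<or> u \<in> Q" using sep_facts(1)[OF t] C(1) by auto
          then show False using no[OF t u(1)] no[OF sep_sym[OF t] u(1)] by blast
        qed
      qed
      then show ?thesis using good_side_partitionable[OF s fin Y h _ _ _ yB ab(2) IH, of B] by auto
    qed
  qed
qed

lemma no_sep_partitionable:
  assumes fin: "finite W" and Y: "Y \<subseteq> W" and h: "degree_cond W Y" and u: "u \<in> W - Y"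
    and n: "\<nexists>P Q. split W P Q" "\<nexists>z P Q. sep W z P Q"
  shows "partitionable W Y \<or> (Y = {} \<and> (\<exists>u v. u \<noteq> v \<and> W = {u, v} \<and> {u, v} \<in> E))"
proof -
  have l: "light_in W {u}" using light_in_single[OF fin] u by auto
  have d: "1 + card Y \<le> dg W u" using degree_condD[OF h _ l, of u] u by simp
  have lt: "dg W u < card W" using dg_less_card[OF fin] u by simp
  show ?thesis
  proof (cases "card W > 2")
    case True
    have "two_proper_partition (W - {}) E {W}" using two_proper_single[OF biconnI[OF True n]] by simp
    then show ?thesis using partitionableI[of "{}" Y W "{W}" "{u}"] l u by auto
  next
    case False
    then have "card W = 2" "card Y = 0" using d lt by linarith+
    then have Y0: "Y = {}" using finite_subset[OF Y fin] by simp
    obtain a b where ab: "W = {a, b}" "a \<noteq> b" using \<open>card W = 2\<close> by (meson card_2_iff)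
    have "{a, b} \<in> E"
    proof (rule ccontr)
      assume "{a, b} \<notin> E"
      then have "split W {a} {b}" using ab by (intro splitI) auto
      then show False using n by blast
    qed
    then show ?thesis using Y0 ab by blast
  qed
qed

subsection \<open>Exceptional graphs\<close>

definition exK2 :: "'a set \<Rightarrow> bool" where
  "exK2 W \<longleftrightarrow> (\<exists>u v. u \<noteq> v \<and> W = {u, v} \<and> {u, v} \<in> E)"

text \<open>The neighbourhood of the centre \<open>g\<close> follows from those of the other four
  vertices.\<close>

definition exF5 :: "'a set \<Rightarrow> bool" where
  "exF5 W \<longleftrightarrow> (\<exists>g p q r s. distinct [g, p, q, r, s] \<and> W = {g, p, q, r, s} \<and>
     nb W p = {g, q} \<and> nb W q = {g, p} \<and> nb W r = {g, s} \<and> nb W s = {g, r})"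

text \<open>\<open>c\<close> and \<open>d\<close> are the vertices c_1 and c_2, and \<open>P\<close>
  and \<open>Q\<close> are the cliques S_1 and S_2. The edge between \<open>a\<close> and
  \<open>b\<close> is left open, which covers both kinds of graphs in the family.\<close>

definition exH :: "'a set \<Rightarrow> bool" where
  "exH W \<longleftrightarrow> (\<exists>a b c d P Q. distinct [a, b, c, d] \<and> {a, b, c, d} \<inter> (P \<union> Q) = {} \<and> P \<inter> Q = {} \<and>
     P \<noteq> {} \<and> Q \<noteq> {} \<and> card P \<le> card Q \<and> W = {a, b, c, d} \<union> (P \<union> Q) \<and>
     nb W c = {a, d} \<and> nb W d = {a, c} \<and>
     (\<forall>x\<in>P. nb W x = insert a (insert b (P - {x}))) \<and> (\<forall>x\<in>Q. nb W x = insert a (insert b (Q - {x}))))"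

text \<open>The common core of the two sporadic families. \<open>y\<close> is the vertex a,
  \<open>g\<close> and \<open>h\<close> are b_1 and b_2, \<open>p\<close>, \<open>q\<close>,
  \<open>r\<close>, \<open>s\<close> are c_1 to c_4, and \<open>c\<close>, \<open>d\<close> are c_5
  and c_6. The vertices \<open>u\<close> and \<open>v\<close> are reserved for c_7 and c_8, whose
  neighbourhoods distinguish the families. Edges from \<open>y\<close> to \<open>g\<close> and
  \<open>h\<close> are left open; they belong to L.\<close>

definition tripod :: "'a set \<Rightarrow> 'a \<Rightarrow> 'a \<Rightarrow> 'a \<Rightarrow> 'a \<Rightarrow> 'a \<Rightarrow> 'a \<Rightarrow> 'a \<Rightarrow> 'a \<Rightarrow> 'a \<Rightarrow> 'a \<Rightarrow> 'a \<Rightarrow> bool" where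
  "tripod W y g p q r s h c d u v \<longleftrightarrow> distinct [y, g, p, q, r, s, h, c, d, u, v] \<and>
     {y, g, p, q, r, s, h, c, d, u, v} \<subseteq> W \<and>
     nb W p = {y, g, q} \<and> nb W q = {y, g, p} \<and> nb W r = {y, g, s} \<and> nb W s = {y, g, r} \<and>
     nb W c = {y, h, d} \<and> nb W d = {y, h, c}"

definition exF11 :: "'a set \<Rightarrow> bool" where
  "exF11 W \<longleftrightarrow> (\<exists>y g p q r s h c d u v. tripod W y g p q r s h c d u v \<and>
     W = {y, g, p, q, r, s, h, c, d, u, v} \<and> nb W u = {y, h, v} \<and> nb W v = {y, h, u} \<and> h \<notin> nb W g)"

text \<open>\<open>z\<close> is c_9, and the final disjunction is the requirement that L contains
  one of its two optional edges at c_9.\<close>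

definition exF12 :: "'a set \<Rightarrow> bool" where
  "exF12 W \<longleftrightarrow> (\<exists>y g p q r s h c d u v z. tripod W y g p q r s h c d u v \<and>
     W = {y, g, p, q, r, s, h, c, d, u, v, z} \<and> z \<notin> {y, g, p, q, r, s, h, c, d, u, v} \<and>
     nb W u = {y, h, z} \<and> nb W v = {y, h, z} \<and> h \<notin> nb W g \<and> z \<notin> nb W g \<and> (y \<in> nb W z \<or> h \<in> nb W z))"

section \<open>Lower bounds for degree sums\<close>

lemma nb_edge: "u \<in> nb W v \<Longrightarrow> {v, u} \<in> E" "u \<in> nb W v \<Longrightarrow> {u, v} \<in> E"
  by (simp_all add: nb_def insert_commute)

lemma indep_nb: "I \<subseteq> W \<Longrightarrow> (\<And>u. u \<in> I \<Longrightarrow> nb W u \<inter> I = {}) \<Longrightarrow> indep W E I"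
  by (auto simp: indep_def nb_def)

lemma nb_full:
  assumes "nb W v \<subseteq> X" "finite X" "card X \<le> dg W v"
  shows "nb W v = X"
  using card_seteq[OF assms(2,1)] assms(3) by (simp add: dg_def)

text \<open>The degree condition read backwards, which turns it into a source of lower bounds for
  degree sums.\<close>

lemma heavy:
  assumes "degree_cond W {}" "indep W E J" "v \<in> J" "dg W v < card J"
  shows "card W \<le> wt W J"
proof (rule ccontr)
  assume "\<not> card W \<le> wt W J"
  then have "light_in W J" using assms(2) by (simp add: light_in_def)
  then have "card J + card {} \<le> dg W v"
    using degree_condD[OF assms(1) _ _ assms(3)] assms(2) by (simp add: indep_def)
  then show False using assms(4) by simp
qed

lemma heavy_side:
  assumes s: "sep W y A B" and fin: "finite W" and h: "degree_cond W {}" and I: "indep A E I"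
    and v: "v \<in> I" "dg W v < card I + 1" and b: "b \<in> B"
  shows "card A + card B + 1 \<le> wt W I + dg W b"
proof -
  have IA: "I \<subseteq> A" using I by (simp add: indep_def)
  have fI: "finite I" using IA sep_finite[OF s fin] finite_subset by blast
  have bI: "b \<notin> I" using IA sep_facts(4)[OF s] b by auto
  have "card W \<le> wt W (insert b I)"
    by (rule heavy[OF h sep_indep[OF s I b], of v]) (use v fI bI in auto)
  then show ?thesis using wt_insert[OF fI bI, of W] sep_card[OF s fin] by simp
qed

lemma heavy_sides:
  assumes s: "sep W y A B" and fin: "finite W" and h: "degree_cond W {}" and t: "sep B f F1 F2" and I: "indep A E I"
    and v: "v \<in> I" "dg W v < card I + 2" and b: "b1 \<in> F1" "b2 \<in> F2"
  shows "card A + card B + 1 \<le> wt W I + dg W b1 + dg W b2"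
proof -
  note T = sep_facts[OF t]
  have IA: "I \<subseteq> A" using I by (simp add: indep_def)
  have fI: "finite I" using IA sep_finite[OF s fin] finite_subset by blast
  have bB: "b1 \<in> B" "b2 \<in> B" using T(1) b by auto
  have bI: "b1 \<notin> I" "b2 \<notin> I" using IA sep_facts(4)[OF s] bB by auto
  have ne: "b1 \<noteq> b2" using T(4) b by auto
  have "indep W E (insert b2 (insert b1 I))"
  proof (rule indep_insert[OF sep_indep[OF s I bB(1)]])
    show "b2 \<in> W" using sep_facts(1)[OF s] bB by simp
    show "{b2, u} \<notin> E" if "u \<in> insert b1 I" for u
      using that T(8)[OF b] sep_facts(8)[OF s, of u b2] bB IA by auto
  qed
  then have "card W \<le> wt W (insert b2 (insert b1 I))"
    by (rule heavy[OF h, of _ v]) (use v fI bI ne in auto)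
  also have "\<dots> = dg W b2 + (dg W b1 + wt W I)"
    using wt_insert[of "insert b1 I" b2 W] wt_insert[OF fI bI(1), of W] fI bI ne by auto
  finally show ?thesis using sep_card[OF s fin] by simp
qed

text \<open>The symmetry between \<open>P\<close> and \<open>Q\<close> supplies the order of sizes
  that \<open>exH\<close> asks for.\<close>

lemma exH_intro:
  assumes "distinct [a, b, c, d]" "{a, b, c, d} \<inter> (P \<union> Q) = {}" "P \<inter> Q = {}" "P \<noteq> {}" "Q \<noteq> {}"
    "W = {a, b, c, d} \<union> (P \<union> Q)" "nb W c = {a, d}" "nb W d = {a, c}"
    "\<And>x. x \<in> P \<Longrightarrow> nb W x = insert a (insert b (P - {x}))"
    "\<And>x. x \<in> Q \<Longrightarrow> nb W x = insert a (insert b (Q - {x}))"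
  shows "exH W"
proof (cases "card P \<le> card Q")
  case True
  show ?thesis unfolding exH_def
    by (rule exI[of _ a], rule exI[of _ b], rule exI[of _ c], rule exI[of _ d], rule exI[of _ P], rule exI[of _ Q])
      (use True assms in \<open>intro conjI ballI; simp only:\<close>)
next
  case False
  then have "card Q \<le> card P" by simp
  moreover have "Q \<inter> P = {}" "P \<union> Q = Q \<union> P" using assms(3) by auto
  ultimately show ?thesis unfolding exH_def
    by - (rule exI[of _ a], rule exI[of _ b], rule exI[of _ c], rule exI[of _ d], rule exI[of _ Q], rule exI[of _ P],
      use assms in \<open>intro conjI ballI; simp only:\<close>)
qed

lemma exH_E:
  assumes "exH W"
  obtains a b c d P Q where "distinct [a, b, c, d]" "{a, b, c, d} \<inter> (P \<union> Q) = {}" "P \<inter> Q = {}"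
    "P \<noteq> {}" "Q \<noteq> {}" "W = {a, b, c, d} \<union> (P \<union> Q)" "nb W c = {a, d}" "nb W d = {a, c}"
    "\<forall>x\<in>P. nb W x = insert a (insert b (P - {x}))"
    "\<forall>x\<in>Q. nb W x = insert a (insert b (Q - {x}))" "card P \<le> card Q"
  using assms unfolding exH_def
  by (elim exE conjE) (rule that; assumption)

text \<open>Since \<open>c\<close> has degree 2, it forms a large set with any two nonadjacent
  vertices of \<open>A\<close>. The weight bound for this set is an Ore-type condition: two such
  vertices have degree sum at least \<open>card A + 1\<close> in \<open>W\<close>. If
  \<open>A\<close> is disconnected, a pair across has sum at most \<open>card A\<close>. If
  \<open>A\<close> has a cut vertex \<open>z\<close>, the sum across is at most
  \<open>card A + 1\<close>, so equality holds everywhere and both sides are cliques joined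
  completely to \<open>y\<close> and \<open>z\<close>.\<close>

lemma triangle_side:
  assumes s: "sep W y A B" and fin: "finite W" and h: "degree_cond W {}"
    and B: "B = {c, d}" "c \<noteq> d" "{c, d} \<in> E" "{y, c} \<in> E" "{y, d} \<in> E"
  shows "partitionable W {} \<or> exF5 W \<or> exH W"
proof -
  note S = sep_facts[OF s]
  have s': "sep W y B A" by (rule sep_sym[OF s])
  have fA: "finite A" using sep_finite[OF s fin] by simp
  have cB: "card B = 2" using B by simp
  have cd: "c \<in> B" "d \<in> B" "c \<noteq> y" "d \<noteq> y" using B S(3) by auto
  have nbB: "nb W c = {y, d}" "nb W d = {y, c}"
  proof -
    have "{d, c} \<in> E" "{c, y} \<in> E" "{d, y} \<in> E" using B by (simp_all add: insert_commute)
    moreover have "{c, a} \<notin> E" "{d, a} \<notin> E" if "a \<in> A" for a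
      using S(8)[OF that cd(1)] S(8)[OF that cd(2)] by auto
    ultimately show "nb W c = {y, d}" "nb W d = {y, c}"
      using S(1) B no_loop[of c] no_loop[of d] unfolding nb_def by auto
  qed
  have dgc: "dg W c = 2" using nbB(1) cd by (simp add: dg_def)
  have dgA: "2 \<le> dg W v" if "v \<in> A" for v
    using side_free_dg[OF s' fin h, of c v] cd that by simp
  have tri: "biconn (insert y B)"
    using biconn_triangle[of y c d] B cd by (simp add: insert_commute)
  have sum: "card A + 1 \<le> dg W v + dg W w" if "v \<in> A" "w \<in> A" "v \<noteq> w" "{v, w} \<notin> E" for v w
  proof -
    have i: "indep A E {v, w}" using that no_loop by (auto simp: indep_def insert_commute)
    have "indep W E {c, v, w}" using sep_indep[OF s i cd(1)] by simp
    moreover have "c \<notin> {v, w}" using S(4) cd that by auto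
    moreover have "card {c, v, w} = 3" using that calculation by auto
    ultimately have "card W \<le> wt W {c, v, w}" using heavy[OF h, of "{c, v, w}" c] dgc by simp
    also have "\<dots> = 2 + (dg W v + dg W w)"
      using dgc that \<open>c \<notin> {v, w}\<close> by (simp add: wt_def)
    finally show ?thesis using sep_card[OF s fin] cB by simp
  qed
  show ?thesis
  proof (cases "biconn A")
    case True
    obtain v where v: "v \<in> A" using S(5) by auto
    have "two_proper_partition (A \<union> insert y B) E {insert y B, A}"
      by (rule two_proper_insert[OF two_proper_single[OF True] tri]) (use S in auto)
    moreover have "A \<union> insert y B = W - {}" using S(1) by auto
    moreover have "v \<noteq> c" using v cd S(4) by auto
    then have "card {insert y B, A} \<le> card {v, c}" by (simp add: card_insert_if)
    moreover have "light_in W {v, c}" by (rule light_in_pair[OF s fin v cd(1)])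
    ultimately have "partitionable W {}"
      using partitionableI[of "{}" "{}" W "{insert y B, A}" "{v, c}"] v cd S(1) by auto
    then show ?thesis by simp
  next
    case nA: False
    have c1: "card A \<noteq> 1"
      using dgA sep_dg(3)[OF s fin] S(5) by fastforce
    have c0: "card A \<noteq> 0" using fA S(5) by simp
    show ?thesis
    proof (cases "card A = 2")
      case True
      then obtain v w where A: "A = {v, w}" "v \<noteq> w" by (meson card_2_iff)
      have yv: "y \<noteq> v" "y \<noteq> w" using S(2) A by auto
      have n: "nb W x \<subseteq> insert y (A - {x})" if "x \<in> A" for x
        using sep_nb(1)[OF s that] nb_subset[of A x] self_notin_nb[of x A] by blast
      have "nb W v = {y, w}"
        by (rule nb_full) (use n[of v] dgA[of v] A yv in auto)
      moreover have "nb W w = {y, v}"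
        by (rule nb_full) (use n[of w] dgA[of w] A yv in auto)
      moreover have "distinct [y, c, d, v, w]" using A B cd yv S(4) by auto
      moreover have "W = {y, c, d, v, w}" using S(1) A(1) B(1) by auto
      ultimately have "exF5 W" unfolding exF5_def using nbB by blast
      then show ?thesis by simp
    next
      case False
      then have "card A > 2" using c0 c1 by simp
      then consider P Q where "split A P Q" | z P Q where "sep A z P Q"
        using nA biconn_iff by blast
      then show ?thesis
      proof cases
        case 1
        note T = split_facts[OF 1]
        obtain v w where vw: "v \<in> P" "w \<in> Q" using T by auto
        have fPQ: "finite P" "finite Q" using T(1) fA by auto
        have vA: "v \<in> A" "w \<in> A" "v \<noteq> w" using vw T(1,2) by auto
        have "nb W v \<subseteq> insert y (P - {v})"
          using sep_nb(1)[OF s vA(1)] split_nb[OF 1 vw(1)] nb_subset[of P v] self_notin_nb[of v P] by blast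
        then have "dg W v \<le> card (insert y (P - {v}))" by (rule dg_le) (use fPQ in simp)
        also have "\<dots> \<le> card P" using card_Suc_Diff1[OF fPQ(1) vw(1)] fPQ by (simp add: card_insert_if)
        finally have dv: "dg W v \<le> card P" .
        have "nb W w \<subseteq> insert y (Q - {w})"
          using sep_nb(1)[OF s vA(2)] split_nb[OF split_sym[OF 1] vw(2)] nb_subset[of Q w] self_notin_nb[of w Q] by blast
        then have "dg W w \<le> card (insert y (Q - {w}))" by (rule dg_le) (use fPQ in simp)
        also have "\<dots> \<le> card Q" using card_Suc_Diff1[OF fPQ(2) vw(2)] fPQ by (simp add: card_insert_if)
        finally have "dg W v + dg W w \<le> card A" using dv split_card[OF 1 fA] by simp
        then show ?thesis using sum[OF vA T(5)[OF vw]] by simp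
      next
        case 2
        note T = sep_facts[OF 2]
        have fPQ: "finite P" "finite Q" using sep_finite[OF 2 fA] by auto
        have full: "nb W v = insert y (insert z (P - {v}))" if v: "v \<in> P" and t: "sep A z P Q" for v P Q
        proof (rule nb_full)
          note T = sep_facts[OF t]
          have fP: "finite P" using sep_finite[OF t fA] by simp
          obtain w where w: "w \<in> Q" using T(6) by auto
          have vw: "v \<in> A" "w \<in> A" "v \<noteq> w" using T(1,4) v w by auto
          show "nb W v \<subseteq> insert y (insert z (P - {v}))" by (rule sep_sep_dg(1)[OF s' fin t v])
          show "finite (insert y (insert z (P - {v})))" using fP by simp
          have "card (insert y (insert z (P - {v}))) \<le> card P + 1"
            using card_Suc_Diff1[OF fP v] fP by (simp add: card_insert_if)
          also have "\<dots> \<le> dg W v"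
            using sum[OF vw T(7)[OF v w]] sep_sep_dg(2)[OF s' fin sep_sym[OF t] w] sep_card[OF t fA] by simp
          finally show "card (insert y (insert z (P - {v}))) \<le> dg W v" .
        qed
        have "exH W"
        proof (rule exH_intro[of y z c d P Q])
          have "z \<in> A" "P \<subseteq> A" "Q \<subseteq> A" using T(1) by auto
          then show "distinct [y, z, c, d]" "{y, z, c, d} \<inter> (P \<union> Q) = {}" using S(2-4) T(2,3) B cd by auto
          show "W = {y, z, c, d} \<union> (P \<union> Q)" using S(1) T(1) B(1) by auto
        qed (use T nbB full[OF _ 2] full[OF _ sep_sym[OF 2]] in auto)
        then show ?thesis by simp
      qed
    qed
  qed
qed

section \<open>Dividing an end block at its inner cut vertex\<close>

lemma miss_at_most_one:
  assumes "nb W u \<subseteq> X" "finite X" "card X \<le> dg W u + 1" "x \<in> X - nb W u" "x' \<in> X - nb W u"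
  shows "x = x'"
proof (rule ccontr)
  assume ne: "x \<noteq> x'"
  have "nb W u \<subseteq> X - {x, x'}" using assms by auto
  then have "dg W u \<le> card (X - {x, x'})" by (rule dg_le) (use assms in simp)
  moreover have "card (X - {x, x'}) + 2 = card X"
    using assms ne card_mono[of X "{x, x'}"] by (simp add: card_Diff_subset)
  ultimately show False using assms(3) by simp
qed

text \<open>Two triangles sharing \<open>f\<close>, with \<open>y\<close> adjacent to the four outer
  vertices. Whether \<open>y\<close> and \<open>f\<close> are adjacent is left open.\<close>

definition bow :: "'a set \<Rightarrow> 'a \<Rightarrow> 'a \<Rightarrow> 'a set \<Rightarrow> bool" where
  "bow W y f B \<longleftrightarrow> (\<exists>p q r s. distinct [f, p, q, r, s] \<and> B = {f, p, q, r, s} \<and>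
        nb W p = {y, f, q} \<and> nb W q = {y, f, p} \<and> nb W r = {y, f, s} \<and> nb W s = {y, f, r})"

text \<open>One of the two triangles of a bow tie survives; beyond \<open>f\<close>, the other pair
  of vertices is replaced by the path \<open>u\<close>, \<open>z\<close>, \<open>v\<close>, whose
  ends see both \<open>y\<close> and \<open>f\<close>.\<close>

definition kite :: "'a set \<Rightarrow> 'a \<Rightarrow> 'a \<Rightarrow> 'a set \<Rightarrow> bool" where
  "kite W y f B \<longleftrightarrow> (\<exists>p q u v z. distinct [f, p, q, u, v, z] \<and> B = {f, p, q, u, v, z} \<and>
        nb W p = {y, f, q} \<and> nb W q = {y, f, p} \<and> nb W u = {y, f, z} \<and> nb W v = {y, f, z} \<and>
        (y \<in> nb W z \<or> f \<in> nb W z))"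

lemma bow_E:
  assumes "bow W y f B"
  obtains p q r s where "distinct [f, p, q, r, s]" "B = {f, p, q, r, s}"
    "nb W p = {y, f, q}" "nb W q = {y, f, p}" "nb W r = {y, f, s}" "nb W s = {y, f, r}"
  using assms unfolding bow_def by (elim exE conjE) (rule that; assumption)

lemma kite_E:
  assumes "kite W y f B"
  obtains p q u v z where "distinct [f, p, q, u, v, z]" "B = {f, p, q, u, v, z}"
    "nb W p = {y, f, q}" "nb W q = {y, f, p}" "nb W u = {y, f, z}" "nb W v = {y, f, z}"
    "y \<in> nb W z \<or> f \<in> nb W z"
  using assms unfolding kite_def by (elim exE conjE) (rule that; assumption)

text \<open>Here each vertex of \<open>F1\<close> misses at most one of its potential neighbours and \<open>F2\<close> misses none.
  If the two parts obtained by giving \<open>f\<close> to one of the sides fail, only two small cases survive.\<close>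

lemma near_complete_sides:
  assumes s: "sep W y A B" and fin: "finite W" and t: "sep B f F1 F2"
    and full: "\<And>u. u \<in> F2 \<Longrightarrow> card F2 + 1 \<le> dg W u" and near: "\<And>u. u \<in> F1 \<Longrightarrow> card F1 \<le> dg W u"
    and deg: "\<And>u. u \<in> F1 \<union> F2 \<Longrightarrow> 3 \<le> dg W u"
  shows "(\<exists>X1 X2. biconn X1 \<and> biconn X2 \<and> X1 \<inter> X2 = {} \<and> X1 \<union> X2 = B) \<or> bow W y f B \<or> kite W y f B" (is "?parts \<or> ?bow \<or> ?kite")
proof -
  note S = sep_facts[OF s] and T = sep_facts[OF t]
  have fB: "finite B" using sep_finite[OF s fin] by simp
  have fF: "finite F1" "finite F2" using sep_finite[OF t fB] by auto
  have yf: "y \<noteq> f" using S(3) T(1) by auto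
  have yF: "y \<notin> F1" "y \<notin> F2" using S(3) T(1) by auto
  have sub: "nb W u \<subseteq> insert y (insert f (F - {u}))" "finite (insert y (insert f (F - {u})))"
    "card (insert y (insert f (F - {u}))) = card F + 1"
    if "u \<in> F" "F = F1 \<or> F = F2" for u F
  proof -
    show "nb W u \<subseteq> insert y (insert f (F - {u}))"
      using that sep_sep_dg(1)[OF s fin t] sep_sep_dg(1)[OF s fin sep_sym[OF t]] by auto
    have fF': "finite F" and n: "y \<notin> F" "f \<notin> F" using that fF yF T(2,3) by auto
    then show "finite (insert y (insert f (F - {u})))" by simp
    show "card (insert y (insert f (F - {u}))) = card F + 1"
      using fF' n yf card_Suc_Diff1[OF fF' that(1)] by simp
  qed
  have nb2: "nb W u = insert y (insert f (F2 - {u}))" if "u \<in> F2" for u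
    by (rule nb_full[OF sub(1,2)]) (use that full sub(3)[of u F2] in auto)
  have miss: "x = x'" if u: "u \<in> F1" and x: "x \<in> insert f (F1 - {u})" "{u, x} \<notin> E"
    and x': "x' \<in> insert f (F1 - {u})" "{u, x'} \<notin> E" for u x x'
  proof (rule miss_at_most_one[OF sub(1,2)[OF u]])
    show "card (insert y (insert f (F1 - {u}))) \<le> dg W u + 1" using near[OF u] sub(3)[OF u] by simp
    show "x \<in> insert y (insert f (F1 - {u})) - nb W u" "x' \<in> insert y (insert f (F1 - {u})) - nb W u"
      using x x' by (auto simp: nb_def)
  qed simp_all
  have two: "2 \<le> card F1" "2 \<le> card F2"
  proof -
    have "2 \<le> card F" if F: "F = F1 \<or> F = F2" for F
    proof -
      obtain u where u: "u \<in> F" using F T(5,6) by auto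
      have "dg W u \<le> card F + 1" using dg_le[OF sub(1,2)[OF u F]] sub(3)[OF u F] by simp
      moreover have "3 \<le> dg W u" using deg u F by auto
      ultimately show ?thesis by simp
    qed
    then show "2 \<le> card F1" "2 \<le> card F2" by auto
  qed
  have nb1: "nb W u = insert y (insert f (F1 - {u}))" if "u \<in> F1" "card F1 = 2" for u
    by (rule nb_full[OF sub(1,2)]) (use that deg[of u] sub(3)[of u F1] in auto)
  have clique2: "{u, v} \<in> E" if "u \<in> insert f F2" "v \<in> insert f F2" "u \<noteq> v" for u v
  proof (cases "u = f")
    case True
    then have "u \<in> nb W v" using nb2[of v] that by auto
    then show ?thesis by (rule nb_edge)
  next
    case False
    then have "v \<in> nb W u" using nb2[of u] that by auto
    then show ?thesis by (rule nb_edge)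
  qed
  have cf2: "card (insert f F2) > 2" using fF T(3) two by simp
  have bf2: "biconn (insert f F2)" by (rule biconn_clique[OF cf2 clique2])
  \<comment> \<open>One way to give away \<open>f\<close>: together with the complete side it is a
    clique of at least three vertices, so only \<open>F1\<close> has to be 2-connected on its
    own.\<close>
  have parts1: ?parts if "biconn F1"
    using that bf2 T(1,2,4) by (intro exI[of _ F1] exI[of _ "insert f F2"]) auto
  show ?thesis
  proof (cases "card F2 = 2")
    case True
    then obtain p q where pq: "F2 = {p, q}" "p \<noteq> q" by (meson card_2_iff)
    have npq: "nb W p = {y, f, q}" "nb W q = {y, f, p}" using nb2[of p] nb2[of q] pq by auto
    have fpq: "f \<noteq> p" "f \<noteq> q" using T(3) pq by auto
    show ?thesis
    proof (cases "card F1 = 2")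
      case True
      then obtain r s' where rs: "F1 = {r, s'}" "r \<noteq> s'" by (meson card_2_iff)
      have "nb W r = {y, f, s'}" "nb W s' = {y, f, r}" using nb1[OF _ True, of r] nb1[OF _ True, of s'] rs by auto
      moreover have "distinct [f, p, q, r, s']" using pq(2) rs(2) fpq T(2,4) rs(1) pq(1) by auto
      moreover have "B = {f, p, q, r, s'}" using T(1) pq(1) rs(1) by auto
      ultimately have ?bow using npq unfolding bow_def by blast
      then show ?thesis by simp
    next
      case F1: False
      show ?thesis
      proof (cases "biconn F1")
        case False
        \<comment> \<open>A vertex of \<open>P\<close> misses all of \<open>Q\<close>, but it may
          miss only one vertex. Hence both sides of any separation of \<open>F1\<close> are
          singletons, and only the path with three vertices is left.\<close>
        have small: "card Q \<le> 1" if "P \<noteq> {}" "P \<subseteq> F1" "Q \<subseteq> F1" "P \<inter> Q = {}" "\<And>p q. p \<in> P \<Longrightarrow> q \<in> Q \<Longrightarrow> {p, q} \<notin> E" for P Q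
        proof -
          obtain u where u: "u \<in> P" using \<open>P \<noteq> {}\<close> by auto
          have "x = x'" if "x \<in> Q" "x' \<in> Q" for x x'
            by (rule miss[of u]) (use that u \<open>P \<subseteq> F1\<close> \<open>Q \<subseteq> F1\<close> \<open>P \<inter> Q = {}\<close> \<open>\<And>p q. p \<in> P \<Longrightarrow> q \<in> Q \<Longrightarrow> {p, q} \<notin> E\<close> in auto)
          then show ?thesis using card_le_Suc0_iff_eq[of Q] finite_subset[OF \<open>Q \<subseteq> F1\<close> fF(1)] by auto
        qed
        have "card F1 > 2" using F1 two by simp
        then consider P Q where "split F1 P Q" | z P Q where "sep F1 z P Q"
          using False biconn_iff by blast
        then show ?thesis
        proof cases
          case 1
          note U = split_facts[OF 1]
          have "P \<subseteq> F1" "Q \<subseteq> F1" using U(1) by auto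
          then have "card Q \<le> 1" "card P \<le> 1" using small[of P Q] small[of Q P] U(2-6) by auto
          then show ?thesis using split_card[OF 1 fF(1)] \<open>card F1 > 2\<close> by simp
        next
          case 2
          note U = sep_facts[OF 2]
          have PQ: "P \<subseteq> F1" "Q \<subseteq> F1" using U(1) by auto
          then have "card Q \<le> 1" "card P \<le> 1" using small[of P Q] small[of Q P] U(4-8) by auto
          moreover have "finite P" "finite Q" using PQ fF finite_subset by auto
          ultimately have "card P = 1" "card Q = 1" using U(5,6) card_0_eq[of P] card_0_eq[of Q] by linarith+
          then obtain u v where uv: "P = {u}" "Q = {v}" by (meson card_1_singletonE)
          have F1: "F1 = {z, u, v}" using U(1) uv by auto
          have ne: "z \<noteq> u" "z \<noteq> v" "u \<noteq> v" using U(2-4) uv by auto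
          have nuv: "{u, v} \<notin> E" "{v, u} \<notin> E" using U(7,8)[of u v] uv by auto
          have fz: "f \<noteq> z" "f \<noteq> u" "f \<noteq> v" "y \<noteq> z" "y \<noteq> u" "y \<noteq> v" using T(2) yF F1 by auto
          have c3: "card F1 = 3" using F1 ne by auto
          have "nb W u = {y, f, z}"
            by (rule nb_full) (use sub(1)[of u F1] nuv near[of u] F1 ne c3 fz yf in \<open>auto simp: nb_def\<close>)
          moreover have "nb W v = {y, f, z}"
            by (rule nb_full) (use sub(1)[of v F1] nuv near[of v] F1 ne c3 fz yf in \<open>auto simp: nb_def\<close>)
          \<comment> \<open>Inside \<open>F1\<close> the vertex \<open>z\<close> has only the
            neighbours \<open>u\<close> and \<open>v\<close>, while its degree is at least
            \<open>card F1 = 3\<close>.\<close>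
          moreover have "y \<in> nb W z \<or> f \<in> nb W z"
          proof (rule ccontr)
            assume "\<not> ?thesis"
            then have "nb W z \<subseteq> {u, v}" using sub(1)[of z F1] F1 by auto
            then have "dg W z \<le> card {u, v}" by (rule dg_le) simp
            then show False using near[of z] F1 c3 ne by simp
          qed
          moreover have "distinct [f, p, q, u, v, z]" using pq ne fz fpq T(4) F1 by auto
          moreover have "B = {f, p, q, u, v, z}" using T(1) pq(1) F1 by auto
          ultimately have ?kite using npq unfolding kite_def by blast
          then show ?thesis by simp
        qed
      qed (use parts1 in simp)
    qed
  next
    case False
    then have "card F2 > 2" using two by simp
    then have b2: "biconn F2" by (rule biconn_clique) (use clique2 in auto)
    show ?thesis
    proof (cases "biconn (insert f F1)")
      case True
      then have ?parts
        using b2 T(1,3,4) by (intro exI[of _ "insert f F1"] exI[of _ F2]) auto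
      then show ?thesis by simp
    next
      case nb: False
      have cf1: "card (insert f F1) > 2" using fF T(2) two by simp
      have "card F1 > 2"
      proof (rule ccontr)
        assume "\<not> card F1 > 2"
        then have c2: "card F1 = 2" using two by simp
        have "biconn (insert f F1)"
        proof (rule biconn_clique[OF cf1])
          fix u v assume uv: "u \<in> insert f F1" "v \<in> insert f F1" "u \<noteq> v"
          show "{u, v} \<in> E"
          proof (cases "u = f")
            case True
            then have "u \<in> nb W v" using nb1[OF _ c2, of v] uv by auto
            then show ?thesis by (rule nb_edge)
          next
            case False
            then have "v \<in> nb W u" using nb1[OF _ c2, of u] uv by auto
            then show ?thesis by (rule nb_edge)
          qed
        qed
        then show False using nb by simp
      qed
      have small: "card Q \<le> 1" if u: "u \<in> P" "u \<in> F1" and Q: "Q \<subseteq> insert f F1" "P \<inter> Q = {}"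
        and e: "\<And>p q. p \<in> P \<Longrightarrow> q \<in> Q \<Longrightarrow> {p, q} \<notin> E" for P Q u
      proof -
        have "x = x'" if "x \<in> Q" "x' \<in> Q" for x x'
          by (rule miss[OF u(2)]) (use that u Q e in auto)
        then show ?thesis using card_le_Suc0_iff_eq[of Q] finite_subset[OF Q(1)] fF by auto
      qed
      \<comment> \<open>\<open>U\<close> stands for \<open>insert f F1\<close>, possibly with one
        vertex removed, so that disconnections and cut vertices are treated together. One side of
        the split has two or more vertices; a vertex of \<open>F1\<close> on the opposite side would
        miss all of them, so the opposite side is just \<open>f\<close>. Each vertex of the big side
        thus spends its only miss on \<open>f\<close> and sees the rest of \<open>F1\<close>. As
        \<open>U\<close> lacks at most one vertex, any two vertices of \<open>F1\<close> include one
        from the big side, so \<open>F1\<close> is a clique.\<close>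
      have cliq: ?parts if PQ: "split U P Q" and U: "U \<subseteq> insert f F1" "card (insert f F1 - U) \<le> 1" for U P Q
      proof -
        note X = split_facts[OF PQ]
        have PQs: "P \<subseteq> insert f F1" "Q \<subseteq> insert f F1" using X(1) U(1) by auto
        have fU: "finite U" "finite P" "finite Q" using U(1) PQs fF by (auto intro: finite_subset)
        have "card (insert f F1) = card U + card (insert f F1 - U)"
          using U(1) fU fF by (metis card_Diff_subset card_mono finite_insert le_add_diff_inverse)
        then have "card P + card Q \<ge> 3"
          using split_card[OF PQ fU(1)] U(2) \<open>card F1 > 2\<close> fF T(2) by simp
        then have big: "card P > 1 \<or> card Q > 1" by auto
        have "\<exists>Q'. Q' \<subseteq> F1 \<and> U = insert f Q' \<and> (\<forall>q\<in>Q'. {q, f} \<notin> E)"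
        proof (cases "card Q > 1")
          case True
          have "u \<notin> F1" if "u \<in> P" for u
          proof
            assume "u \<in> F1"
            from small[OF that this PQs(2) X(2) X(5)] True show False by simp
          qed
          then have P: "P = {f}" using PQs(1) X(3) by auto
          then have "Q \<subseteq> F1" using PQs(2) X(2) by auto
          then show ?thesis using P X(1) X(6) by (intro exI[of _ Q]) auto
        next
          case False
          then have c: "card P > 1" using big by simp
          have "Q \<inter> P = {}" using X(2) by auto
          have "u \<notin> F1" if "u \<in> Q" for u
          proof
            assume "u \<in> F1"
            from small[OF that this PQs(1) \<open>Q \<inter> P = {}\<close> X(6)] c show False by simp
          qed
          then have Q: "Q = {f}" using PQs(2) X(4) by auto
          then have "P \<subseteq> F1" using PQs(1) X(2) by auto
          then show ?thesis using Q X(1) X(5) by (intro exI[of _ P]) auto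
        qed
        then obtain Q' where Q': "Q' \<subseteq> F1" "U = insert f Q'" "\<And>q. q \<in> Q' \<Longrightarrow> {q, f} \<notin> E" by auto
        have half: "{u, v} \<in> E" if "u \<in> Q'" "v \<in> F1" "u \<noteq> v" for u v
        proof (rule ccontr)
          assume "{u, v} \<notin> E"
          then have "v = f" using miss[of u v f] that Q' by auto
          then show False using that T(2) by simp
        qed
        have "biconn F1"
        proof (rule biconn_clique[OF \<open>card F1 > 2\<close>])
          fix u v assume uv: "u \<in> F1" "v \<in> F1" "u \<noteq> v"
          have "u \<in> Q' \<or> v \<in> Q'"
          proof (rule ccontr)
            assume "\<not> ?thesis"
            then have "{u, v} \<subseteq> insert f F1 - U" using uv Q'(2) T(2) by auto
            then have "card {u, v} \<le> card (insert f F1 - U)" by (rule card_mono[rotated]) (use fF in simp)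
            then show False using U(2) uv(3) by simp
          qed
          then show "{u, v} \<in> E" using half[of u v] half[of v u] uv by (auto simp: insert_commute)
        qed
        then show ?parts by (rule parts1)
      qed
      from nb cf1 consider P Q where "split (insert f F1) P Q" | z P Q where "sep (insert f F1) z P Q"
        using biconn_iff by blast
      then have ?parts
      proof cases
        case 1 then show ?thesis by (rule cliq) simp_all
      next
        case 2
        then have z: "z \<in> insert f F1" "split (insert f F1 - {z}) P Q" by (simp_all add: sep_def)
        have "insert f F1 - (insert f F1 - {z}) = {z}" using z(1) by auto
        then show ?thesis using cliq[OF z(2)] by auto
      qed
      then show ?thesis by simp
    qed
  qed
qed

section \<open>Tight light sets in the exceptional graphs\<close>

lemma light_in_triple:
  assumes "{a, b, c} \<subseteq> W" "distinct [a, b, c]" "b \<notin> nb W a" "c \<notin> nb W a" "c \<notin> nb W b"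
    "dg W a = 3" "dg W b = 3" "dg W c = 3" "9 < card W"
  shows "light_in W {a, b, c}" "wt W {a, b, c} = 9"
proof -
  show w: "wt W {a, b, c} = 9" using assms(2,6-8) by (simp add: wt_def)
  have "{a, b} \<notin> E" "{a, c} \<notin> E" "{b, c} \<notin> E" using assms(1,3-5) by (auto simp: nb_def)
  moreover have "{b, a} = {a, b}" "{c, a} = {a, c}" "{c, b} = {b, c}" by auto
  ultimately have "indep W E {a, b, c}" using assms(1) no_loop[of a] no_loop[of b] no_loop[of c]
    by (simp add: indep_def)
  then show "light_in W {a, b, c}" using w assms(9) by (simp add: light_in_def)
qed

lemma tripod_light_in:
  assumes t: "tripod W y g p q r s h c d u v" and fin: "finite W"
  shows "light_in W {p, r, c}" "light_in W {q, s, d}" "wt W {p, r, c} = 9"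
    "dg W p = 3" "dg W q = 3" "dg W r = 3" "dg W s = 3" "dg W c = 3" "dg W d = 3" "11 \<le> card W"
proof -
  have D: "distinct [y, g, p, q, r, s, h, c, d, u, v]" and sub: "{y, g, p, q, r, s, h, c, d, u, v} \<subseteq> W"
    and N: "nb W p = {y, g, q}" "nb W q = {y, g, p}" "nb W r = {y, g, s}" "nb W s = {y, g, r}"
      "nb W c = {y, h, d}" "nb W d = {y, h, c}"
    using t by (auto simp: tripod_def)
  have "card {y, g, p, q, r, s, h, c, d, u, v} = 11" using D by simp
  then show c: "11 \<le> card W" using card_mono[OF fin sub] by simp
  show dg: "dg W p = 3" "dg W q = 3" "dg W r = 3" "dg W s = 3" "dg W c = 3" "dg W d = 3"
    using D by (simp_all add: dg_def N)
  show "light_in W {p, r, c}" "wt W {p, r, c} = 9"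
    by (rule light_in_triple; use D sub N dg c in auto)+
  show "light_in W {q, s, d}" by (rule light_in_triple; use D sub N dg c in auto)
qed

definition exceptional_type :: "'a set \<Rightarrow> bool" where
  "exceptional_type W \<longleftrightarrow> exK2 W \<or> exF5 W \<or> exH W \<or> exF11 W \<or> exF12 W"

lemma tripod_critical:
  assumes t: "tripod W y g p q r s h c d u v" and fin: "finite W"
  shows "\<exists>I v. light_in W I \<and> x \<notin> I \<and> v \<in> I \<and> dg W v \<le> card I"
proof -
  note L = tripod_light_in[OF t fin]
  have D: "distinct [p, r, c]" "distinct [q, s, d]" "{p, r, c} \<inter> {q, s, d} = {}"
    using t by (auto simp: tripod_def)
  show ?thesis
  proof (cases "x \<in> {p, r, c}")
    case True
    then have "x \<notin> {q, s, d}" using D by auto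
    moreover have "card {q, s, d} = 3" using D by simp
    ultimately show ?thesis using L by (intro exI[of _ "{q, s, d}"] exI[of _ q]) simp
  next
    case False
    moreover have "card {p, r, c} = 3" using D by simp
    ultimately show ?thesis using L by (intro exI[of _ "{p, r, c}"] exI[of _ p]) simp
  qed
qed

lemma exF5_facts:
  assumes "distinct [g, p, q, r, s]" "W = {g, p, q, r, s}"
    "nb W p = {g, q}" "nb W q = {g, p}" "nb W r = {g, s}" "nb W s = {g, r}"
  shows "light_in W {p, r}" "light_in W {q, s}" "dg W p = 2" "dg W q = 2" "dg W r = 2" "dg W s = 2" "card W = 5"
proof -
  show dg: "dg W p = 2" "dg W q = 2" "dg W r = 2" "dg W s = 2" using assms(1) by (simp_all add: dg_def assms(3-6))
  show c: "card W = 5" using assms(1) by (simp add: assms(2))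
  have "indep W E {p, r}" by (rule indep_nb) (use assms in auto)
  then show "light_in W {p, r}" using c dg assms(1) by (simp add: light_in_def wt_def)
  have "indep W E {q, s}" by (rule indep_nb) (use assms in auto)
  then show "light_in W {q, s}" using c dg assms(1) by (simp add: light_in_def wt_def)
qed

lemma exH_facts:
  assumes "distinct [a, b, c, d]" "{a, b, c, d} \<inter> (P \<union> Q) = {}" "P \<inter> Q = {}" "P \<noteq> {}" "Q \<noteq> {}"
    "W = {a, b, c, d} \<union> (P \<union> Q)" "nb W c = {a, d}" "finite W"
    "\<forall>x\<in>P. nb W x = insert a (insert b (P - {x}))"
  shows "card W = card P + card Q + 4" "x \<in> P \<Longrightarrow> dg W x = card P + 1" "dg W c = 2"
    "x \<in> P \<Longrightarrow> light_in W {c, x}"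
proof -
  have fin: "finite P" "finite Q" using assms(6,8) by auto
  have "card W = card {a, b, c, d} + card (P \<union> Q)"
    unfolding assms(6) by (rule card_Un_disjoint) (use fin assms(2) in auto)
  also have "\<dots> = 4 + (card P + card Q)" using assms(1) card_Un_disjoint[OF fin assms(3)] by simp
  finally show cW: "card W = card P + card Q + 4" by simp
  show dc: "dg W c = 2" using assms(1) by (simp add: dg_def assms(7))
  assume x: "x \<in> P"
  have ab: "a \<notin> P" "b \<notin> P" "c \<notin> P" "d \<notin> P" using assms(2) by auto
  have "Suc (card (P - {x})) = card P" by (rule card_Suc_Diff1[OF fin(1) x])
  then show dx: "dg W x = card P + 1"
    using assms(1) ab fin by (simp add: dg_def bspec[OF assms(9) x])
  have cx: "c \<noteq> x" "a \<noteq> x" "d \<noteq> x" "b \<noteq> x" using x ab by auto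
  have "indep W E {c, x}"
    by (rule indep_nb) (use assms(1,6) cx x ab assms(7) bspec[OF assms(9) x] in auto)
  moreover have "card Q > 0" using fin assms(5) by (simp add: card_gt_0_iff)
  ultimately show "light_in W {c, x}" using cx dc dx cW by (simp add: light_in_def wt_def)
qed

text \<open>This tightness is the only property of exceptional graphs used to exclude them. Two
  disjoint tight sets are exhibited in each graph, so one of them avoids the prescribed vertex
  \<open>x\<close>, for instance a cut vertex whose degree changes.\<close>

lemma exceptional_type_critical:
  assumes fin: "finite W" and e: "exceptional_type W"
  shows "\<exists>I v. light_in W I \<and> x \<notin> I \<and> v \<in> I \<and> dg W v \<le> card I"
proof -
  consider "exK2 W" | "exF5 W" | "exH W" | "exF11 W" | "exF12 W" using e by (auto simp: exceptional_type_def)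
  then show ?thesis
  proof cases
    case 1
    then obtain u v where uv: "u \<noteq> v" "W = {u, v}" by (auto simp: exK2_def)
    have "\<exists>w\<in>W. w \<noteq> x" using uv by auto
    then obtain w where w: "w \<in> W" "w \<noteq> x" by auto
    have "dg W w < 2" using dg_less_card[OF fin w(1)] uv by simp
    then show ?thesis using light_in_single[OF fin w(1)] w(2) by (intro exI[of _ "{w}"] exI[of _ w]) simp
  next
    case 2
    then obtain g p q r s where F: "distinct [g, p, q, r, s]" "W = {g, p, q, r, s}"
      "nb W p = {g, q}" "nb W q = {g, p}" "nb W r = {g, s}" "nb W s = {g, r}"
      unfolding exF5_def by blast
    note L = exF5_facts[OF F]
    have c: "card {p, r} = 2" "card {q, s} = 2" using F(1) by auto
    show ?thesis
    proof (cases "x \<in> {p, r}")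
      case True
      then have "x \<notin> {q, s}" using F(1) by auto
      then show ?thesis using L c by (intro exI[of _ "{q, s}"] exI[of _ q]) simp
    next
      case False
      then show ?thesis using L c by (intro exI[of _ "{p, r}"] exI[of _ p]) simp
    qed
  next
    case 3
    then obtain a b c d P Q where H: "distinct [a, b, c, d]" "{a, b, c, d} \<inter> (P \<union> Q) = {}" "P \<inter> Q = {}"
      "P \<noteq> {}" "Q \<noteq> {}" "W = {a, b, c, d} \<union> (P \<union> Q)" "nb W c = {a, d}" "nb W d = {a, c}"
      "\<forall>x\<in>P. nb W x = insert a (insert b (P - {x}))"
      "\<forall>x\<in>Q. nb W x = insert a (insert b (Q - {x}))" "card P \<le> card Q"
      by (rule exH_E) (rule that; assumption)
    obtain v w where vw: "v \<in> P" "w \<in> Q" using H(4,5) by auto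
    have W': "W = {a, b, d, c} \<union> (Q \<union> P)" using H(6) by auto
    have 1: "light_in W {c, v}" "dg W c = 2" using exH_facts(3,4)[OF H(1-7) fin H(9)] vw by auto
    have 2: "light_in W {d, w}" "dg W d = 2"
      using exH_facts(3,4)[of a b d c Q P W, OF _ _ _ H(5,4) W' H(8) fin H(10)] H(1-3) vw by auto
    have ne: "c \<noteq> v" "d \<noteq> w" "{c, v} \<inter> {d, w} = {}" using H(1-3) vw by auto
    show ?thesis
    proof (cases "x \<in> {c, v}")
      case True
      then have "x \<notin> {d, w}" using ne by auto
      then show ?thesis using 2 ne by (intro exI[of _ "{d, w}"] exI[of _ d]) simp
    next
      case False
      then show ?thesis using 1 ne by (intro exI[of _ "{c, v}"] exI[of _ c]) simp
    qed
  next
    case 4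
    then show ?thesis unfolding exF11_def using tripod_critical[OF _ fin] by blast
  next
    case 5
    then show ?thesis unfolding exF12_def using tripod_critical[OF _ fin] by blast
  qed
qed

section \<open>An exceptional rest\<close>

lemma biconn_grow:
  assumes "finite S" "biconn X"
    and "\<And>v. v \<in> S \<Longrightarrow> \<exists>a\<in>X. \<exists>b\<in>X. a \<noteq> b \<and> {v, a} \<in> E \<and> {v, b} \<in> E"
  shows "biconn (X \<union> S)"
  using assms(1,3)
proof (induction S)
  case empty
  then show ?case using assms(2) by simp
next
  case (insert v S)
  then have IH: "biconn (X \<union> S)" by simp
  obtain a b where ab: "a \<in> X" "b \<in> X" "a \<noteq> b" "{v, a} \<in> E" "{v, b} \<in> E" using insert.prems by blast
  show ?case
  proof (cases "v \<in> X")
    case True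
    then show ?thesis using IH by (simp add: insert_absorb)
  next
    case False
    then have "biconn (insert v (X \<union> S))"
      using biconn_insert[OF IH, of v a b] ab insert.hyps by simp
    then show ?thesis by simp
  qed
qed

text \<open>When \<open>y\<close> is added, a vertex of \<open>A\<close> can gain only the edge to
  \<open>y\<close>. A vertex that is tight in \<open>A\<close> but needs a larger degree in
  \<open>W\<close> must therefore have this edge.\<close>

lemma critical_adj:
  assumes s: "sep W y A B" and fin: "finite W" and v: "v \<in> A" "card I + 1 \<le> dg W v" "dg A v \<le> card I"
  shows "{v, y} \<in> E" "{y, v} \<in> E" "nb W v = insert y (nb A v)"
proof -
  have y: "y \<in> nb W v" using sep_dg(5)[OF s fin v(1)] v by fastforce
  then show "{v, y} \<in> E" "{y, v} \<in> E" by (rule nb_edge)+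
  show "nb W v = insert y (nb A v)" using sep_nb[OF s v(1)] y by blast
qed

text \<open>The inequality \<open>k * k < card A\<close> makes \<open>I\<close> light in
  \<open>A\<close>, and \<open>slack_degree_cond\<close> fixes the degrees of its vertices in
  \<open>W\<close> to \<open>k + 1\<close>. With one vertex from each side of \<open>f\<close>,
  \<open>I\<close> becomes a set of size \<open>k + 2\<close>, hence large and heavy. Given
  \<open>k * (k + 1) \<le> card A + 1\<close>, this bounds the degree sum across \<open>f\<close>
  from below, within one of the maximum \<open>card B + 1\<close>. So one side is complete and the
  other nearly complete. If \<open>B\<close> can be divided, there are three parts, and
  \<open>k + 1\<close> is at least 3. All vertices of \<open>F1\<close> and \<open>F2\<close> have
  degree above \<open>k\<close>, while \<open>bow\<close> and \<open>kite\<close> contain vertices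
  of degree at most 3, which leaves them only for \<open>k = 2\<close>.\<close>

lemma anchor_case:
  assumes s: "sep W y A B" and fin: "finite W" and h: "degree_cond W {}" and t: "sep B f F1 F2"
    and I: "indep A E I" "card I = k" "2 \<le> k" "\<And>v. v \<in> I \<Longrightarrow> dg A v = k" "k * k < card A" "k * (k + 1) \<le> card A + 1"
    and yA: "biconn (insert y A)"
  shows "partitionable W {} \<or> (k = 2 \<and> (bow W y f B \<or> kite W y f B))"
proof -
  note S = sep_facts[OF s] and T = sep_facts[OF t]
  have fB: "finite B" using sep_finite[OF s fin] by simp
  have IA: "I \<subseteq> A" using I(1) by (simp add: indep_def)
  have fI: "finite I" using I(2,3) card.infinite by fastforce
  have I0: "I \<noteq> {}" using I(2,3) by auto
  obtain u1 u2 where u: "u1 \<in> F1" "u2 \<in> F2" using T(5,6) by auto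
  have "wt A I = k * k" using I(2,4) by (simp add: wt_def)
  then have l: "light_in A I" using I(1,5) by (simp add: light_in_def)
  have dI: "dg W v = k + 1" if "v \<in> I" for v
  proof -
    have "k + 1 \<le> dg W v" using slack_degree_cond(2)[OF s fin _ h t, of u1 u2 I v] u IA l that I(2) by simp
    moreover have "dg W v \<le> k + 1" using sep_dg(1)[OF s fin, of v] that IA I(4)[OF that] by auto
    ultimately show ?thesis by simp
  qed
  have "wt W I = k * (k + 1)" using I(2) dI by (simp add: wt_def)
  then have sum: "card F1 + card F2 + 1 \<le> dg W v1 + dg W v2" if "v1 \<in> F1" "v2 \<in> F2" for v1 v2
    using heavy_sides[OF s fin h t I(1) _ _ that] I0 dI I(2,6) sep_card[OF t fB] by fastforce
  have dF: "k < dg W v" if "v \<in> F1 \<union> F2" for v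
  proof (cases "v \<in> F1")
    case True
    then show ?thesis using slack(4)[OF s fin _ h t, of v u2 I] u IA l I0 I(2) by simp
  next
    case False
    then show ?thesis
      using slack(4)[OF s fin _ h sep_sym[OF t], of v u1 I] that u IA l I0 I(2) by simp
  qed
  have up: "dg W v1 \<le> card F1 + 1" "dg W v2 \<le> card F2 + 1" if "v1 \<in> F1" "v2 \<in> F2" for v1 v2
    using sep_sep_dg(2)[OF s fin t that(1)] sep_sep_dg(2)[OF s fin sep_sym[OF t] that(2)] .
  let ?parts = "\<exists>X1 X2. biconn X1 \<and> biconn X2 \<and> X1 \<inter> X2 = {} \<and> X1 \<union> X2 = B"
  have "?parts \<or> bow W y f B \<or> kite W y f B"
  proof (cases "\<forall>v\<in>F2. card F2 + 1 \<le> dg W v")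
    case True
    show ?thesis
    proof (rule near_complete_sides[OF s fin t])
      show "card F2 + 1 \<le> dg W v" if "v \<in> F2" for v using True that by simp
      show "card F1 \<le> dg W v" if "v \<in> F1" for v using sum[OF that u(2)] up(2)[OF that u(2)] by simp
      show "3 \<le> dg W v" if "v \<in> F1 \<union> F2" for v using dF[OF that] I(3) by simp
    qed
  next
    case False
    \<comment> \<open>A vertex of \<open>F2\<close> that misses something uses up the whole deficit
      of one, so now \<open>F1\<close> is the complete side.\<close>
    then obtain w where w: "w \<in> F2" "dg W w \<le> card F2" by auto
    show ?thesis
    proof (rule near_complete_sides[OF s fin sep_sym[OF t]])
      show "card F1 + 1 \<le> dg W v" if "v \<in> F1" for v using sum[OF that w(1)] w(2) by simp
      show "card F2 \<le> dg W v" if "v \<in> F2" for v using sum[OF u(1) that] up(1)[OF u(1) that] by simp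
      show "3 \<le> dg W v" if "v \<in> F2 \<union> F1" for v using dF[of v] that I(3) by auto
    qed
  qed
  moreover have "partitionable W {}" if parts: ?parts
  proof -
    obtain X1 X2 where X: "biconn X1" "biconn X2" "X1 \<inter> X2 = {}" "X1 \<union> X2 = B" using parts by blast
    have "two_proper_partition (X1 \<union> X2) E {X2, X1}" using two_proper_insert[OF two_proper_single[OF X(1)] X(2,3)] .
    then have B: "two_proper_partition B E {X2, X1}" using X(4) by simp
    have "two_proper_partition (B \<union> insert y A) E {insert y A, X2, X1}"
      by (rule two_proper_insert[OF B yA]) (use S(3,4) in auto)
    moreover have "B \<union> insert y A = W - {}" using S(1) by auto
    ultimately have p: "two_proper_partition (W - {}) E {insert y A, X2, X1}" by simp
    have I': "I \<subseteq> A - {}" using IA by simp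
    have u': "u1 \<in> F1 - {}" "u2 \<in> F2 - {}" using u by auto
    note SL = slack[OF s fin empty_subsetI h t u' I' l]
    have "card {insert y A, X2, X1} \<le> 3" by (simp add: card_insert_if)
    also have "\<dots> \<le> card (insert u1 I)" using SL(3) fI I(2,3) by simp
    finally show ?thesis by (rule partitionableI[OF subset_refl p SL(2,1)])
  qed
  moreover have "k = 2" if ex: "\<exists>w\<in>B - {f}. dg W w \<le> 3"
  proof -
    obtain w where w: "w \<in> B" "w \<noteq> f" "dg W w \<le> 3" using ex by auto
    then have "w \<in> F1 \<union> F2" using T(1) by auto
    from dF[OF this] w(3) I(3) show ?thesis by simp
  qed
  moreover have "\<exists>w\<in>B - {f}. dg W w \<le> 3" if bk: "bow W y f B \<or> kite W y f B"
  proof -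
    have "\<exists>p x. p \<in> B \<and> p \<noteq> f \<and> nb W p = {y, f, x}"
      using bk
    proof
      assume "bow W y f B"
      then obtain p q where "p \<in> B" "f \<noteq> p" "nb W p = {y, f, q}" by (rule bow_E) auto
      then show ?thesis by (intro exI[of _ p] exI[of _ q]) simp
    next
      assume "kite W y f B"
      then obtain p q where "p \<in> B" "f \<noteq> p" "nb W p = {y, f, q}" by (rule kite_E) auto
      then show ?thesis by (intro exI[of _ p] exI[of _ q]) simp
    qed
    then obtain p x where "p \<in> B" "p \<noteq> f" "nb W p = {y, f, x}" by blast
    then show ?thesis
      by (intro bexI[of _ p]) (auto simp: dg_def card_insert_if)
  qed
  ultimately show ?thesis by blast
qed

lemma bow_biconn:
  assumes F: "distinct [g, p, q, r, s]" "A = {g, p, q, r, s}"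
    "nb A p = {g, q}" "nb A q = {g, p}" "nb A r = {g, s}" "nb A s = {g, r}"
    and y: "{y, p} \<in> E" "{y, q} \<in> E" "{r, y} \<in> E" "{s, y} \<in> E" "y \<notin> A"
  shows "biconn (insert y A)"
proof -
  have e: "{p, q} \<in> E" "{g, p} \<in> E" "{g, q} \<in> E" "{r, g} \<in> E" "{s, g} \<in> E"
    using nb_edge[of q A p] nb_edge[of g A p] nb_edge[of g A q] nb_edge[of g A r] nb_edge[of g A s] F by auto
  have "biconn {y, p, q}" by (rule biconn_triangle) (use e y F in auto)
  then have "biconn (insert g {y, p, q})" by (rule biconn_insert[of _ _ p q]) (use e y F in auto)
  then have "biconn (insert g {y, p, q} \<union> {r, s})"
    by (rule biconn_grow[rotated]) (use e y F in auto)
  moreover have "insert g {y, p, q} \<union> {r, s} = insert y A" using F(2) by auto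
  ultimately show ?thesis by simp
qed

lemma exF5_E:
  assumes "exF5 W"
  obtains g p q r s where "distinct [g, p, q, r, s]" "W = {g, p, q, r, s}"
    "nb W p = {g, q}" "nb W q = {g, p}" "nb W r = {g, s}" "nb W s = {g, r}"
  using assms unfolding exF5_def by (elim exE conjE) (rule that; assumption)

text \<open>For \<open>k = 2\<close> and order 5 the inequalities of \<open>anchor_case\<close> read
  4 < 5 and 6 = 5 + 1, so the case just fits. The two disjoint tight pairs force \<open>y\<close> to
  see all four outer vertices of \<open>A\<close>. A bow tie on the other side then gives F11 and a
  kite gives F12.\<close>

lemma side_exF5:
  assumes s: "sep W y A B" and fin: "finite W" and h: "degree_cond W {}" and t: "sep B f F1 F2" and e: "exF5 A"
  shows "partitionable W {} \<or> exF11 W \<or> exF12 W"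
proof -
  note S = sep_facts[OF s] and T = sep_facts[OF t]
  obtain g p q r s' where F: "distinct [g, p, q, r, s']" "A = {g, p, q, r, s'}"
      "nb A p = {g, q}" "nb A q = {g, p}" "nb A r = {g, s'}" "nb A s' = {g, r}"
    using e by (rule exF5_E) (rule that; assumption)
  note L = exF5_facts[OF F]
  have two: "card {p, r} = 2" "card {q, s'} = 2" using F(1) by auto
  obtain u1 u2 where u: "u1 \<in> F1 - {}" "u2 \<in> F2 - {}" using T(5,6) by auto
  have crit: "3 \<le> dg W x" if "light_in A I" "card I = 2" "x \<in> I" for I x
    using slack_degree_cond(2)[OF s fin empty_subsetI h t u, of I x] that by (simp add: light_in_def indep_def)
  have adj: "{x, y} \<in> E \<and> {y, x} \<in> E \<and> nb W x = insert y (nb A x)" if "x \<in> {p, q, r, s'}" for x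
  proof -
    have "x \<in> A" "dg A x \<le> card {p, r}" using that F(2) L two by auto
    moreover have "card {p, r} + 1 \<le> dg W x"
      using that crit[OF L(1) two(1)] crit[OF L(2) two(2)] two by auto
    ultimately show ?thesis using critical_adj[OF s fin, of x "{p, r}"] by blast
  qed
  have N: "nb W p = {y, g, q}" "nb W q = {y, g, p}" "nb W r = {y, g, s'}" "nb W s' = {y, g, r}"
    using adj F(3-6) by auto
  have yA: "biconn (insert y A)"
    by (rule bow_biconn[OF F]) (use adj S(2) in auto)
  have "partitionable W {} \<or> (2 = (2::nat) \<and> (bow W y f B \<or> kite W y f B))"
  proof (rule anchor_case[OF s fin h t _ two(1) _ _ _ _ yA])
    show "indep A E {p, r}" using L(1) by (simp add: light_in_def)
    show "dg A v = 2" if "v \<in> {p, r}" for v using that L by auto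
  qed (use L in simp_all)
  moreover have gf: "x \<notin> nb W g" if "x \<in> B" for x
    using S(7)[of g x] that F(2) by (auto simp: nb_def)
  moreover have "exF11 W" if "bow W y f B"
    using that
  proof (rule bow_E)
    fix p' q' r' s'' assume B: "distinct [f, p', q', r', s'']" "B = {f, p', q', r', s''}"
      "nb W p' = {y, f, q'}" "nb W q' = {y, f, p'}" "nb W r' = {y, f, s''}" "nb W s'' = {y, f, r'}"
    have "distinct ([y] @ [g, p, q, r, s'] @ [f, p', q', r', s''])"
      using F(1) B(1) S(2-4) unfolding distinct_append F(2) B(2) by auto
    moreover have W: "W = {y, g, p, q, r, s', f, p', q', r', s''}"
      unfolding S(1) F(2) B(2) by auto
    ultimately have "tripod W y g p q r s' f p' q' r' s''"
      using N B unfolding tripod_def by simp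
    then show ?thesis unfolding exF11_def using W B(5,6) gf[of f] B(2) by blast
  qed
  moreover have "exF12 W" if "kite W y f B"
    using that
  proof (rule kite_E)
    fix p' q' u v z assume B: "distinct [f, p', q', u, v, z]" "B = {f, p', q', u, v, z}"
      "nb W p' = {y, f, q'}" "nb W q' = {y, f, p'}" "nb W u = {y, f, z}" "nb W v = {y, f, z}"
      "y \<in> nb W z \<or> f \<in> nb W z"
    have D: "distinct ([y] @ [g, p, q, r, s'] @ [f, p', q', u, v, z])"
      using F(1) B(1) S(2-4) unfolding distinct_append F(2) B(2) by auto
    moreover have W: "W = {y, g, p, q, r, s', f, p', q', u, v, z}"
      unfolding S(1) F(2) B(2) by auto
    ultimately have "tripod W y g p q r s' f p' q' u v"
      using N B unfolding tripod_def by simp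
    moreover have "z \<notin> {y, g, p, q, r, s', f, p', q', u, v}" using D by auto
    ultimately show ?thesis unfolding exF12_def using W B(5-7) gf[of f] gf[of z] B(2) by blast
  qed
  ultimately show ?thesis by blast
qed

text \<open>Now \<open>k = 3\<close>, with 9 < 11 and 12 = 11 + 1 at the smallest order, and
  \<open>k = 3\<close> excludes \<open>bow\<close> and \<open>kite\<close>. Four tight triples cover
  \<open>p\<close>, \<open>q\<close>, \<open>r\<close>, \<open>s'\<close>, \<open>c\<close>,
  \<open>d\<close>, \<open>u\<close>, \<open>v\<close>, so all eight are common neighbours of
  \<open>y\<close> and \<open>y0\<close>. They form the 2-connected core of
  \<open>insert y A\<close>, to which \<open>rest\<close> attaches the remaining vertices.\<close>

lemma side_tripod:
  assumes s: "sep W y A B" and fin: "finite W" and h: "degree_cond W {}" and t: "sep B f F1 F2"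
    and tr: "tripod A y0 g p q r s' h' c d u v" and uv: "y0 \<in> nb A u" "y0 \<in> nb A v" "dg A u = 3" "dg A v = 3"
    and rest: "\<And>x. x \<in> A - {y0, p, q, r, s', c, d, u, v} \<Longrightarrow>
      \<exists>a\<in>{y0, p, q, r, s', c, d, u, v}. \<exists>b\<in>{y0, p, q, r, s', c, d, u, v}. a \<noteq> b \<and> {x, a} \<in> E \<and> {x, b} \<in> E"
  shows "partitionable W {}"
proof -
  note S = sep_facts[OF s] and T = sep_facts[OF t]
  have fA: "finite A" using sep_finite[OF s fin] by simp
  note L = tripod_light_in[OF tr fA]
  have D: "distinct [y0, g, p, q, r, s', h', c, d, u, v]" and sub: "{y0, g, p, q, r, s', h', c, d, u, v} \<subseteq> A"
    and N: "nb A p = {y0, g, q}" "nb A q = {y0, g, p}" "nb A r = {y0, g, s'}" "nb A s' = {y0, g, r}"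
      "nb A c = {y0, h', d}" "nb A d = {y0, h', c}"
    using tr by (auto simp: tripod_def)
  have Luv: "light_in A {p, r, u}" "light_in A {p, r, v}"
    by (rule light_in_triple; use D sub N L uv in auto)+
  have three: "card {p, r, c} = 3" "card {q, s', d} = 3" "card {p, r, u} = 3" "card {p, r, v} = 3"
    using D by auto
  obtain u1 u2 where u: "u1 \<in> F1 - {}" "u2 \<in> F2 - {}" using T(5,6) by auto
  have crit: "4 \<le> dg W x" if "light_in A I" "card I = 3" "x \<in> I" for I x
    using slack_degree_cond(2)[OF s fin empty_subsetI h t u, of I x] that by (simp add: light_in_def indep_def)
  have adj: "{x, y} \<in> E \<and> {y, x} \<in> E" if "x \<in> {p, q, r, s', c, d, u, v}" for x
  proof -
    have "x \<in> A" "dg A x \<le> card {p, r, c}" using that sub L uv three by auto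
    moreover have "card {p, r, c} + 1 \<le> dg W x"
      using that crit[OF L(1) three(1)] crit[OF L(2) three(2)] crit[OF Luv(1) three(3)] crit[OF Luv(2) three(4)]
        three(1) by auto
    ultimately show ?thesis using critical_adj[OF s fin, of x "{p, r, c}"] by blast
  qed
  have e: "{x, y0} \<in> E" if "x \<in> {p, q, r, s', c, d, u, v}" for x
    using that N uv by (auto intro: nb_edge(1)[of _ A])
  have "{p, q} \<in> E" by (rule nb_edge(1)[of _ A]) (simp add: N)
  then have "biconn {p, q, y0}"
    by (intro biconn_triangle) (use e D in auto)
  then have "biconn (insert y {p, q, y0})"
    by (rule biconn_insert[of _ _ p q]) (use adj S(2) sub D in auto)
  then have "biconn (insert y {p, q, y0} \<union> {r, s', c, d, u, v})"
    by (rule biconn_grow[rotated]) (use adj e S(2) sub in auto)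
  then have "biconn ((insert y {p, q, y0} \<union> {r, s', c, d, u, v}) \<union> (A - {y0, p, q, r, s', c, d, u, v}))"
  proof (rule biconn_grow[rotated])
    fix x assume "x \<in> A - {y0, p, q, r, s', c, d, u, v}"
    from rest[OF this] show "\<exists>a\<in>insert y {p, q, y0} \<union> {r, s', c, d, u, v}. \<exists>b\<in>insert y {p, q, y0} \<union> {r, s', c, d, u, v}.
        a \<noteq> b \<and> {x, a} \<in> E \<and> {x, b} \<in> E"
      by blast
  qed (use fA in simp)
  moreover have "(insert y {p, q, y0} \<union> {r, s', c, d, u, v}) \<union> (A - {y0, p, q, r, s', c, d, u, v}) = insert y A"
    using sub by auto
  ultimately have yA: "biconn (insert y A)" by simp
  have "partitionable W {} \<or> (3 = (2::nat) \<and> (bow W y f B \<or> kite W y f B))"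
  proof (rule anchor_case[OF s fin h t _ three(1) _ _ _ _ yA])
    show "indep A E {p, r, c}" using L(1) by (simp add: light_in_def)
    show "dg A v = 3" if "v \<in> {p, r, c}" for v using that L by auto
  qed (use L in simp_all)
  then show ?thesis by simp
qed

lemma side_exF11:
  assumes s: "sep W y A B" and fin: "finite W" and h: "degree_cond W {}" and t: "sep B f F1 F2" and e: "exF11 A"
  shows "partitionable W {}"
proof -
  obtain y0 g p q r s' h' c d u v where tr: "tripod A y0 g p q r s' h' c d u v"
    and A: "A = {y0, g, p, q, r, s', h', c, d, u, v}" and uv: "nb A u = {y0, h', v}" "nb A v = {y0, h', u}"
    using e unfolding exF11_def by (elim exE conjE) (rule that; assumption)
  have D: "distinct [y0, g, p, q, r, s', h', c, d, u, v]"
    and N: "g \<in> nb A p" "g \<in> nb A q" "h' \<in> nb A c" "h' \<in> nb A d" using tr by (auto simp: tripod_def)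
  show ?thesis
  proof (rule side_tripod[OF s fin h t tr])
    show "dg A u = 3" "dg A v = 3" using D by (simp_all add: dg_def uv)
    fix x assume "x \<in> A - {y0, p, q, r, s', c, d, u, v}"
    then have "x = g \<or> x = h'" unfolding A by auto
    then show "\<exists>a\<in>{y0, p, q, r, s', c, d, u, v}. \<exists>b\<in>{y0, p, q, r, s', c, d, u, v}. a \<noteq> b \<and> {x, a} \<in> E \<and> {x, b} \<in> E"
    proof
      assume "x = g"
      then show ?thesis using nb_edge(2)[OF N(1)] nb_edge(2)[OF N(2)] D
        by (intro bexI[of _ p] bexI[of _ q]) auto
    next
      assume "x = h'"
      then show ?thesis using nb_edge(2)[OF N(3)] nb_edge(2)[OF N(4)] D
        by (intro bexI[of _ c] bexI[of _ d]) auto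
    qed
  qed (simp_all add: uv)
qed

lemma side_exF12:
  assumes s: "sep W y A B" and fin: "finite W" and h: "degree_cond W {}" and t: "sep B f F1 F2" and e: "exF12 A"
  shows "partitionable W {}"
proof -
  obtain y0 g p q r s' h' c d u v z where tr: "tripod A y0 g p q r s' h' c d u v"
    and A: "A = {y0, g, p, q, r, s', h', c, d, u, v, z}" and z: "z \<notin> {y0, g, p, q, r, s', h', c, d, u, v}"
    and uv: "nb A u = {y0, h', z}" "nb A v = {y0, h', z}"
    using e unfolding exF12_def by (elim exE conjE) (rule that; assumption)
  have D: "distinct [y0, g, p, q, r, s', h', c, d, u, v]"
    and N: "g \<in> nb A p" "g \<in> nb A q" "h' \<in> nb A c" "h' \<in> nb A d" using tr by (auto simp: tripod_def)
  have Nz: "z \<in> nb A u" "z \<in> nb A v" using uv by auto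
  show ?thesis
  proof (rule side_tripod[OF s fin h t tr])
    show "dg A u = 3" "dg A v = 3" using D z by (auto simp add: dg_def uv)
    fix x assume "x \<in> A - {y0, p, q, r, s', c, d, u, v}"
    then have "x = g \<or> x = h' \<or> x = z" unfolding A by auto
    then show "\<exists>a\<in>{y0, p, q, r, s', c, d, u, v}. \<exists>b\<in>{y0, p, q, r, s', c, d, u, v}. a \<noteq> b \<and> {x, a} \<in> E \<and> {x, b} \<in> E"
    proof (elim disjE)
      assume "x = g"
      then show ?thesis using nb_edge(2)[OF N(1)] nb_edge(2)[OF N(2)] D
        by (intro bexI[of _ p] bexI[of _ q]) auto
    next
      assume "x = h'"
      then show ?thesis using nb_edge(2)[OF N(3)] nb_edge(2)[OF N(4)] D
        by (intro bexI[of _ c] bexI[of _ d]) auto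
    next
      assume "x = z"
      then show ?thesis using nb_edge(2)[OF Nz(1)] nb_edge(2)[OF Nz(2)] D
        by (intro bexI[of _ u] bexI[of _ v]) auto
    qed
  qed (simp_all add: uv)
qed

text \<open>Every vertex of \<open>A\<close> has degree at least 2, so \<open>A\<close> and
  \<open>y\<close> form a triangle. \<open>triangle_side\<close> applies with the two sides
  exchanged.\<close>

lemma side_exK2:
  assumes s: "sep W y A B" and fin: "finite W" and h: "degree_cond W {}" and e: "exK2 A"
  shows "partitionable W {} \<or> exF5 W \<or> exH W"
proof -
  note S = sep_facts[OF s]
  obtain v w where A: "A = {v, w}" "v \<noteq> w" "{v, w} \<in> E" using e by (auto simp: exK2_def)
  obtain b where b: "b \<in> B" using S(6) by auto
  have d: "2 \<le> dg W x" if "x \<in> A" for x using side_free_dg[OF sep_sym[OF s] fin h, of b x] b that by simp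
  have "{y, x} \<in> E" if x: "x \<in> A" "x' \<in> A" "A = {x, x'}" for x x'
  proof (rule ccontr)
    assume "{y, x} \<notin> E"
    then have "y \<notin> nb W x" using nb_edge(2) by blast
    then have "nb W x \<subseteq> {x'}"
      using sep_nb(1)[OF s x(1)] nb_subset[of A x] self_notin_nb[of x A] x(3) by blast
    then have "dg W x \<le> card {x'}" by (rule dg_le) simp
    then show False using d[OF x(1)] by simp
  qed
  from this[of v w] this[of w v] have "{y, v} \<in> E" "{y, w} \<in> E" using A(1) by auto
  then show ?thesis by (rule triangle_side[OF sep_sym[OF s] fin h A])
qed

text \<open>The weight bound for \<open>c\<close>, a clique vertex and one vertex from each side of
  \<open>f\<close> reduces \<open>A\<close> to order 6 and makes the inequalities tight. The other
  side turns out to be a bow tie with centre \<open>f\<close>. In the resulting member of F12,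
  \<open>f\<close> plays b_1, \<open>a\<close> plays b_2 and \<open>b\<close> plays c_9.\<close>

lemma side_exH:
  assumes s: "sep W y A B" and fin: "finite W" and h: "degree_cond W {}" and t: "sep B f F1 F2" and e: "exH A"
  shows "exF12 W"
proof -
  note S = sep_facts[OF s] and T = sep_facts[OF t]
  have fA: "finite A" and fB: "finite B" using sep_finite[OF s fin] by auto
  have fF: "finite F1" "finite F2" using sep_finite[OF t fB] by auto
  obtain a b c d P Q where H: "distinct [a, b, c, d]" "{a, b, c, d} \<inter> (P \<union> Q) = {}" "P \<inter> Q = {}"
    "P \<noteq> {}" "Q \<noteq> {}" "A = {a, b, c, d} \<union> (P \<union> Q)" "nb A c = {a, d}" "nb A d = {a, c}"
    "\<forall>x\<in>P. nb A x = insert a (insert b (P - {x}))"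
    "\<forall>x\<in>Q. nb A x = insert a (insert b (Q - {x}))" "card P \<le> card Q"
    using e by (rule exH_E) (rule that; assumption)
  have AQ: "A = {a, b, c, d} \<union> (Q \<union> P)" and Ad: "A = {a, b, d, c} \<union> (P \<union> Q)" using H(6) by auto
  have HQ: "{a, b, c, d} \<inter> (Q \<union> P) = {}" "Q \<inter> P = {}" and Hd: "distinct [a, b, d, c]" "{a, b, d, c} \<inter> (P \<union> Q) = {}"
    using H(1-3) by auto
  note LP = exH_facts[OF H(1-7) fA H(9)]
  note LQ = exH_facts[OF H(1) HQ H(5,4) AQ H(7) fA H(10)]
  note Ld = exH_facts[OF Hd H(3-5) Ad H(8) fA H(9)]
  obtain v w where vw: "v \<in> P" "w \<in> Q" using H(4,5) by auto
  obtain u1 u2 where u: "u1 \<in> F1 - {}" "u2 \<in> F2 - {}" using T(5,6) by auto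
  have crit: "card I + 1 \<le> dg W x" if "light_in A I" "x \<in> I" for I x
    using slack_degree_cond(2)[OF s fin empty_subsetI h t u, of I x] that by (simp add: light_in_def indep_def)
  have cv: "c \<noteq> v" "d \<noteq> v" "c \<noteq> w" "v \<noteq> w" using H(2,3) vw by auto
  have inA: "a \<in> A" "b \<in> A" "c \<in> A" "d \<in> A" "v \<in> A" "w \<in> A" using H(6) vw by auto
  have ynot: "y \<noteq> a" "y \<noteq> b" "y \<noteq> c" "y \<noteq> d" "y \<noteq> v" "y \<noteq> w" using inA S(2) by auto
  have Nc: "nb W c = {y, a, d}"
    using critical_adj(3)[OF s fin inA(3), of "{c, v}"] crit[OF LP(4)[OF vw(1)], of c] cv LP(3) H(7) by simp
  have Nd: "nb W d = {y, a, c}"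
    using critical_adj(3)[OF s fin inA(4), of "{d, v}"] crit[OF Ld(4)[OF vw(1)], of d] cv Ld(3) H(8) by simp
  have dc: "dg W c = 3" using H(1) ynot by (simp add: dg_def Nc)
  have cB: "card B = card F1 + card F2 + 1" by (rule sep_card[OF t fB])
  have up1: "dg W x \<le> card F1 + 1" if "x \<in> F1" for x by (rule sep_sep_dg(2)[OF s fin t that])
  have up2: "dg W x \<le> card F2 + 1" if "x \<in> F2" for x by (rule sep_sep_dg(2)[OF s fin sep_sym[OF t] that])
  have sum: "card A + card B + 1 \<le> 3 + dg W x + dg W x1 + dg W x2"
    if "indep A E {c, x}" "c \<noteq> x" "x1 \<in> F1" "x2 \<in> F2" for x x1 x2
    using heavy_sides[OF s fin h t that(1) _ _ that(3,4), of c] that(2) dc by (simp add: wt_def)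
  have iP: "indep A E {c, v}" "indep A E {c, w}" using LP(4)[OF vw(1)] LQ(4)[OF vw(2)] by (auto simp: light_in_def)
  have dv: "dg W v \<le> card P + 2" using sep_dg(1)[OF s fin inA(5)] LP(2)[OF vw(1)] by simp
  have dw: "dg W w \<le> card Q + 2" using sep_dg(1)[OF s fin inA(6)] LQ(2)[OF vw(2)] by simp
  \<comment> \<open>The bound for \<open>c\<close>, \<open>v\<close>, \<open>u1\<close>,
    \<open>u2\<close> compares \<open>card P + card Q + card F1 + card F2 + 6\<close> with at most
    \<open>3 + (card P + 2) + (card F1 + 1) + (card F2 + 1)\<close>. This leaves
    \<open>card Q \<le> 1\<close>.\<close>
  have cP0: "card P > 0" "card Q > 0" using H(4-6) fA by (auto simp: card_gt_0_iff)
  have Q1: "card Q = 1"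
    using sum[OF iP(1) cv(1), of u1 u2] u up1[of u1] up2[of u2] dv LP(1) cB cP0 by simp
  then have P1: "card P = 1" using H(11) cP0 by simp
  have cA: "card A = 6" using LP(1) P1 Q1 by simp
  have P: "P = {v}" "Q = {w}" using P1 Q1 vw by (auto simp: card_1_singleton_iff)
  have d3: "dg W v = 3" "dg W w = 3"
    using sum[OF iP(1) cv(1), of u1 u2] sum[OF iP(2) cv(3), of u1 u2] u up1[of u1] up2[of u2] dv dw cA cB P1 Q1
    by auto
  have d1: "dg W x = card F1 + 1" if "x \<in> F1" for x
    using sum[OF iP(1) cv(1) that, of u2] u up1[OF that] up2[of u2] d3 cA cB by simp
  have d2: "dg W x = card F2 + 1" if "x \<in> F2" for x
    using sum[OF iP(1) cv(1) _ that, of u1] u up2[OF that] up1[of u1] d3 cA cB by simp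
  have NAvw: "nb A v = {a, b}" "nb A w = {a, b}" using bspec[OF H(9) vw(1)] bspec[OF H(10) vw(2)] P by simp_all
  have "dg A v = 2" "dg A w = 2" using LP(2)[OF vw(1)] LQ(2)[OF vw(2)] P1 Q1 by auto
  then have Nv: "nb W v = {y, a, b}" and Nw: "nb W w = {y, a, b}"
    using critical_adj(3)[OF s fin inA(5), of "{c, v}"] critical_adj(3)[OF s fin inA(6), of "{c, v}"] d3 cv NAvw
    by simp_all
  have "indep A E {c, v, w}"
  proof (rule indep_nb)
    show "{c, v, w} \<subseteq> A" using inA by simp
    have "{a, b, d} \<inter> {c, v, w} = {}" using H(1,2) P by auto
    moreover have "nb A x \<subseteq> {a, b, d}" if "x \<in> {c, v, w}" for x using that H(7) NAvw by auto
    ultimately show "nb A x \<inter> {c, v, w} = {}" if "x \<in> {c, v, w}" for x using that by fast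
  qed
  moreover have "card {c, v, w} = 3" "wt W {c, v, w} = 9" using cv dc d3 by (auto simp: wt_def)
  \<comment> \<open>Four independent vertices, three of them of degree 3, form a large set. With
    \<open>card A = 6\<close> this says that a vertex of \<open>F1\<close> or \<open>F2\<close> sees
    all but two vertices of \<open>B\<close> by count, so each of the sides has at most two
    vertices.\<close>
  ultimately have s4: "card A + card B + 1 \<le> 9 + dg W x" if "x \<in> B" for x
    using heavy_side[OF s fin h, of "{c, v, w}" c x] that dc by simp
  have "card F2 \<le> 2" "card F1 \<le> 2"
    using s4[of u1] s4[of u2] u T(1) d1[of u1] d2[of u2] cA cB by auto
  moreover have "2 \<le> card F1" "2 \<le> card F2"
  proof -
    have I: "{c, v} \<subseteq> A - {}" using inA by simp
    show "2 \<le> card F1" using slack(4)[OF s fin empty_subsetI h t u I LP(4)[OF vw(1)]] cv d1[of u1] u by simp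
    show "2 \<le> card F2"
      using slack(4)[OF s fin empty_subsetI h sep_sym[OF t] u(2,1) I LP(4)[OF vw(1)]] cv d2[of u2] u by simp
  qed
  ultimately have c2: "card F1 = 2" "card F2 = 2" by auto
  obtain p q where F1: "F1 = {p, q}" "p \<noteq> q" using c2(1) by (meson card_2_iff)
  obtain r s' where F2: "F2 = {r, s'}" "r \<noteq> s'" using c2(2) by (meson card_2_iff)
  have yf: "y \<noteq> f" "y \<notin> F1" "y \<notin> F2" using S(3) T(1) by auto
  have full: "nb W x = insert y (insert f (F - {x}))"
    if x: "x \<in> F" and F: "F = F1 \<or> F = F2" for x F
  proof (rule nb_full)
    have fF': "finite F" "y \<notin> F" "f \<notin> F" "card F = 2" using F fF yf T(2,3) c2 by auto
    show "nb W x \<subseteq> insert y (insert f (F - {x}))"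
      using F x sep_sep_dg(1)[OF s fin t] sep_sep_dg(1)[OF s fin sep_sym[OF t]] by auto
    show "finite (insert y (insert f (F - {x})))" using fF' by simp
    have "dg W x = 3" using F x d1 d2 c2 by auto
    then show "card (insert y (insert f (F - {x}))) \<le> dg W x"
      using fF' yf card_Suc_Diff1[OF fF'(1) x] by simp
  qed
  have NB: "nb W p = {y, f, q}" "nb W q = {y, f, p}" "nb W r = {y, f, s'}" "nb W s' = {y, f, r}"
    using full[of p F1] full[of q F1] full[of r F2] full[of s' F2] F1 F2 by auto
  have D: "distinct ([y] @ [f, p, q, r, s'] @ [a, c, d, v, w, b])"
  proof -
    have "distinct [f, p, q, r, s']" using F1 F2 T(2-4) by auto
    moreover have "distinct [a, c, d, v, w, b]" using H(1,2) P cv by auto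
    moreover have "B = {f, p, q, r, s'}" "A = {a, c, d, v, w, b}" using T(1) F1 F2 H(6) P by auto
    ultimately show ?thesis using S(2-4) unfolding distinct_append by auto
  qed
  have W: "W = {y, f, p, q, r, s', a, c, d, v, w, b}"
    using S(1) T(1) F1(1) F2(1) H(6) P by auto
  have tr: "tripod W y f p q r s' a c d v w"
    unfolding tripod_def using D NB Nc Nd W by auto
  have noAB: "x \<notin> nb W f" if "x \<in> A" for x
    using S(8)[OF that, of f] T(1) by (auto simp: nb_def)
  have "y \<in> nb W b \<or> a \<in> nb W b"
  \<comment> \<open>Without these edges \<open>b\<close> has degree at most 2, and \<open>c\<close>,
    \<open>b\<close>, \<open>u1\<close>, \<open>u2\<close> are a large independent set of weight at
    most 3 + 2 + 3 + 3 = 11, while the order is 12.\<close>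
  proof (rule ccontr)
    assume n: "\<not> ?thesis"
    have "c \<notin> nb W b" "d \<notin> nb W b"
    proof -
      have "b \<notin> nb W c" "b \<notin> nb W d" using Nc Nd H(1) ynot by auto
      then show "c \<notin> nb W b" "d \<notin> nb W b" using nb_sym[of _ W b W] W by auto
    qed
    moreover have "nb W b \<subseteq> insert y A" using sep_nb(1)[OF s inA(2)] nb_subset[of A b] by auto
    moreover have "A = {a, b, c, d, v, w}" unfolding H(6) P by auto
    moreover have "y \<notin> nb W b" "a \<notin> nb W b" "b \<notin> nb W b" using n by simp_all
    ultimately have "nb W b \<subseteq> {v, w}" by blast
    then have "dg W b \<le> card {v, w}" by (rule dg_le) simp
    then have db: "dg W b \<le> 2" using cv by simp
    have cb: "c \<noteq> b" using H(1) by auto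
    have "{b, c} \<notin> E" using \<open>c \<notin> nb W b\<close> W by (simp add: nb_def)
    then have "indep A E {c, b}" using inA no_loop[of c] no_loop[of b] by (auto simp: indep_def insert_commute)
    then show False
      using sum[of b u1 u2] cb u d1[of u1] d2[of u2] c2 cA cB db by simp
  qed
  moreover have "b \<notin> {y, f, p, q, r, s', a, c, d, v, w}" using D by auto
  ultimately show ?thesis
    unfolding exF12_def using tr W Nv Nw noAB[OF inA(1)] noAB[OF inA(2)] by blast
qed

subsection \<open>The induction\<close>

text \<open>A tight set of \<open>P\<close> stays light after adding an unmarked vertex of
  \<open>Q\<close>; if \<open>Q\<close> has none, there are marks. Either way the degree condition
  asks for more than the tight vertex has.\<close>

lemma split_not_exceptional_type:
  assumes s: "split W P Q" and fin: "finite W" and Y: "Y \<subseteq> W" and h: "degree_cond W Y" and P: "Y \<inter> P = {}"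
  shows "\<not> exceptional_type P"
proof
  assume e: "exceptional_type P"
  have fPQ: "finite P" "finite Q" using split_facts(1)[OF s] fin by auto
  obtain I v where I: "light_in P I" "v \<in> I" "dg P v \<le> card I" using exceptional_type_critical[OF fPQ(1) e] by blast
  have IP: "I \<subseteq> P" using I(1) by (simp add: light_in_def indep_def)
  have v: "dg W v \<le> card I" using I IP split_nb[OF s, of v] by (auto simp: dg_def)
  have fI: "finite I" using IP fPQ finite_subset by blast
  obtain J where J: "light_in Q J" "J \<subseteq> Q - Y" "J \<noteq> {} \<or> Y \<noteq> {}"
  proof (cases "Q \<subseteq> Y")
    case True
    then have "Y \<noteq> {}" using split_facts(4)[OF s] by auto
    then show ?thesis using that[of "{}"] light_in_empty[OF fPQ(2) split_facts(4)[OF s]] by simp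
  next
    case False
    then obtain q where "q \<in> Q - Y" by auto
    then show ?thesis using that[of "{q}"] light_in_single[OF fPQ(2)] by simp
  qed
  have "I \<union> J \<subseteq> W - Y" using IP P J(2) split_facts(1)[OF s] by auto
  then have "card (I \<union> J) + card Y \<le> dg W v"
    using degree_condD[OF h _ split_light_in[OF s fin I(1) J(1)], of v] I(2) by simp
  moreover have "I \<inter> J = {}" "finite J"
    using IP J(2) split_facts(2)[OF s] finite_subset[of J Q] fPQ by auto
  then have "card (I \<union> J) = card I + card J" using fI by (simp add: card_Un_disjoint)
  moreover have "card J > 0 \<or> card Y > 0"
    using J(3) \<open>finite J\<close> finite_subset[OF Y fin] by (auto simp: card_gt_0_iff)
  ultimately show False using v by linarith
qed

text \<open>The tight set is chosen to avoid \<open>y\<close>, so its vertices have the same degrees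
  in \<open>W\<close>. The nonempty set of marks in \<open>B\<close> then contradicts
  tightness.\<close>

lemma dissolve_not_exceptional_type:
  assumes s: "sep W y A B" and fin: "finite W" and Y: "Y \<subseteq> W" and B: "B \<subseteq> Y" and h: "degree_cond W Y" and Y0: "Y - B = {}"
  shows "\<not> exceptional_type (insert y A)"
proof
  assume e: "exceptional_type (insert y A)"
  have "finite (insert y A)" using sep_finite[OF s fin] by simp
  then obtain I v where I: "light_in (insert y A) I" "y \<notin> I" "v \<in> I" "dg (insert y A) v \<le> card I"
    using exceptional_type_critical[OF _ e, of y] by blast
  have sub: "I \<subseteq> insert y A" using I(1) by (simp add: light_in_def indep_def)
  have "I \<subseteq> W - Y \<and> light_in W I" by (rule dissolve_degree_cond(2)[OF s fin Y B h]) (use sub Y0 I in auto)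
  then have "card I + card Y \<le> dg W v" using degree_condD[OF h, of I v] I(3) by simp
  moreover have "dg (insert y A) v = dg W v" by (rule sep_dg(4)[OF s fin]) (use sub I in auto)
  moreover have "card Y > 0"
    using B sep_facts(6)[OF s] finite_subset[OF Y fin] by (auto simp: card_gt_0_iff)
  ultimately show False using I(4) by simp
qed

theorem marked_partition:
  assumes "finite W" "W \<noteq> {}" "Y \<subseteq> W" "degree_cond W Y"
  shows "partitionable W Y \<or> (Y = {} \<and> exceptional_type W)"
  using assms
proof (induction "card W" arbitrary: W Y rule: less_induct)
  case less
  note fin = less.prems(1) and Y = less.prems(3) and h = less.prems(4)
  consider (marked) "W \<subseteq> Y" | (split) P Q where "split W P Q"
    | (dissolve) y A B where "sep W y A B" "B \<subseteq> Y"
    | (two) "\<not> W \<subseteq> Y" "\<nexists>P Q. split W P Q" "\<nexists>z P Q. sep W z P Q"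
    | (sep) y A B where "\<nexists>P Q. split W P Q" "\<And>y A B. sep W y A B \<Longrightarrow> \<not> B \<subseteq> Y" "sep W y A B"
    by blast
  then show ?case
  proof cases
    case marked
    then have "W = Y" using Y by simp
    then show ?thesis
      using partitionableI[of W Y W "{}" "{}"] two_proper_empty light_in_empty[OF fin less.prems(2)] by simp
  next
    case split
    note F = split_facts[OF split]
    have fPQ: "finite P" "finite Q" using F(1) fin by auto
    then have "card P < card W" "card Q < card W"
      using split_card[OF split fin] F(3,4) by (auto simp: card_gt_0_iff)
    then have "partitionable P (Y \<inter> P) \<or> (Y \<inter> P = {} \<and> exceptional_type P)" "partitionable Q (Y \<inter> Q) \<or> (Y \<inter> Q = {} \<and> exceptional_type Q)"
      using less.hyps[of P "Y \<inter> P"] less.hyps[of Q "Y \<inter> Q"] fPQ F(3,4)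
        split_degree_cond[OF split fin Y h] split_degree_cond[OF split_sym[OF split] fin Y h] by auto
    then have "partitionable P (Y \<inter> P)" "partitionable Q (Y \<inter> Q)"
      using split_not_exceptional_type[OF split fin Y h] split_not_exceptional_type[OF split_sym[OF split] fin Y h] by auto
    then show ?thesis using split_partitionable[OF split fin Y] by simp
  next
    case dissolve
    note S = sep_facts[OF dissolve(1)]
    have "finite A" "finite B" using sep_finite[OF dissolve(1) fin] by auto
    then have "card (insert y A) < card W"
      using sep_card[OF dissolve(1) fin] S(2,6) by (auto simp: card_gt_0_iff)
    moreover have "Y - B \<subseteq> insert y A" using Y S(1) by auto
    ultimately have "partitionable (insert y A) (Y - B) \<or> (Y - B = {} \<and> exceptional_type (insert y A))"
      using less.hyps[of "insert y A" "Y - B"] \<open>finite A\<close>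
        dissolve_degree_cond(1)[OF dissolve(1) fin Y dissolve(2) h] by simp
    then have "partitionable (insert y A) (Y - B)"
      using dissolve_not_exceptional_type[OF dissolve(1) fin Y dissolve(2) h] by auto
    then show ?thesis using dissolve_partitionable[OF dissolve(1) fin Y dissolve(2) h] by simp
  next
    case two
    then obtain u where "u \<in> W - Y" by auto
    from no_sep_partitionable[OF fin Y h this two(2,3)] show ?thesis by (auto simp: exceptional_type_def exK2_def)
  next
    case sep
    obtain y A B where s: "sep W y A B" and min: "\<And>y' A' B'. sep W y' A' B' \<Longrightarrow> card B \<le> card B'"
    proof -
      let ?sep = "\<lambda>(y, A, B). sep W y A B" and ?size = "\<lambda>(y, A, B). card B"
      have "?sep (y, A, B)" using sep(3) by simp
      from ex_has_least_nat[of ?sep, OF this, of ?size] obtain y A B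
        where "sep W y A B" "\<forall>x. ?sep x \<longrightarrow> card B \<le> ?size x" by auto
      then show ?thesis by (intro that[of y A B]) auto
    qed
    note S = sep_facts[OF s]
    have M: "\<nexists>P Q. split B P Q" "\<nexists>P Q. split (insert y B) P Q" "\<nexists>z P Q. sep (insert y B) z P Q"
      by (rule minimal_side[OF fin sep(1) s], erule min)+
    have fAB: "finite A" "finite B" using sep_finite[OF s fin] by auto
    obtain a b where ab: "a \<in> A - Y" "b \<in> B - Y" using sep(2)[OF s] sep(2)[OF sep_sym[OF s]] by blast
    show ?thesis
    \<comment> \<open>A cut vertex \<open>f\<close> of \<open>B\<close> helps only if both its sides
      contain an unmarked vertex, since marked ones may not enter a light set. Such vertices
      \<open>a\<close>, \<open>b\<close> exist in \<open>A\<close> and \<open>B\<close> because no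
      side of a cut vertex of \<open>W\<close> is completely marked.\<close>
    proof (cases "\<exists>f F1 F2. sep B f F1 F2 \<and> \<not> F1 \<subseteq> Y \<and> \<not> F2 \<subseteq> Y")
      case False
      have "card (insert y A) < card W"
        using sep_card[OF s fin] S(2,6) fAB by (auto simp: card_gt_0_iff)
      moreover have "insert y (Y - B) \<subseteq> insert y A" using Y S(1) by auto
      \<comment> \<open>The new mark \<open>y\<close> makes the set of marks nonempty, which removes
        the exceptional alternative of the induction hypothesis.\<close>
      ultimately have IH: "partitionable (insert y A) (insert y (Y - B))"
        if "degree_cond (insert y A) (insert y (Y - B))"
        using less.hyps[of "insert y A" "insert y (Y - B)"] fAB that by simp
      have good: "P \<subseteq> Y \<or> Q \<subseteq> Y" if "sep B z P Q" for z P Q using False that by blast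
      have "partitionable W Y \<or> (Y = {} \<and> (\<exists>c d. c \<noteq> d \<and> B = {c, d} \<and> {c, d} \<in> E \<and> {y, c} \<in> E \<and> {y, d} \<in> E))"
        by (rule good_side[OF s fin Y h M ab]) (fact good, fact IH)
      then consider "partitionable W Y" | c d where "Y = {}" "c \<noteq> d" "B = {c, d}" "{c, d} \<in> E" "{y, c} \<in> E" "{y, d} \<in> E"
        by blast
      then show ?thesis
      proof cases
        case 2
        have "degree_cond W {}" using h 2(1) by simp
        from triangle_side[OF s fin this 2(3,2,4-6)] show ?thesis using 2(1) by (auto simp: exceptional_type_def)
      qed simp
    next
      case True
      then obtain f F1 F2 u1 u2 where t: "sep B f F1 F2" and u: "u1 \<in> F1 - Y" "u2 \<in> F2 - Y" by blast
      note T = sep_facts[OF t]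
      have "finite F1" "finite F2" using sep_finite[OF t fAB(2)] by auto
      then have "card F1 > 0" "card F2 > 0" using T(5,6) by (auto simp: card_gt_0_iff)
      then have "card (insert y B) > 2" using sep_card[OF t fAB(2)] S(3) fAB by simp
      then have yB: "biconn (insert y B)" using M(2,3) by (rule biconnI)
      have "card A < card W" using sep_card[OF s fin] by simp
      then have "partitionable A (Y \<inter> A) \<or> (Y \<inter> A = {} \<and> exceptional_type A)"
        using less.hyps[of A "Y \<inter> A"] fAB S(5) slack_degree_cond(1)[OF s fin Y h t u] by simp
      then show ?thesis
      proof
        assume "partitionable A (Y \<inter> A)"
        then show ?thesis using slack_partitionable[OF s fin Y h t u yB] by simp
      next
        assume e: "Y \<inter> A = {} \<and> exceptional_type A"
        then obtain I v where I: "light_in A I" "v \<in> I" "dg A v \<le> card I" using exceptional_type_critical[OF fAB(1)] by blast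
        have IA: "I \<subseteq> A" using I(1) by (simp add: light_in_def indep_def)
        then have "card I + 1 + card Y \<le> dg W v"
          using e I slack_degree_cond(2)[OF s fin Y h t u, of I v] by auto
        moreover have "dg W v \<le> dg A v + 1" using sep_dg(1)[OF s fin] IA I(2) by auto
        \<comment> \<open>The tight vertex \<open>v\<close> gains at most the edge to
          \<open>y\<close>, and this already pays for \<open>u1\<close>; nothing is left for
          marks.\<close>
        ultimately have "card Y = 0" using I(3) by linarith
        then have Y0: "Y = {}" using finite_subset[OF Y fin] by simp
        then have h0: "degree_cond W {}" using h by simp
        consider "exK2 A" | "exF5 A" | "exH A" | "exF11 A" | "exF12 A" using e by (auto simp: exceptional_type_def)
        then show ?thesis
          using side_exK2[OF s fin h0] side_exF5[OF s fin h0 t] side_exH[OF s fin h0 t]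
            side_exF11[OF s fin h0 t] side_exF12[OF s fin h0 t] Y0
          by cases (auto simp: exceptional_type_def)
      qed
    qed
  qed
qed

subsection \<open>Isomorphism types\<close>

text \<open>Numbering the vertices reduces an isomorphism to a comparison of index pairs
  \<open>i < j\<close>. The map asked for goes from vertices to indices, so it is the inverse of
  list indexing.\<close>

lemma isomorphic_list:
  assumes xs: "distinct xs" "set xs = W" "length xs = n"
    and irr: "\<And>i. {i} \<notin> E'"
    and e: "\<And>i j. i < j \<Longrightarrow> j < n \<Longrightarrow> {xs ! i, xs ! j} \<in> E \<longleftrightarrow> {i, j} \<in> E'"
  shows "isomorphic W E {0..<n} E'"
proof -
  have b: "bij_betw ((!) xs) {0..<n} W"
    using bij_betw_nth[OF xs(1), of "{0..<n}" W] xs by (auto simp: lessThan_atLeast0)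
  let ?f = "the_inv_into {0..<n} ((!) xs)"
  have inj: "inj_on ((!) xs) {0..<n}" using b by (simp add: bij_betw_def)
  have e': "{xs ! i, xs ! j} \<in> E \<longleftrightarrow> {i, j} \<in> E'" if "i < n" "j < n" for i j
    using e[of i j] e[of j i] that irr[of i] no_loop[of "xs ! i"]
    by (cases i j rule: linorder_cases) (simp_all add: insert_commute)
  show ?thesis
    unfolding isomorphic_def
  proof (intro exI[of _ ?f] conjI ballI)
    show "bij_betw ?f W {0..<n}" by (rule bij_betw_the_inv_into[OF b])
    fix u v assume "u \<in> W" "v \<in> W"
    then obtain i j where ij: "i < n" "j < n" "u = xs ! i" "v = xs ! j"
      using xs(2,3) by (metis in_set_conv_nth)
    then have "?f u = i" "?f v = j" using the_inv_into_f_f[OF inj] by auto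
    then show "{u, v} \<in> E \<longleftrightarrow> {?f u, ?f v} \<in> E'" using e'[OF ij(1,2)] ij by simp
  qed
qed

lemma edge_nb: "u \<in> W \<Longrightarrow> {u, v} \<in> E \<longleftrightarrow> u \<in> nb W v"
  by (simp add: nb_def insert_commute)

lemma exK2_iso: 
  assumes "exK2 W" shows "isomorphic W E (fst K2) (snd K2)"
proof -
  obtain u v where W: "u \<noteq> v" "W = {u, v}" "{u, v} \<in> E" using assms by (auto simp: exK2_def)
  have "isomorphic W E {0..<2} {{0 :: nat, 1}}"
  proof (rule isomorphic_list[of "[u, v]"])
    fix i j :: nat assume "i < j" "j < 2"
    then have "i = 0" "j = 1" by auto
    then show "{[u, v] ! i, [u, v] ! j} \<in> E \<longleftrightarrow> {i, j} \<in> {{0, 1}}" using W by simp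
  qed (use W in auto)
  moreover have "{0..<2} = {0, 1 :: nat}" by auto
  ultimately show ?thesis by (simp add: K2_def)
qed

lemma nth_edge:
  assumes xs: "distinct xs" "set xs = W" and n: "nb W (xs ! j) = (!) xs ` N" "N \<subseteq> {..<length xs}" "i < length xs"
  shows "{xs ! i, xs ! j} \<in> E \<longleftrightarrow> i \<in> N"
proof -
  have "{xs ! i, xs ! j} \<in> E \<longleftrightarrow> xs ! i \<in> (!) xs ` N"
    using edge_nb[of "xs ! i" W "xs ! j"] n nth_mem[OF n(3)] xs(2) by simp
  also have "\<dots> \<longleftrightarrow> i \<in> N"
    using n(2,3) nth_eq_iff_index_eq[OF xs(1) n(3)] by (auto simp: subset_iff)
  finally show ?thesis .
qed

lemma exF5_iso:
  assumes "exF5 W" shows "isomorphic W E (fst F5) (snd F5)"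
proof -
  obtain g p q r s where F: "distinct [g, p, q, r, s]" "W = {g, p, q, r, s}"
    "nb W p = {g, q}" "nb W q = {g, p}" "nb W r = {g, s}" "nb W s = {g, r}"
    using assms by (rule exF5_E) (rule that; assumption)
  define xs where "xs = [g, p, q, r, s]"
  let ?E = "{{0,1},{0,2},{0,3},{0,4},{1,2},{3,4}} :: nat set set"
  have D: "distinct xs" and len: "length xs = 5" and set: "set xs = W" using F by (auto simp: xs_def)
  have C: "{xs ! i, xs ! 1} \<in> E \<longleftrightarrow> i \<in> {0, 2}" "{xs ! i, xs ! 2} \<in> E \<longleftrightarrow> i \<in> {0, 1}"
    "{xs ! i, xs ! 3} \<in> E \<longleftrightarrow> i \<in> {0, 4}" "{xs ! i, xs ! 4} \<in> E \<longleftrightarrow> i \<in> {0, 3}" if "i < 5" for i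
    by (rule nth_edge[OF D set]; use that len in \<open>simp add: xs_def F(3-6)\<close>)+
  have main: "{xs ! i, xs ! j} \<in> E \<longleftrightarrow> {i, j} \<in> ?E" if ij: "i < j" "j < 5" for i j
  proof -
    have i: "i < 5" using ij by simp
    have "j = 1 \<or> j = 2 \<or> j = 3 \<or> j = 4" using ij by arith
    then show ?thesis by (elim disjE) (use ij C[OF i] in \<open>auto simp: doubleton_eq_iff\<close>)
  qed
  have "isomorphic W E {0..<5} ?E"
    by (rule isomorphic_list[OF D set len]) (use main in \<open>auto simp: doubleton_eq_iff\<close>)
  moreover have "{0..<5} = {0..4 :: nat}" by auto
  ultimately show ?thesis by (simp add: F5_def)
qed

text \<open>The bound \<open>a \<le> l + 1\<close> makes \<open>a\<close> the smaller element of
  each pair \<open>{a, k + 2}\<close>, so the two elements can be matched in only one way.\<close>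

lemma doubleton_range_iff:
  fixes i j a l m :: nat
  assumes "i < j" "a \<le> l + 1"
  shows "{i, j} \<in> {{a, k + 2} | k. k \<in> {l..m}} \<longleftrightarrow> i = a \<and> l + 2 \<le> j \<and> j \<le> m + 2"
  using assms by (auto simp: doubleton_eq_iff intro!: exI[of _ "j - 2"])

lemma doubleton_less_iff:
  fixes i j a b :: nat
  assumes "i < j" "a < b"
  shows "{i, j} = {a, b} \<longleftrightarrow> i = a \<and> j = b"
  using assms by (auto simp: doubleton_eq_iff)

lemma F11_base_iff:
  assumes "i < j"
  shows "{i, j} \<in> F11_base \<longleftrightarrow> i = 0 \<and> 3 \<le> j \<and> j \<le> 10 \<or> i = 1 \<and> 3 \<le> j \<and> j \<le> 6 \<or> i = 2 \<and> 7 \<le> j \<and> j \<le> 10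
    \<or> i = 3 \<and> j = 4 \<or> i = 5 \<and> j = 6 \<or> i = 7 \<and> j = 8 \<or> i = 9 \<and> j = 10"
  unfolding F11_base_def Un_iff insert_iff empty_iff
  using doubleton_range_iff[OF assms, of 0 1 8] doubleton_range_iff[OF assms, of 1 1 4] doubleton_range_iff[OF assms, of 2 5 8]
  by (simp add: doubleton_less_iff[OF assms] numeral_3_eq_3)

lemma F12_base_iff:
  assumes "i < j"
  shows "{i, j} \<in> F12_base \<longleftrightarrow> i = 0 \<and> 3 \<le> j \<and> j \<le> 10 \<or> i = 1 \<and> 3 \<le> j \<and> j \<le> 6 \<or> i = 2 \<and> 7 \<le> j \<and> j \<le> 10
    \<or> i = 3 \<and> j = 4 \<or> i = 5 \<and> j = 6 \<or> i = 7 \<and> j = 8 \<or> i = 9 \<and> j = 11 \<or> i = 10 \<and> j = 11"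
  unfolding F12_base_def Un_iff insert_iff empty_iff
  using doubleton_range_iff[OF assms, of 0 1 8] doubleton_range_iff[OF assms, of 1 1 4] doubleton_range_iff[OF assms, of 2 5 8]
  by (simp add: doubleton_less_iff[OF assms] numeral_3_eq_3)

lemma exF11_iso:
  assumes "exF11 W" shows "\<exists>G \<in> F11. isomorphic W E (fst G) (snd G)"
proof -
  obtain y g p q r s h c d u v where tr: "tripod W y g p q r s h c d u v"
    and W: "W = {y, g, p, q, r, s, h, c, d, u, v}" and uv: "nb W u = {y, h, v}" "nb W v = {y, h, u}"
    and hg: "h \<notin> nb W g"
    using assms unfolding exF11_def by (elim exE conjE) (rule that; assumption)
  have D0: "distinct [y, g, p, q, r, s, h, c, d, u, v]"
    and N0: "nb W p = {y, g, q}" "nb W q = {y, g, p}" "nb W r = {y, g, s}" "nb W s = {y, g, r}"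
      "nb W c = {y, h, d}" "nb W d = {y, h, c}" using tr by (simp_all add: tripod_def)
  \<comment> \<open>The positions follow the numbering of \<open>F11\<close>: a, b_1, b_2, then c_1
    to c_8. \<open>L\<close> records which of the optional edges are present.\<close>
  define xs where "xs = [y, g, h, p, q, r, s, c, d, u, v]"
  define L where "L = (if {y, g} \<in> E then {{0, 1}} else {}) \<union> (if {y, h} \<in> E then {{0, 2}} else {} :: nat set set)"
  let ?E = "F11_base \<union> L"
  have D: "distinct xs" and len: "length xs = 11" and set: "set xs = W" using D0 W by (auto simp: xs_def)
  have CC: "{xs ! i, xs ! 3} \<in> E \<longleftrightarrow> i \<in> {0, 1, 4}" "{xs ! i, xs ! 4} \<in> E \<longleftrightarrow> i \<in> {0, 1, 3}"
    "{xs ! i, xs ! 5} \<in> E \<longleftrightarrow> i \<in> {0, 1, 6}" "{xs ! i, xs ! 6} \<in> E \<longleftrightarrow> i \<in> {0, 1, 5}"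
    "{xs ! i, xs ! 7} \<in> E \<longleftrightarrow> i \<in> {0, 2, 8}" "{xs ! i, xs ! 8} \<in> E \<longleftrightarrow> i \<in> {0, 2, 7}"
    "{xs ! i, xs ! 9} \<in> E \<longleftrightarrow> i \<in> {0, 2, 10}" "{xs ! i, xs ! 10} \<in> E \<longleftrightarrow> i \<in> {0, 2, 9}"
    if "i < 11" for i
    by (rule nth_edge[OF D set]; use that len in \<open>simp add: xs_def N0 uv\<close>)+
  have gh: "{xs ! 0, xs ! 1} \<in> E \<longleftrightarrow> {y, g} \<in> E" "{xs ! 0, xs ! 2} \<in> E \<longleftrightarrow> {y, h} \<in> E" "{xs ! 1, xs ! 2} \<notin> E"
    using hg W by (auto simp: nb_def xs_def)
  have Liff: "{i, j} \<in> L \<longleftrightarrow> i = 0 \<and> (j = 1 \<and> {y, g} \<in> E \<or> j = 2 \<and> {y, h} \<in> E)" if "i < j" for i j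
    using that by (auto simp: L_def doubleton_eq_iff)
  have main: "{xs ! i, xs ! j} \<in> E \<longleftrightarrow> {i, j} \<in> ?E" if ij: "i < j" "j < 11" for i j
  proof -
    have i: "i < 11" using ij by simp
    have "j = 1 \<and> i = 0 \<or> j = 2 \<and> i = 0 \<or> j = 2 \<and> i = 1 \<or> j = 3 \<or> j = 4 \<or> j = 5 \<or> j = 6 \<or> j = 7 \<or> j = 8 \<or> j = 9 \<or> j = 10"
      using ij by arith
    then show ?thesis unfolding Un_iff Liff[OF ij(1)] F11_base_iff[OF ij(1)]
      by (elim disjE conjE) (use ij CC[OF i] gh in auto)
  qed
  have "isomorphic W E {0..<11} ?E"
  proof (rule isomorphic_list[OF D set len])
    show "{i} \<notin> ?E" for i by (auto simp: F11_base_def L_def doubleton_eq_iff)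
  qed (fact main)
  moreover have "{0..<11} = {0..10 :: nat}" by auto
  moreover have "({0..10}, ?E) \<in> F11"
  proof -
    have "L \<subseteq> {{0,1},{0,2}}" by (auto simp: L_def)
    then show ?thesis unfolding F11_def by blast
  qed
  ultimately show ?thesis by (intro bexI[of _ "({0..10}, ?E)"]) simp_all
qed

lemma exF12_iso:
  assumes "exF12 W" shows "\<exists>G \<in> F12. isomorphic W E (fst G) (snd G)"
proof -
  obtain y g p q r s h c d u v z where tr: "tripod W y g p q r s h c d u v"
    and W: "W = {y, g, p, q, r, s, h, c, d, u, v, z}" and z: "z \<notin> {y, g, p, q, r, s, h, c, d, u, v}"
    and uv: "nb W u = {y, h, z}" "nb W v = {y, h, z}"
    and hg: "h \<notin> nb W g" "z \<notin> nb W g" and yhz: "y \<in> nb W z \<or> h \<in> nb W z"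
    using assms unfolding exF12_def by (elim exE conjE) (rule that; assumption)
  have D0: "distinct [y, g, p, q, r, s, h, c, d, u, v]"
    and N0: "nb W p = {y, g, q}" "nb W q = {y, g, p}" "nb W r = {y, g, s}" "nb W s = {y, g, r}"
      "nb W c = {y, h, d}" "nb W d = {y, h, c}" using tr by (simp_all add: tripod_def)
  define xs where "xs = [y, g, h, p, q, r, s, c, d, u, v, z]"
  define L where "L = (if {y, g} \<in> E then {{0, 1}} else {}) \<union> (if {y, h} \<in> E then {{0, 2}} else {})
    \<union> (if {y, z} \<in> E then {{0, 11}} else {}) \<union> (if {h, z} \<in> E then {{2, 11}} else {} :: nat set set)"
  let ?E = "F12_base \<union> L"
  have D: "distinct xs" and len: "length xs = 12" and set: "set xs = W" using D0 W z by (auto simp: xs_def)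
  have CC: "{xs ! i, xs ! 3} \<in> E \<longleftrightarrow> i \<in> {0, 1, 4}" "{xs ! i, xs ! 4} \<in> E \<longleftrightarrow> i \<in> {0, 1, 3}"
    "{xs ! i, xs ! 5} \<in> E \<longleftrightarrow> i \<in> {0, 1, 6}" "{xs ! i, xs ! 6} \<in> E \<longleftrightarrow> i \<in> {0, 1, 5}"
    "{xs ! i, xs ! 7} \<in> E \<longleftrightarrow> i \<in> {0, 2, 8}" "{xs ! i, xs ! 8} \<in> E \<longleftrightarrow> i \<in> {0, 2, 7}"
    "{xs ! i, xs ! 9} \<in> E \<longleftrightarrow> i \<in> {0, 2, 11}" "{xs ! i, xs ! 10} \<in> E \<longleftrightarrow> i \<in> {0, 2, 11}"
    if "i < 12" for i
    by (rule nth_edge[OF D set]; use that len in \<open>simp add: xs_def N0 uv\<close>)+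
  \<comment> \<open>The neighbourhood of \<open>z\<close> is not prescribed as a whole, so its edges
    to c_1 up to c_8 are read off from the neighbourhoods of the other ends.\<close>
  have C11: "{xs ! j, xs ! 11} \<in> E \<longleftrightarrow> j \<in> {9, 10}" if "3 \<le> j" "j \<le> 10" for j
  proof -
    have "j = 3 \<or> j = 4 \<or> j = 5 \<or> j = 6 \<or> j = 7 \<or> j = 8 \<or> j = 9 \<or> j = 10" using that by arith
    moreover have "{xs ! j, xs ! 11} = {xs ! 11, xs ! j}" by auto
    ultimately show ?thesis by (elim disjE) (simp_all add: CC)
  qed
  have gh: "{xs ! 0, xs ! 1} \<in> E \<longleftrightarrow> {y, g} \<in> E" "{xs ! 0, xs ! 2} \<in> E \<longleftrightarrow> {y, h} \<in> E" "{xs ! 1, xs ! 2} \<notin> E"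
    "{xs ! 0, xs ! 11} \<in> E \<longleftrightarrow> {y, z} \<in> E" "{xs ! 1, xs ! 11} \<notin> E" "{xs ! 2, xs ! 11} \<in> E \<longleftrightarrow> {h, z} \<in> E"
    using hg W by (simp_all add: nb_def xs_def)
  have Liff: "{i, j} \<in> L \<longleftrightarrow> i = 0 \<and> (j = 1 \<and> {y, g} \<in> E \<or> j = 2 \<and> {y, h} \<in> E \<or> j = 11 \<and> {y, z} \<in> E)
      \<or> i = 2 \<and> j = 11 \<and> {h, z} \<in> E" if "i < j" for i j
    using that by (auto simp: L_def doubleton_eq_iff)
  have main: "{xs ! i, xs ! j} \<in> E \<longleftrightarrow> {i, j} \<in> ?E" if ij: "i < j" "j < 12" for i j
  proof -
    have i: "i < 12" using ij by simp
    have "j = 1 \<and> i = 0 \<or> j = 2 \<and> i = 0 \<or> j = 2 \<and> i = 1 \<or> j = 3 \<or> j = 4 \<or> j = 5 \<or> j = 6 \<or> j = 7 \<or> j = 8 \<or> j = 9 \<or> j = 10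
      \<or> j = 11 \<and> i = 0 \<or> j = 11 \<and> i = 1 \<or> j = 11 \<and> i = 2 \<or> j = 11 \<and> 3 \<le> i \<and> i \<le> 10"
      using ij by arith
    then show ?thesis unfolding Un_iff Liff[OF ij(1)] F12_base_iff[OF ij(1)]
      by (elim disjE conjE) (use ij CC[OF i] C11[of i] gh in auto)
  qed
  have "isomorphic W E {0..<12} ?E"
  proof (rule isomorphic_list[OF D set len])
    show "{i} \<notin> ?E" for i by (auto simp: F12_base_def L_def doubleton_eq_iff)
  qed (fact main)
  moreover have "{0..<12} = {0..11 :: nat}" by auto
  moreover have "({0..11}, ?E) \<in> F12"
  proof -
    have "L \<subseteq> {{0,1},{0,2},{0,11},{2,11}}" by (auto simp: L_def)
    moreover have "{y, z} \<in> E \<or> {h, z} \<in> E" using yhz nb_edge(2) by blast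
    then have "L \<inter> {{0,11},{2,11}} \<noteq> {}" by (auto simp: L_def)
    ultimately show ?thesis unfolding F12_def by blast
  qed
  ultimately show ?thesis by (intro bexI[of _ "({0..11}, ?E)"]) simp_all
qed

lemma H_graph_edge_iff:
  fixes i j s t :: nat
  assumes "i < j" "2 \<le> s" "2 \<le> t"
  shows "{i, j} \<in> snd (H_graph s t ab) \<longleftrightarrow> 4 \<le> i \<and> j < s + 3 \<or> s + 3 \<le> i \<and> j < s + t + 2
    \<or> i = 0 \<and> 4 \<le> j \<and> j < s + t + 2 \<or> i = 1 \<and> 4 \<le> j \<and> j < s + t + 2 \<or> ab \<and> i = 0 \<and> j = 1
    \<or> i = 0 \<and> (j = 2 \<or> j = 3) \<or> i = 2 \<and> j = 3"
proof -
  have 1: "{i, j} \<in> {{x, y} | x y. x \<in> S \<and> y \<in> S \<and> x \<noteq> y} \<longleftrightarrow> i \<in> S \<and> j \<in> S" for S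
    using assms(1) by (auto simp: doubleton_eq_iff)
  have 2: "{i, j} \<in> {{a, x} | x. x \<in> H_S1 s \<or> x \<in> H_S2 s t} \<longleftrightarrow> i = a \<and> 4 \<le> j \<and> j < s + t + 2" if "a < 4" for a
    using assms that by (auto simp: doubleton_eq_iff H_S1_def H_S2_def)
  have 3: "{i, j} \<in> (if ab then {{0, 1}} else {}) \<longleftrightarrow> ab \<and> i = 0 \<and> j = 1"
    using assms(1) by (auto simp: doubleton_eq_iff)
  have 4: "{i, j} \<in> {{0, 2}, {0, 3}, {2, 3}} \<longleftrightarrow> i = 0 \<and> (j = 2 \<or> j = 3) \<or> i = 2 \<and> j = 3"
    using assms(1) by (auto simp: doubleton_eq_iff)
  have 5: "i \<in> H_S1 s \<and> j \<in> H_S1 s \<longleftrightarrow> 4 \<le> i \<and> j < s + 3" "i \<in> H_S2 s t \<and> j \<in> H_S2 s t \<longleftrightarrow> s + 3 \<le> i \<and> j < s + t + 2"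
    using assms(1) by (auto simp: H_S1_def H_S2_def)
  have 6: "{i, j} \<in> {{0, x} | x. x \<in> H_S1 s \<or> x \<in> H_S2 s t} \<longleftrightarrow> i = 0 \<and> 4 \<le> j \<and> j < s + t + 2"
    "{i, j} \<in> {{1, x} | x. x \<in> H_S1 s \<or> x \<in> H_S2 s t} \<longleftrightarrow> i = 1 \<and> 4 \<le> j \<and> j < s + t + 2"
    by (rule 2; simp)+
  show ?thesis
    unfolding H_graph_def snd_conv Un_iff 1 3 4 5 6 by (simp only: disj_assoc)
qed

lemma exH_iso:
  assumes "exH W" and fin: "finite W"
  shows "\<exists>G \<in> H_family (card W). isomorphic W E (fst G) (snd G)"
proof -
  obtain a b c d P Q where H: "distinct [a, b, c, d]" "{a, b, c, d} \<inter> (P \<union> Q) = {}" "P \<inter> Q = {}"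
    "P \<noteq> {}" "Q \<noteq> {}" "W = {a, b, c, d} \<union> (P \<union> Q)" "nb W c = {a, d}" "nb W d = {a, c}"
    "\<forall>x\<in>P. nb W x = insert a (insert b (P - {x}))"
    "\<forall>x\<in>Q. nb W x = insert a (insert b (Q - {x}))" "card P \<le> card Q"
    using assms(1) by (rule exH_E) (rule that; assumption)
  have fPQ: "finite P" "finite Q" using H(6) fin by auto
  obtain ps where ps: "set ps = P" "distinct ps" using finite_distinct_list[OF fPQ(1)] by blast
  obtain qs where qs: "set qs = Q" "distinct qs" using finite_distinct_list[OF fPQ(2)] by blast
  \<comment> \<open>The cliques of \<open>H_graph s t ab\<close> have orders \<open>s - 1\<close>
    and \<open>t - 1\<close>.\<close>
  define s t where "s = length ps + 1" and "t = length qs + 1"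
  define ab where "ab = ({a, b} \<in> E)"
  define xs where "xs = [a, b, c, d] @ ps @ qs"
  have lpq: "length ps = card P" "length qs = card Q" using ps qs distinct_card by force+
  have "0 < card P" "0 < card Q" using H(4,5) fPQ by (auto simp: card_gt_0_iff)
  then have st: "2 \<le> s" "s \<le> t" "2 \<le> t" using lpq H(11) by (auto simp: s_def t_def)
  have D: "distinct xs" using H(1-3) ps qs by (auto simp: xs_def)
  have set: "set xs = W" using H(6) ps qs by (auto simp: xs_def)
  have len: "length xs = s + t + 2" by (simp add: xs_def s_def t_def)
  have cW: "card W = s + t + 2" using distinct_card[OF D] set len by simp
  have x0: "xs ! 0 = a" "xs ! 1 = b" "xs ! 2 = c" "xs ! 3 = d" by (simp_all add: xs_def)
  have app: "xs ! i = (ps @ qs) ! (i - 4)" if "4 \<le> i" for i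
    using that nth_append[of "[a, b, c, d]" "ps @ qs" i] unfolding xs_def
    by (simp del: append_Cons add: numeral_eq_Suc)
  have inP: "xs ! i \<in> P \<longleftrightarrow> 4 \<le> i \<and> i < s + 3" and inQ: "xs ! i \<in> Q \<longleftrightarrow> s + 3 \<le> i" if "i < s + t + 2" for i
  proof -
    consider "i < 4" | "4 \<le> i" "i < s + 3" | "s + 3 \<le> i" by linarith
    then have "(xs ! i \<in> P \<longleftrightarrow> 4 \<le> i \<and> i < s + 3) \<and> (xs ! i \<in> Q \<longleftrightarrow> s + 3 \<le> i)"
    proof cases
      case 1
      then have "i = 0 \<or> i = 1 \<or> i = 2 \<or> i = 3" by arith
      then have "xs ! i \<in> {a, b, c, d}" using x0 by auto
      then have "xs ! i \<notin> P" "xs ! i \<notin> Q" using H(2) by auto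
      then show ?thesis using 1 st by simp
    next
      case 2
      then have l: "i - 4 < length ps" unfolding s_def by arith
      then have "xs ! i = ps ! (i - 4)" using app[OF 2(1)] nth_append[of ps qs "i - 4"] by simp
      then have "xs ! i \<in> P" using nth_mem[OF l] ps by simp
      then show ?thesis using 2 H(3) by auto
    next
      case 3
      then have l: "4 \<le> i" "\<not> i - 4 < length ps" "i - 4 - length ps < length qs"
        using that st unfolding s_def t_def by arith+
      then have "xs ! i = qs ! (i - 4 - length ps)" using app[OF l(1)] nth_append[of ps qs "i - 4"] by simp
      then have "xs ! i \<in> Q" using nth_mem[OF l(3)] qs by simp
      then show ?thesis using 3 H(3) by auto
    qed
    then show "xs ! i \<in> P \<longleftrightarrow> 4 \<le> i \<and> i < s + 3" "xs ! i \<in> Q \<longleftrightarrow> s + 3 \<le> i" by auto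
  qed
  have main: "{xs ! i, xs ! j} \<in> E \<longleftrightarrow> {i, j} \<in> snd (H_graph s t ab)" if ij: "i < j" "j < s + t + 2" for i j
  proof -
    have i: "i < s + t + 2" using ij by simp
    have inj: "xs ! i = xs ! k \<longleftrightarrow> i = k" if "k < s + t + 2" for k
      using nth_eq_iff_index_eq[OF D] i that len by simp
    have ne: "xs ! i = a \<longleftrightarrow> i = 0" "xs ! i = b \<longleftrightarrow> i = 1" "xs ! i = c \<longleftrightarrow> i = 2" "xs ! i = d \<longleftrightarrow> i = 3" "xs ! i \<noteq> xs ! j"
      using inj[of 0] inj[of 1] inj[of 2] inj[of 3] inj[OF ij(2)] x0 st ij by auto
    have e: "{xs ! i, xs ! j} \<in> E \<longleftrightarrow> xs ! i \<in> nb W (xs ! j)"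
      by (rule edge_nb) (use nth_mem[of i xs] i len set in simp)
    consider "j = 1" "i = 0" | "j = 2" | "j = 3" | "4 \<le> j" "j < s + 3" | "s + 3 \<le> j" using ij by linarith
    then show ?thesis
    proof cases
      case 1
      then show ?thesis unfolding H_graph_edge_iff[OF ij(1) st(1,3)] using x0 by (simp add: ab_def)
    next
      case 2
      then show ?thesis unfolding H_graph_edge_iff[OF ij(1) st(1,3)] e using x0 H(7) ne ij st by auto
    next
      case 3
      then show ?thesis unfolding H_graph_edge_iff[OF ij(1) st(1,3)] e using x0 H(8) ne ij st by auto
    next
      case 4
      then have "xs ! j \<in> P" using inP[OF ij(2)] by simp
      then have "nb W (xs ! j) = insert a (insert b (P - {xs ! j}))" using H(9) by blast
      then have "xs ! i \<in> nb W (xs ! j) \<longleftrightarrow> i = 0 \<or> i = 1 \<or> 4 \<le> i \<and> i < s + 3" using ne inP[OF i] by simp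
      then show ?thesis unfolding H_graph_edge_iff[OF ij(1) st(1,3)] e using 4 ij by auto
    next
      case 5
      then have "xs ! j \<in> Q" using inQ[OF ij(2)] by simp
      then have "nb W (xs ! j) = insert a (insert b (Q - {xs ! j}))" using H(10) by blast
      then have "xs ! i \<in> nb W (xs ! j) \<longleftrightarrow> i = 0 \<or> i = 1 \<or> s + 3 \<le> i" using ne inQ[OF i] by simp
      then show ?thesis unfolding H_graph_edge_iff[OF ij(1) st(1,3)] e using 5 ij st by auto
    qed
  qed
  have "isomorphic W E {0..<s + t + 2} (snd (H_graph s t ab))"
  proof (rule isomorphic_list[OF D set len])
    show "{i} \<notin> snd (H_graph s t ab)" for i
      by (auto simp: H_graph_def H_S1_def H_S2_def doubleton_eq_iff)
  qed (fact main)
  moreover have "fst (H_graph s t ab) = {0..<s + t + 2}" by (simp add: H_graph_def)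
  moreover have "H_graph s t ab \<in> H_family (card W)" using st cW unfolding H_family_def by auto
  ultimately show ?thesis by (intro bexI[of _ "H_graph s t ab"]) simp_all
qed

lemma exceptional_type_iso:
  assumes "finite W" "exceptional_type W"
  shows "\<exists>G \<in> exceptional (card W). isomorphic W E (fst G) (snd G)"
  using assms(2) exK2_iso exF5_iso exF11_iso exF12_iso exH_iso[OF _ assms(1)]
  unfolding exceptional_type_def exceptional_def by blast

end

section \<open>From the weight hypothesis to the degree condition\<close>

theorem theorem1p8:
  fixes V :: "'a set" and E :: "'a set set"
  assumes "graph V E"
    and "sigma_star V E \<ge> enat (card V)"
  shows "(\<exists>P. two_proper_partition V E P \<and> card P \<le> alpha_star V E)
       \<or> (\<exists>G \<in> exceptional (card V). isomorphic V E (fst G) (snd G))"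
proof (cases "V = {}")
  case True
  \<comment> \<open>On the empty graph no set is light, so \<open>alpha_star\<close> is
    \<open>Max {}\<close>, of which nothing is known. The empty partition has 0 parts and is within
    any bound.\<close>
  then have "two_proper_partition V E {}" by (auto simp: two_proper_partition_def is_partition_def)
  then show ?thesis by (intro disjI1 exI[of _ "{}"]) simp
next
  case False
  have fin: "finite V" using assms(1) by (simp add: graph_def)
  interpret loopless E
  proof
    fix v
    show "{v} \<notin> E"
    proof
      assume "{v} \<in> E"
      then obtain x y where "x \<noteq> y" "{v} = {x, y}" using assms(1) unfolding graph_def by meson
      then show False by (metis insertI1 insertI2 singletonD)
    qed
  qed
  have deg: "deg E v = dg V v" for v
  proof -
    have "u \<in> V" if e: "{v, u} \<in> E" for u
    proof -
      obtain x y where xy: "x \<in> V" "y \<in> V" "{v, u} = {x, y}"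
        using assms(1) e unfolding graph_def by meson
      have "u \<in> {v, u}" by simp
      then have "u \<in> {x, y}" using xy(3) by (simp only:)
      then show ?thesis using xy(1,2) by auto
    qed
    then have "{u. {v, u} \<in> E} = nb V v" by (auto simp: nb_def)
    then show ?thesis by (simp add: deg_def dg_def)
  qed
  have weight: "weight E I = wt V I" for I by (simp add: weight_def wt_def deg)
  have "0 < card V" using False fin by (simp add: card_gt_0_iff)
  have light: "light V E I \<longleftrightarrow> wt V I < card V" for I
    by (auto simp: light_def weight)
  have "degree_cond V {}"
    unfolding degree_cond_def
  proof (intro allI impI ballI; elim conjE)
    fix I v assume I: "I \<noteq> {}" "I \<subseteq> V - {}" "light_in V I" "v \<in> I"
    \<comment> \<open>If \<open>I\<close> were large, its weight would be at least
      \<open>sigma_star V E\<close> and hence at least the order, contrary to lightness.\<close>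
    have "\<not> large E I"
    proof
      assume "large E I"
      then have "sigma_star V E \<le> enat (weight E I)"
        unfolding sigma_star_def using I(3) by (intro INF_lower) (auto simp: light_in_def)
      then have "enat (card V) \<le> enat (weight E I)" using assms(2) by (rule order_trans[rotated])
      then show False using I(3) by (simp add: weight light_in_def)
    qed
    then have "card I \<le> delta_set E I" using I(1) by (simp add: large_def)
    also have "\<dots> \<le> deg E v"
      unfolding delta_set_def using I(2,4) fin finite_subset[of I V] by (intro Min_le) auto
    finally show "card I + card {} \<le> dg V v" by (simp add: deg)
  qed
  then have "partitionable V {} \<or> exceptional_type V" using marked_partition[OF fin False, of "{}"] by simp
  then show ?thesis
  proof
    assume "partitionable V {}"
    then obtain P I where P: "two_proper_partition V E P" and I: "light_in V I" "card P \<le> card I"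
      by (auto simp: partitionable_def)
    have "{I. indep V E I \<and> light V E I} \<subseteq> Pow V" by (auto simp: indep_def)
    then have "finite {I. indep V E I \<and> light V E I}" using fin by (simp add: finite_subset)
    then have "finite {card I | I. indep V E I \<and> light V E I}" by simp
    then have "card I \<le> alpha_star V E"
      unfolding alpha_star_def by (rule Max_ge) (use I(1) light in \<open>auto simp: light_in_def\<close>)
    then show ?thesis using P I(2) by auto
  next
    assume "exceptional_type V"
    then show ?thesis using exceptional_type_iso[OF fin] by simp
  qed
qed

end
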